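(* Suppose that $P\in\mathbb{C}[x,y]$ can be parametrized by $x=f(t)=\lambda_1\prod_r(t-\alpha_r)^{l_r}$ and $y=g(t)=\lambda_2\prod_s(t-\beta_s)^{m_s}$, where $\lambda_1,\lambda_2\in\mathbb{C}^*$, the $\alpha_r\in\mathbb{C}$ are distinct, the $\beta_s\in\mathbb{C}$ are distinct, and the $l_r,m_s$ are non-zero integers. Let $S$ consist of those points in the zero-locus of $P$ for which $|x|=1$ and $|y|\ge 1$, and let $\gamma_1,\ldots,\gamma_n\subset\mathbb{P}^1(\mathbb{C})$ be the paths which map to $S$ under $t\mapsto(f(t),g(t))$, oriented via $f(\gamma_j)\subset T^1$ (the unit circle with its usual orientation). If $u_j$ and $v_j$ denote the initial and terminal points of $\gamma_j$, and $P(x,y)$ has leading coefficient $\lambda(x)$ as a polynomial in $y$, then $$2\pi m(P) = 2\pi m(\lambda(x)) + \sum_{j=1}^n \Bigg[{\sum_{r,s}}' l_rm_s \left( D\left(\frac{u_j-\alpha_r}{\beta_s-\alpha_r} \right) - D\left(\frac{v_j-\alpha_r}{\beta_s-\alpha_r} \right) \right) + \sum_r l_r \log|\tilde{g}(\alpha_r)| \cdot \mathrm{wind}(\gamma_j,\alpha_r) - \sum_s m_s \log|\tilde{f}(\beta_s)| \cdot \mathrm{wind}(\gamma_j,\beta_s) \Bigg],$$ where ${\sum}'$ denotes the sum over all pairs $(r,s)$ with $\alpha_r\neq\beta_s$.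
   Context: Mahler measure: for $P\in\mathbb{C}[x_1,\dots,x_n]$, $m(P)=\frac{1}{(2\pi i)^n}\int_{T^n}\log|P(x_1,\dots,x_n)|\,\frac{dx_1}{x_1}\cdots\frac{dx_n}{x_n}$, where $T^n=\{|x_1|=\cdots=|x_n|=1\}$. Parametrizable: $P\in\mathbb{C}[x,y]$ is parametrizable if it is irreducible and there exist $f,g\in\mathbb{C}(t)$ such that $t\mapsto(f(t),g(t))$ is a bijection (except at singular points) between $\mathbb{P}^1(\mathbb{C})$ and the projective curve defined by $P$; in particular $P(f(t),g(t))\equiv0$. One then says that $P$ is parametrized by $f,g$. Dilogarithm: $D$ is the Bloch-Wigner dilogarithm, $D(z)=\mathrm{Im}(\mathrm{Li}_2(z))+\log|z|\arg(1-z)$ for $z\in\mathbb{C}\smallsetminus[1,\infty)$, extended continuously to $\mathbb{P}^1(\mathbb{C})$; it vanishes on the real axis and at $\infty$. Paths: the set of all points with $|x|=1$ on the projective curve defined by $P$ (points at infinity included) consists of one or more closed loops, oriented compatibly, via the $x$-coordinate, with the usual orientation of $T^1$. Let $\gamma\subset\mathbb{P}^1(\mathbb{C})$ be the oriented pullback of this set under $t\mapsto(f(t),g(t))$. The $\gamma_1,\dots,\gamma_n$ are the oriented paths which comprise those portions of $\gamma$ where $|g(t)|\ge1$. If some $\gamma_j$ is a closed loop, any point of it may be chosen to serve as both endpoints, $u_j=v_j$. Tilde notation: $\tilde g(\alpha_r)=\lambda_2\prod_{s:\,\beta_s\neq\alpha_r}(\alpha_r-\beta_s)^{m_s}$ and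 $\tilde f(\beta_s)=\lambda_1\prod_{r:\,\alpha_r\neq\beta_s}(\beta_s-\alpha_r)^{l_r}$, i.e. a factor that would vanish (or be infinite) is omitted before evaluating. Winding angle: $\mathrm{wind}(\gamma_j,a)=\mathrm{Im}\int_{\gamma_j}\frac{dt}{t-a}$, understood as a limiting value if $\gamma_j$ passes through $a$ or $\infty$. If $\beta_s\in\gamma_j$, then $|\tilde f(\beta_s)|=|f(\beta_s)|=1$ and the term $\log|\tilde f(\beta_s)|\cdot\mathrm{wind}(\gamma_j,\beta_s)$ is $0$. *)

theory Defs
  imports
    "HOL-Complex_Analysis.Complex_Analysis"
    "HOL-Computational_Algebra.Computational_Algebra"
    "HOL-Computational_Algebra.Field_as_Ring"
begin

section \<open>Mahler measure\<close>

text \<open>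
  An element of \<open>\<complex>[x,y]\<close> is a \<^typ>\<open>complex poly poly\<close>, i.e. a polynomial in \<open>y\<close> whose
  coefficients are polynomials in \<open>x\<close>; its leading coefficient as a polynomial in \<open>y\<close> is thus
  \<^const>\<open>lead_coeff\<close>.
\<close>

definition eval2 :: "complex poly poly \<Rightarrow> complex \<Rightarrow> complex \<Rightarrow> complex" where
  "eval2 P x y = poly (poly P [:y:]) x"

text \<open>
  With \<open>x\<^sub>k = exp (i \<theta>\<^sub>k)\<close> one has \<open>dx\<^sub>k / x\<^sub>k = i d\<theta>\<^sub>k\<close>, so the normalisation \<open>1 / (2\<pi>i)\<^sup>n\<close> of the
  integral over the torus becomes \<open>1 / (2\<pi>)\<^sup>n\<close>. The zeros of a nonzero polynomial form a null
  set of the torus, so the convention \<open>ln 0 = 0\<close> is irrelevant.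
\<close>

definition mahler1 :: "complex poly \<Rightarrow> real" where
  "mahler1 p = 1 / (2 * pi) *
     (LINT \<theta>:{0..2 * pi}|lborel. ln (cmod (poly p (cis \<theta>))))"

definition mahler2 :: "complex poly poly \<Rightarrow> real" where
  "mahler2 P = 1 / (2 * pi) ^ 2 *
     (LINT \<theta>:{0..2 * pi} \<times> {0..2 * pi}|lborel.
        ln (cmod (eval2 P (cis (fst \<theta>)) (cis (snd \<theta>)))))"


section \<open>The Riemann sphere and rational functions on it\<close>

text \<open>\<open>\<P>\<^sup>1(\<complex>)\<close> is \<^typ>\<open>complex option\<close>, with \<^const>\<open>None\<close> as the point at infinity.\<close>

definition riemann_sphere :: "complex option topology" where
  "riemann_sphere = Alexandroff_compactification euclidean"

text \<open>
  \<^const>\<open>quot_of_fract\<close> returns a coprime numerator and denominator, so the value is correct at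
  every point. At infinity, the coefficient of \<open>p\<close> is zero if \<open>degree p < degree q\<close>.
\<close>

definition ratfun_at :: "complex poly fract \<Rightarrow> complex option \<Rightarrow> complex option" where
  "ratfun_at f t = (let (p, q) = quot_of_fract f in
     case t of
       Some z \<Rightarrow> if poly q z = 0 then None else Some (poly p z / poly q z)
     | None \<Rightarrow> if degree q < degree p then None
               else Some (coeff p (degree q) / lead_coeff q))"

text \<open>The rational function \<open>c \<Prod>\<^sub>k\<^sub><\<^sub>n (t - a\<^sub>k)\<^bsup>e\<^sub>k\<^esup>\<close>.\<close>

definition factored_fract ::
    "complex \<Rightarrow> nat \<Rightarrow> (nat \<Rightarrow> complex) \<Rightarrow> (nat \<Rightarrow> int) \<Rightarrow> complex poly fract" where
  "factored_fract c n a e = to_fract [:c:] * (\<Prod>k<n. to_fract [:- a k, 1:] powi e k)"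

text \<open>The value at \<open>z\<close> of the same product, with the factor vanishing at \<open>z\<close> (if any) omitted.\<close>

definition tilde_at ::
    "complex \<Rightarrow> nat \<Rightarrow> (nat \<Rightarrow> complex) \<Rightarrow> (nat \<Rightarrow> int) \<Rightarrow> complex \<Rightarrow> complex" where
  "tilde_at c n a e z = c * (\<Prod>k\<in>{k. k < n \<and> a k \<noteq> z}. (z - a k) powi e k)"


section \<open>Parametrized plane curves\<close>

definition total_degree :: "complex poly poly \<Rightarrow> nat" where
  "total_degree P = Max {i + j |i j. coeff (coeff P j) i \<noteq> 0}"

definition homogenization ::
    "complex poly poly \<Rightarrow> complex \<Rightarrow> complex \<Rightarrow> complex \<Rightarrow> complex" where
  "homogenization P X Y Z =
     (\<Sum>j\<le>degree P. \<Sum>i\<le>degree (coeff P j).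
        coeff (coeff P j) i * X ^ i * Y ^ j * Z ^ (total_degree P - (i + j)))"

text \<open>
  A point of \<open>\<P>\<^sup>2(\<complex>)\<close> is the set of all its homogeneous coordinate triples; the affine point
  \<open>(x, y)\<close> is \<open>[x : y : 1]\<close>.
\<close>

definition proj_point :: "complex \<Rightarrow> complex \<Rightarrow> complex \<Rightarrow> (complex \<times> complex \<times> complex) set" where
  "proj_point X Y Z = {(c * X, c * Y, c * Z) |c. c \<noteq> 0}"

definition proj_curve :: "complex poly poly \<Rightarrow> (complex \<times> complex \<times> complex) set set" where
  "proj_curve P = {proj_point X Y Z |X Y Z.
     (X, Y, Z) \<noteq> (0, 0, 0) \<and> homogenization P X Y Z = 0}"

definition singular_points :: "complex poly poly \<Rightarrow> (complex \<times> complex \<times> complex) set set" where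
  "singular_points P = {proj_point X Y Z |X Y Z.
     (X, Y, Z) \<noteq> (0, 0, 0) \<and> homogenization P X Y Z = 0 \<and>
     deriv (\<lambda>W. homogenization P W Y Z) X = 0 \<and>
     deriv (\<lambda>W. homogenization P X W Z) Y = 0 \<and>
     deriv (\<lambda>W. homogenization P X Y W) Z = 0}"

text \<open>
  The map \<open>t \<mapsto> [f(t) : g(t) : 1]\<close>, extended to all of \<open>\<P>\<^sup>1(\<complex>)\<close>: \<open>f = A / C\<close> and \<open>g = B / C\<close> with
  \<open>C\<close> the least common denominator, so that \<open>A\<close>, \<open>B\<close>, \<open>C\<close> have no common zero; at infinity their
  coefficients in the largest occurring degree are taken.
\<close>

definition param_point ::
    "complex poly fract \<Rightarrow> complex poly fract \<Rightarrow> complex option \<Rightarrow>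
     (complex \<times> complex \<times> complex) set" where
  "param_point f g t =
     (let (p, q) = quot_of_fract f;
          (p', q') = quot_of_fract g;
          C = lcm q q';
          A = p * (C div q);
          B = p' * (C div q');
          d = Max {degree A, degree B, degree C};
          val = (\<lambda>h. case t of Some z \<Rightarrow> poly h z | None \<Rightarrow> coeff h d)
      in proj_point (val A) (val B) (val C))"

text \<open>
  A bijection except at singular points: every point of the curve is attained, and every
  nonsingular one exactly once.
\<close>

definition parametrized_by ::
    "complex poly poly \<Rightarrow> complex poly fract \<Rightarrow> complex poly fract \<Rightarrow> bool" where
  "parametrized_by P f g \<longleftrightarrow>
     irreducible P \<and>
     range (param_point f g) = proj_curve P \<and>
     inj_on (param_point f g) {t. param_point f g t \<notin> singular_points P}"


section \<open>The Bloch-Wigner dilogarithm\<close>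

text \<open>\<open>Li\<^sub>2(z) = - \<integral>\<^sub>0\<^sup>z log(1 - u) du/u\<close> along the segment from 0, for \<open>z\<close> outside \<open>[1,\<infinity>)\<close>.\<close>

definition Li2 :: "complex \<Rightarrow> complex" where
  "Li2 z = - contour_integral (linepath 0 z) (\<lambda>u. Ln (1 - u) / u)"

text \<open>The continuous extension to \<open>[1,\<infinity>)\<close> and to the point at infinity is by zero.\<close>

definition bloch_wigner :: "complex option \<Rightarrow> real" where
  "bloch_wigner t = (case t of
     None \<Rightarrow> 0
   | Some z \<Rightarrow> if z \<in> \<real> \<and> 1 \<le> Re z then 0
               else Im (Li2 z) + ln (cmod z) * Arg (1 - z))"


section \<open>Paths\<close>

text \<open>
  The parameters \<open>t\<close> for which \<open>(f(t), g(t))\<close> satisfies \<open>\<bar>x\<bar> = 1\<close> and \<open>\<bar>y\<bar> \<ge> 1\<close>; the case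
  \<open>y = \<infinity>\<close> is included.
\<close>

definition unit_locus :: "complex poly fract \<Rightarrow> complex poly fract \<Rightarrow> complex option set" where
  "unit_locus f g =
     {t. (\<exists>x. ratfun_at f t = Some x \<and> cmod x = 1) \<and>
         (case ratfun_at g t of None \<Rightarrow> True | Some y \<Rightarrow> 1 \<le> cmod y)}"

text \<open>
  Continuous on the sphere, and continuously differentiable away from finitely many parameters;
  among the latter are those at which the path passes through infinity.
\<close>

definition sphere_path :: "(real \<Rightarrow> complex option) \<Rightarrow> bool" where
  "sphere_path \<gamma> \<longleftrightarrow>
     pathin riemann_sphere \<gamma> \<and>
     (\<exists>K c. finite K \<and> c C1_differentiable_on ({0..1} - K) \<and>
        (\<forall>s\<in>{0..1} - K. \<gamma> s = Some (c s)))"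

text \<open>The image under \<open>f\<close> runs along the unit circle counterclockwise.\<close>

definition oriented_via :: "complex poly fract \<Rightarrow> (real \<Rightarrow> complex option) \<Rightarrow> bool" where
  "oriented_via f \<gamma> \<longleftrightarrow>
     (\<exists>\<theta>::real \<Rightarrow> real. continuous_on {0..1} \<theta> \<and> strict_mono_on {0..1} \<theta> \<and>
        (\<forall>s\<in>{0..1}. ratfun_at f (\<gamma> s) = Some (cis (\<theta> s))))"

text \<open>
  The paths \<open>\<gamma>\<^sub>0, \<dots>, \<gamma>\<^sub>n\<^sub>-\<^sub>1\<close> make up the locus: every point of it is passed exactly once, up to
  finitely many exceptions (common endpoints, the base point of a closed loop, crossings at
  critical points of \<open>f\<close>, isolated points of the locus).
\<close>

definition paths_comprising ::
    "complex poly fract \<Rightarrow> complex poly fract \<Rightarrow> nat \<Rightarrow> (nat \<Rightarrow> real \<Rightarrow> complex option) \<Rightarrow> bool" where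
  "paths_comprising f g n \<gamma> \<longleftrightarrow>
     (\<forall>j<n. sphere_path (\<gamma> j) \<and> oriented_via f (\<gamma> j) \<and> \<gamma> j ` {0..1} \<subseteq> unit_locus f g) \<and>
     finite {t \<in> unit_locus f g. \<not> (\<exists>!(j, s). j < n \<and> s \<in> {0..1} \<and> \<gamma> j s = t)}"

text \<open>
  \<open>Im \<integral> dt / (t - a)\<close> along \<open>\<gamma>\<close>. The Henstock-Kurzweil integral agrees with the improper one, so
  this is the limiting value if \<open>\<gamma>\<close> passes through \<open>a\<close> or infinity; the imaginary part is taken
  inside since the real part diverges there. Finitely many parameters do not affect it.
\<close>

definition wind :: "(real \<Rightarrow> complex option) \<Rightarrow> complex \<Rightarrow> real" where
  "wind \<gamma> a = integral {0..1}
     (\<lambda>s. Im (vector_derivative (\<lambda>s. the (\<gamma> s)) (at s) / (the (\<gamma> s) - a)))"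

end

theory Submission
  imports Defs "HOL-Real_Asymp.Real_Asymp"
begin

text \<open>
  Jensen's formula in the variable \<open>y\<close> turns \<open>m (P)\<close> into the integral of \<open>\<Sum> log\<^sup>+ \<bar>y\<bar>\<close> over the
  roots \<open>y\<close> of \<open>P (x, y)\<close> for \<open>x\<close> on the unit circle. For all but finitely many \<open>x\<close> these roots are
  simple and correspond bijectively, via \<open>g\<close>, to the parameters \<open>t\<close> with \<open>f (t) = x\<close>, so the integral
  equals the sum over the paths of \<open>\<integral> log \<bar>g\<bar> d arg f\<close>. As \<open>\<bar>f\<bar> = 1\<close> on the paths, the integrand is
  \<open>log \<bar>g\<bar> d arg f - log \<bar>f\<bar> d arg g\<close>, which is bilinear in the factorizations of \<open>f\<close> and \<open>g\<close> and is
  integrated by means of \<open>dD (z) = log \<bar>z\<bar> d arg (1 - z) - log \<bar>1 - z\<bar> d arg z\<close>.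
\<close>

section \<open>The Bloch-Wigner dilogarithm\<close>

text \<open>The paths may run through infinity and through points \<open>\<beta> s\<close>, and they
  are continuously differentiable only off finitely many parameters, so derivatives can be unbounded
  and single terms can diverge. Two things absorb this. The dilogarithm is continuous on the whole
  sphere; the dilogarithm terms therefore form a continuous primitive, and the Henstock-Kurzweil
  fundamental theorem tolerates finitely many exceptional parameters without integrability being
  known beforehand. Absolute integrability, needed for the substitution from the path parameter to
  the angle of x and for Fubini, comes from signs: log |g| is nonnegative on the paths, and arg f
  increases along them. The tilde values come from the argument of the dilogarithm: differentiating
  D((t - \<alpha>)/(\<beta> - \<alpha>)) produces constants log |\<beta> - \<alpha>| next to log |t
  - \<alpha>| and log |t - \<beta>|. Weighted with the exponents, these constants add up to the
  logarithms of the tilde products, paired with the winding angles. For \<alpha> = \<beta> the two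
  terms of the bilinear form cancel, which is why such pairs are left out.\<close>

lemma has_vector_derivative_cong_nhds:
  assumes "(f has_vector_derivative D) (at s)" "eventually (\<lambda>x. f x = g x) (nhds s)"
  shows "(g has_vector_derivative D) (at s)"
proof -
  obtain A where "open A" "s \<in> A" "\<And>x. x \<in> A \<Longrightarrow> f x = g x"
    using assms(2) unfolding eventually_nhds by blast
  thus ?thesis
    using has_vector_derivative_transform_within_open[OF assms(1)] by blast
qed

lemma isCont_cong_nhds:
  "isCont f z \<Longrightarrow> eventually (\<lambda>x. f x = g x) (nhds z) \<Longrightarrow> isCont g z"
  using isCont_cong by blast

section \<open>Differentiation along curves\<close>

lemma has_vector_derivative_inverse_at:
  fixes c :: "real \<Rightarrow> complex"
  assumes "(c has_vector_derivative c') (at s)" "c s \<noteq> 0"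
  shows "((\<lambda>s. inverse (c s)) has_vector_derivative (- c' / (c s)\<^sup>2)) (at s)"
proof -
  have "(inverse \<circ> c has_vector_derivative c' * - (inverse (c s) ^ Suc (Suc 0))) (at s)"
    by (rule field_vector_diff_chain_at[OF assms(1) DERIV_inverse[OF assms(2)]])
  moreover have "c' * - (inverse (c s) ^ Suc (Suc 0)) = - c' / (c s)\<^sup>2"
    by (simp add: divide_inverse power2_eq_square)
  ultimately show ?thesis by (simp add: o_def)
qed

lemma has_vector_derivative_isCont:
  "(c has_vector_derivative c') (at s) \<Longrightarrow> isCont c s"
  using has_vector_derivative_continuous by blast

lemma isCont_eventually_nhds:
  assumes "isCont c s" "open A" "c s \<in> A"
  shows "eventually (\<lambda>x. c x \<in> A) (nhds s)"
  using assms by (simp add: continuous_within topological_tendstoD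
      eventually_nhds_conv_at)

lemma has_vector_derivative_Re:
  "(c has_vector_derivative c') F \<Longrightarrow> ((\<lambda>s. Re (c s)) has_vector_derivative Re c') F"
  by (rule bounded_linear.has_vector_derivative[OF bounded_linear_Re])

lemma has_vector_derivative_Im:
  "(c has_vector_derivative c') F \<Longrightarrow> ((\<lambda>s. Im (c s)) has_vector_derivative Im c') F"
  by (rule bounded_linear.has_vector_derivative[OF bounded_linear_Im])

lemma has_vector_derivative_Ln:
  assumes "(c has_vector_derivative c') (at s)" "c s \<notin> \<real>\<^sub>\<le>\<^sub>0"
  shows "((\<lambda>s. Ln (c s)) has_vector_derivative (c' / c s)) (at s)"
  using field_vector_diff_chain_at[OF assms(1) has_field_derivative_Ln[OF assms(2)]]
  by (simp add: o_def divide_inverse)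

lemma has_vector_derivative_ln_cmod:
  assumes c: "(c has_vector_derivative c') (at s)" and nz: "c s \<noteq> 0"
  shows "((\<lambda>s. ln (cmod (c s))) has_vector_derivative Re (c' / c s)) (at s)"
proof -
  \<comment> \<open>Dividing by the nonzero value \<open>c s\<close> brings the argument of
    \<open>Ln\<close> to 1 at \<open>s\<close>, away from the branch cut, wherever
    \<open>c s\<close> lies.\<close>
  have "((\<lambda>x. Re (Ln (c x / c s)) + ln (cmod (c s))) has_vector_derivative Re (c' / c s)) (at s)"
    using nz by (auto intro!: derivative_eq_intros has_vector_derivative_Re
        has_vector_derivative_Ln[THEN has_vector_derivative_eq_rhs] c
        has_vector_derivative_divide)
  moreover have "eventually (\<lambda>x. c x \<noteq> 0) (nhds s)"
    using isCont_eventually_nhds[OF has_vector_derivative_isCont[OF c], of "- {0}"] nz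
    by auto
  hence "eventually (\<lambda>x. Re (Ln (c x / c s)) + ln (cmod (c s)) = ln (cmod (c x))) (nhds s)"
    by eventually_elim (simp add: nz norm_divide ln_div)
  ultimately show ?thesis
    by (rule has_vector_derivative_cong_nhds)
qed

lemma open_slit: "open {z::complex. 1 - z \<notin> \<real>\<^sub>\<le>\<^sub>0}"
proof -
  have "open ((\<lambda>z::complex. 1 - z) -` (- \<real>\<^sub>\<le>\<^sub>0))"
    by (intro open_vimage continuous_intros) (auto simp: open_Compl)
  thus ?thesis by (simp add: vimage_def)
qed

lemma not_nonpos_Reals_slit_iff: "1 - z \<notin> \<real>\<^sub>\<le>\<^sub>0 \<longleftrightarrow> \<not> (z \<in> \<real> \<and> 1 \<le> Re z)"
  by (auto simp: complex_nonpos_Reals_iff complex_is_Real_iff)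

text \<open>The plane slit along [1,\<infinity>) is starlike about 0, so the integrand, holomorphic
  once its removable singularity is filled, has a primitive there, and the integral along the
  segment from 0 evaluates it.\<close>

lemma Li2_has_field_derivative:
  assumes z: "1 - z \<notin> \<real>\<^sub>\<le>\<^sub>0"
  shows "(Li2 has_field_derivative (if z = 0 then 1 else - Ln (1 - z) / z)) (at z)"
proof -
  define S where "S = {z::complex. 1 - z \<notin> \<real>\<^sub>\<le>\<^sub>0}"
  \<comment> \<open>-1 is the limit at 0. The integrand of \<open>Li2\<close> itself has the value 0
    there, because division by zero gives 0; the two differ at one point, which the contour integral
    ignores.\<close>
  define h where "h = (\<lambda>u::complex. if u = 0 then -1 else Ln (1 - u) / u)"
  have S: "open S" unfolding S_def by (rule open_slit)
  have seg: "closed_segment 0 y \<subseteq> S" if "y \<in> S" for y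
  proof
    fix x assume "x \<in> closed_segment 0 y"
    then obtain t where t: "0 \<le> t" "t \<le> 1" "x = t *\<^sub>R y"
      by (auto simp: in_segment)
    show "x \<in> S"
    proof (rule ccontr)
      assume "x \<notin> S"
      hence "t * Re y \<ge> 1" "t * Im y = 0"
        by (auto simp: S_def t complex_nonpos_Reals_iff)
      moreover from this have "t > 0" using t by (cases "t = 0") auto
      moreover have "Re y \<ge> 1"
      proof (rule ccontr)
        assume "\<not> Re y \<ge> 1"
        hence "t * Re y < t * 1" using \<open>t > 0\<close> by (intro mult_strict_left_mono) auto
        thus False using \<open>t * Re y \<ge> 1\<close> t by simp
      qed
      ultimately show False using that
        by (auto simp: S_def complex_nonpos_Reals_iff)
    qed
  qed
  have star: "starlike S"
    unfolding starlike_def using seg by (intro bexI[of _ 0]) (auto simp: S_def)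
  have d0: "((\<lambda>u. Ln (1 - u)) has_field_derivative -1) (at 0)"
    by (auto intro!: derivative_eq_intros)
  have lim0: "(h \<longlongrightarrow> -1) (at 0)"
    using d0 unfolding has_field_derivative_iff
    by (rule tendsto_cong[THEN iffD1, rotated]) (auto simp: eventually_at_filter h_def)
  have diff: "h field_differentiable at u" if "u \<in> S - {0}" for u
  proof -
    have "((\<lambda>u. Ln (1 - u) / u) has_field_derivative
            (- 1 / (1 - u) * u - Ln (1 - u)) / (u * u)) (at u)"
      using that by (auto intro!: derivative_eq_intros simp: S_def divide_inverse algebra_simps)
    moreover have "eventually (\<lambda>v. Ln (1 - v) / v = h v) (nhds u)"
      using that by (intro eventually_mono[OF t1_space_nhds[of u 0]]) (auto simp: h_def)
    ultimately show ?thesis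
      unfolding field_differentiable_def
      using DERIV_cong_ev[OF refl _ refl, of "\<lambda>u. Ln (1 - u) / u" h u] by blast
  qed
  have cont: "continuous_on S h"
  proof (rule continuous_at_imp_continuous_on, rule ballI)
    fix u assume u: "u \<in> S"
    show "isCont h u"
    proof (cases "u = 0")
      case True
      thus ?thesis using lim0 by (simp add: isCont_def h_def)
    next
      case False
      thus ?thesis using diff u field_differentiable_imp_continuous_at by blast
    qed
  qed
  obtain G where G: "\<And>x. x \<in> S \<Longrightarrow> (G has_field_derivative h x) (at x)"
    using holomorphic_starlike_primitive[OF cont star S, of "{0}"] diff by blast
  have eq: "- (G x - G 0) = Li2 x" if "x \<in> S" for x
  proof -
    have "(h has_contour_integral (G (pathfinish (linepath 0 x)) - G (pathstart (linepath 0 x))))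
            (linepath 0 x)"
      using seg[OF that] G
      by (intro contour_integral_primitive[of S] valid_path_linepath)
         (auto simp only: path_image_linepath intro: has_field_derivative_at_within)
    hence "contour_integral (linepath 0 x) h = G x - G 0"
      by (simp add: contour_integral_unique)
    moreover have "contour_integral (linepath 0 x) h =
                   contour_integral (linepath 0 x) (\<lambda>u. Ln (1 - u) / u)"
    proof (cases "x = 0")
      case True thus ?thesis by simp
    next
      case False
      thus ?thesis
        by (intro contour_integral_spike_finite_simple_path[of "{0}"]) (auto simp: h_def)
    qed
    ultimately show ?thesis by (simp add: Li2_def)
  qed
  have "((\<lambda>x. - (G x - G 0)) has_field_derivative - h z) (at z)"
    using G[of z] z by (auto intro!: derivative_eq_intros simp: S_def)
  moreover have "eventually (\<lambda>x. - (G x - G 0) = Li2 x) (nhds z)"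
    using eventually_nhds_in_open[OF S, of z] z eq by (auto elim!: eventually_mono simp: S_def)
  ultimately have "(Li2 has_field_derivative - h z) (at z)"
    using DERIV_cong_ev[OF refl _ refl, of "\<lambda>x. - (G x - G 0)" Li2 z] by blast
  thus ?thesis by (simp add: h_def split: if_splits)
qed

lemma bloch_wigner_slit:
  assumes "1 - z \<notin> \<real>\<^sub>\<le>\<^sub>0"
  shows "bloch_wigner (Some z) = Im (Li2 z) + ln (cmod z) * Im (Ln (1 - z))"
proof -
  have "1 - z \<noteq> 0" using assms by auto
  thus ?thesis using assms unfolding not_nonpos_Reals_slit_iff by (auto simp: bloch_wigner_def Arg_eq_Im_Ln)
qed

text \<open>The term \<open>Re (c' / c s) * Im (Ln (1 - c s))\<close>, produced by the product rule,
  cancels against a part of the derivative of \<open>Im (Li2 (c s))\<close>. What remains involves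
  only the modulus of \<open>1 - c s\<close> and so has no branch cut.\<close>

lemma bloch_wigner_deriv_slit:
  assumes c: "(c has_vector_derivative c') (at s)" and z: "1 - c s \<notin> \<real>\<^sub>\<le>\<^sub>0" "c s \<noteq> 0"
  shows "((\<lambda>s. bloch_wigner (Some (c s))) has_vector_derivative
     (ln (cmod (c s)) * Im (c' / (c s - 1)) - ln (cmod (1 - c s)) * Im (c' / c s))) (at s)"
proof -
  have L: "((\<lambda>s. Li2 (c s)) has_vector_derivative c' * (- Ln (1 - c s) / c s)) (at s)"
    using field_vector_diff_chain_at[OF c Li2_has_field_derivative[OF z(1)]] z
    by (simp add: o_def)
  have M: "((\<lambda>s. Ln (1 - c s)) has_vector_derivative (- c') / (1 - c s)) (at s)"
    using z c by (intro has_vector_derivative_Ln) (auto intro!: derivative_eq_intros)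
  have A: "((\<lambda>s. Im (Li2 (c s)) + ln (cmod (c s)) * Im (Ln (1 - c s))) has_vector_derivative
     (Im (c' * (- Ln (1 - c s) / c s)) + (ln (cmod (c s)) * Im ((- c') / (1 - c s)) +
       Re (c' / c s) * Im (Ln (1 - c s))))) (at s)"
    by (intro has_vector_derivative_add has_vector_derivative_Im L
       has_vector_derivative_mult has_vector_derivative_ln_cmod M c z)
  have ev: "eventually (\<lambda>x. 1 - c x \<notin> \<real>\<^sub>\<le>\<^sub>0) (nhds s)"
  proof -
    have "eventually (\<lambda>x. c x \<in> {z. 1 - z \<notin> \<real>\<^sub>\<le>\<^sub>0}) (nhds s)"
      using z by (intro isCont_eventually_nhds[OF has_vector_derivative_isCont[OF c] open_slit]) auto
    thus ?thesis by simp
  qed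
  from ev have B: "eventually (\<lambda>x. Im (Li2 (c x)) + ln (cmod (c x)) * Im (Ln (1 - c x)) =
      bloch_wigner (Some (c x))) (nhds s)"
    by eventually_elim (simp add: bloch_wigner_slit)
  have C: "(Im (c' * (- Ln (1 - c s) / c s)) + (ln (cmod (c s)) * Im ((- c') / (1 - c s)) +
       Re (c' / c s) * Im (Ln (1 - c s)))) =
      (ln (cmod (c s)) * Im (c' / (c s - 1)) - ln (cmod (1 - c s)) * Im (c' / c s))"
  proof -
    have nz: "1 - c s \<noteq> 0" using z by auto
    have "c' * (- Ln (1 - c s) / c s) = - (Ln (1 - c s) * (c' / c s))" by simp
    hence "Im (c' * (- Ln (1 - c s) / c s)) =
        - (Re (Ln (1 - c s)) * Im (c' / c s) + Im (Ln (1 - c s)) * Re (c' / c s))"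
      by (simp only: uminus_complex.simps times_complex.simps)
    moreover have "(- c') / (1 - c s) = c' / (c s - 1)"
      by (metis minus_diff_eq minus_divide_divide minus_minus)
    ultimately show ?thesis using nz by (simp add: algebra_simps)
  qed
  show ?thesis
    using has_vector_derivative_cong_nhds[OF A B] by (simp only: C)
qed

section \<open>Functional equations of the dilogarithm and its derivative on the cut\<close>

lemma vector_derivative_zero_const:
  fixes E :: "real \<Rightarrow> real"
  assumes "\<And>t. t \<in> {0..1} \<Longrightarrow> (E has_vector_derivative 0) (at t)"
  shows "E 0 = E 1"
proof -
  obtain k where "\<forall>t\<in>{0..1}. E t = k"
    using has_vector_derivative_zero_constant[of "{0..1}" E] assms
    by (meson convex_real_interval(5) has_vector_derivative_at_within)
  thus ?thesis by simp
qed

text \<open>On (-\<infinity>,1) the derivative of \<open>Li2\<close> along the segment from 0 is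
  real and \<open>Li2 0 = 0\<close>, so \<open>Li2\<close> is real there, as is
  \<open>Ln (1 - z)\<close>; on [1,\<infinity>) the value is 0 by definition.\<close>

lemma bloch_wigner_real:
  assumes "z \<in> \<real>"
  shows "bloch_wigner (Some z) = 0"
proof (cases "1 - z \<in> \<real>\<^sub>\<le>\<^sub>0")
  case True
  thus ?thesis using not_nonpos_Reals_slit_iff[of z] by (auto simp: bloch_wigner_def)
next
  case False
  from assms obtain x where z: "z = of_real x" by (auto elim: Reals_cases)
  have x: "x < 1" using False by (auto simp: z complex_nonpos_Reals_iff)
  have "Im (Li2 (of_real (0 * x))) = Im (Li2 (of_real (1 * x)))"
  proof (rule vector_derivative_zero_const[of "\<lambda>t. Im (Li2 (of_real (t * x)))"])
    fix t :: real assume t: "t \<in> {0..1}"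
    have tx: "t * x < 1"
    proof (cases "x \<le> 0")
      case True thus ?thesis using t mult_nonneg_nonpos[of t x] by auto
    next
      case False
      show ?thesis
        by (rule le_less_trans[OF mult_left_le_one_le x]) (use t False in auto)
    qed
    define L where "L = (if complex_of_real (t * x) = 0 then 1
        else - Ln (1 - complex_of_real (t * x)) / complex_of_real (t * x))"
    have "L \<in> \<real>"
    proof -
      have "Ln (1 - complex_of_real (t * x)) = of_real (ln (1 - t * x))"
        using tx Ln_of_real[of "1 - t * x"] by simp
      thus ?thesis by (simp add: L_def)
    qed
    have "((\<lambda>t. complex_of_real (t * x)) has_vector_derivative complex_of_real x) (at t)"
      by (auto intro!: derivative_eq_intros)
    moreover have "(Li2 has_field_derivative L) (at (complex_of_real (t * x)))"
      unfolding L_def using tx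
      by (intro Li2_has_field_derivative) (auto simp: complex_nonpos_Reals_iff)
    ultimately have "((\<lambda>t. Li2 (complex_of_real (t * x))) has_vector_derivative (complex_of_real x * L)) (at t)"
      using field_vector_diff_chain_at by (fastforce simp: o_def)
    from has_vector_derivative_Im[OF this]
    show "((\<lambda>t. Im (Li2 (of_real (t * x)))) has_vector_derivative 0) (at t)"
      using \<open>L \<in> \<real>\<close> by (auto simp: complex_is_Real_iff)
  qed
  hence "Im (Li2 z) = 0" by (simp add: z Li2_def)
  moreover have "Ln (1 - z) = of_real (ln (1 - x))"
    using x Ln_of_real[of "1 - x"] by (simp add: z)
  ultimately show ?thesis using False by (simp add: bloch_wigner_slit)
qed

text \<open>The sum of the two values has zero derivative along the segment from \<open>z\<close> to
  1/2, the fixed point of the reflection. For nonreal \<open>z\<close> this segment meets the real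
  axis only at 1/2, so no cut is touched.\<close>

lemma bloch_wigner_reflect: "bloch_wigner (Some (1 - z)) = - bloch_wigner (Some z)"
proof (cases "z \<in> \<real>")
  case True
  thus ?thesis using bloch_wigner_real[of z] bloch_wigner_real[of "1 - z"] by simp
next
  case False
  define c where "c = linepath z (1/2)"
  define E where "E = (\<lambda>t. bloch_wigner (Some (c t)) + bloch_wigner (Some (1 - c t)))"
  have "E 0 = E 1"
  proof (rule vector_derivative_zero_const)
    fix t :: real assume t: "t \<in> {0..1}"
    have c': "(c has_vector_derivative (1/2 - z)) (at t)"
      unfolding c_def by (rule has_vector_derivative_linepath_within)
    have e': "((\<lambda>t. 1 - c t) has_vector_derivative (- (1/2 - z))) (at t)"
      by (auto intro!: derivative_eq_intros c')
    have "Im (c t) = (1 - t) * Im z" by (simp add: c_def linepath_def)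
    moreover have "Im z \<noteq> 0" using False by (simp add: complex_is_Real_iff)
    ultimately have "Im (c t) \<noteq> 0 \<or> c t = 1/2"
      by (auto simp: c_def linepath_def)
    hence s: "1 - c t \<notin> \<real>\<^sub>\<le>\<^sub>0" "c t \<noteq> 0" "1 - (1 - c t) \<notin> \<real>\<^sub>\<le>\<^sub>0" "1 - c t \<noteq> 0"
      by (auto simp: complex_nonpos_Reals_iff complex_eq_iff)
    have i1: "(- (1 / 2 - z)) / ((1 - c t) - 1) = (1 / 2 - z) / c t"
      using s by (simp add: field_simps)
    have i2: "(- (1 / 2 - z)) / (1 - c t) = (1 / 2 - z) / (c t - 1)"
      by (metis minus_diff_eq minus_divide_divide)
    have "(E has_vector_derivative
       ((ln (cmod (c t)) * Im ((1/2 - z) / (c t - 1)) - ln (cmod (1 - c t)) * Im ((1/2 - z) / c t)) +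
        (ln (cmod (1 - c t)) * Im ((- (1/2 - z)) / ((1 - c t) - 1)) -
          ln (cmod (1 - (1 - c t))) * Im ((- (1/2 - z)) / (1 - c t))))) (at t)"
      unfolding E_def using s
      by (intro has_vector_derivative_add bloch_wigner_deriv_slit c' e')
    thus "(E has_vector_derivative 0) (at t)"
      unfolding i1 i2 by simp
  qed
  moreover have "E 1 = 0"
    using bloch_wigner_real[of "1/2"] by (simp add: E_def c_def linepath_def)
  ultimately show ?thesis by (simp add: E_def c_def linepath_def)
qed

text \<open>As for the reflection, with the segment now running to the fixed point -1 of inversion.
  Inversion makes (1,\<infinity>) accessible: it maps that half-line to (0,1), where there is no
  cut.\<close>

lemma bloch_wigner_inverse:
  assumes "z \<noteq> 0"
  shows "bloch_wigner (Some (inverse z)) = - bloch_wigner (Some z)"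
proof (cases "z \<in> \<real>")
  case True
  thus ?thesis using bloch_wigner_real[of z] bloch_wigner_real[of "inverse z"] by simp
next
  case False
  define c where "c = linepath z (-1)"
  define E where "E = (\<lambda>t. bloch_wigner (Some (c t)) + bloch_wigner (Some (inverse (c t))))"
  have "E 0 = E 1"
  proof (rule vector_derivative_zero_const)
    fix t :: real assume t: "t \<in> {0..1}"
    define d where "d = -1 - z"
    have c': "(c has_vector_derivative d) (at t)"
      unfolding c_def d_def by (rule has_vector_derivative_linepath_within)
    have "Im (c t) = (1 - t) * Im z" by (simp add: c_def linepath_def)
    moreover have "Im z \<noteq> 0" using False by (simp add: complex_is_Real_iff)
    ultimately have ct: "Im (c t) \<noteq> 0 \<or> c t = -1"
      by (auto simp: c_def linepath_def)
    hence s: "1 - c t \<notin> \<real>\<^sub>\<le>\<^sub>0" "c t \<noteq> 0" "inverse (c t) \<noteq> 0" "c t \<noteq> 1"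
      by (auto simp: complex_nonpos_Reals_iff complex_eq_iff)
    have s': "1 - inverse (c t) \<notin> \<real>\<^sub>\<le>\<^sub>0"
    proof
      assume "1 - inverse (c t) \<in> \<real>\<^sub>\<le>\<^sub>0"
      hence "inverse (c t) \<in> \<real>" "c t \<noteq> -1"
        by (auto simp: complex_nonpos_Reals_iff complex_is_Real_iff)
      hence "c t \<in> \<real>" by (metis Reals_inverse inverse_inverse_eq)
      with ct \<open>c t \<noteq> -1\<close> show False by (auto simp: complex_is_Real_iff)
    qed
    have e': "((\<lambda>t. inverse (c t)) has_vector_derivative (- d / (c t)\<^sup>2)) (at t)"
      by (rule has_vector_derivative_inverse_at[OF c' s(2)])
    have i1: "(- d / (c t)\<^sup>2) / (inverse (c t) - 1) = d / (c t - 1) - d / c t"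
    proof -
      have "inverse (c t) - 1 = - ((c t - 1) / c t)" using s by (simp add: field_simps)
      moreover have "c t - 1 \<noteq> 0" using s by simp
      ultimately show ?thesis using s
        by (simp add: divide_simps power2_eq_square) (simp add: algebra_simps)
    qed
    have i2: "(- d / (c t)\<^sup>2) / inverse (c t) = - (d / c t)"
      using s by (simp add: field_simps power2_eq_square)
    have i3: "ln (cmod (1 - inverse (c t))) = ln (cmod (1 - c t)) - ln (cmod (c t))"
    proof -
      have "1 - inverse (c t) = - ((1 - c t) / c t)" using s by (simp add: field_simps)
      thus ?thesis using s by (simp add: norm_divide ln_div)
    qed
    have i4: "ln (cmod (inverse (c t))) = - ln (cmod (c t))"
      using s by (simp add: norm_inverse ln_inverse)
    have "(E has_vector_derivative
       ((ln (cmod (c t)) * Im (d / (c t - 1)) - ln (cmod (1 - c t)) * Im (d / c t)) +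
        (ln (cmod (inverse (c t))) * Im ((- d / (c t)\<^sup>2) / (inverse (c t) - 1)) -
          ln (cmod (1 - inverse (c t))) * Im ((- d / (c t)\<^sup>2) / inverse (c t))))) (at t)"
      unfolding E_def using s s'
      by (intro has_vector_derivative_add bloch_wigner_deriv_slit c' e')
    thus "(E has_vector_derivative 0) (at t)"
      unfolding i1 i2 i3 i4 by (simp add: algebra_simps)
  qed
  moreover have "E 1 = 0"
    using bloch_wigner_real[of "-1"] by (simp add: E_def c_def linepath_def)
  ultimately show ?thesis by (simp add: E_def c_def linepath_def)
qed

text \<open>The cut (1,\<infinity>) of the defining formula is an artefact: there the function is
  minus its value at the inverse point, where the formula for the slit plane applies, and the
  derivative comes out in the same form.\<close>

lemma bloch_wigner_deriv:
  assumes c: "(c has_vector_derivative c') (at s)" and z: "c s \<noteq> 0" "c s \<noteq> 1"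
  shows "((\<lambda>s. bloch_wigner (Some (c s))) has_vector_derivative
     (ln (cmod (c s)) * Im (c' / (c s - 1)) - ln (cmod (1 - c s)) * Im (c' / c s))) (at s)"
proof (cases "1 - c s \<in> \<real>\<^sub>\<le>\<^sub>0")
  case False
  thus ?thesis using bloch_wigner_deriv_slit[OF c] z by simp
next
  case True
  define x where "x = Re (c s)"
  have cs: "c s = of_real x" and x: "x > 1"
    using True z by (auto simp: complex_nonpos_Reals_iff complex_eq_iff x_def)
  have s': "1 - inverse (c s) \<notin> \<real>\<^sub>\<le>\<^sub>0"
    using x by (simp add: cs complex_nonpos_Reals_iff field_simps flip: of_real_inverse)
  have e': "((\<lambda>t. inverse (c t)) has_vector_derivative (- c' / (c s)\<^sup>2)) (at s)"
    by (rule has_vector_derivative_inverse_at[OF c z(1)])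
  have A: "((\<lambda>s. - bloch_wigner (Some (inverse (c s)))) has_vector_derivative
     - (ln (cmod (inverse (c s))) * Im ((- c' / (c s)\<^sup>2) / (inverse (c s) - 1)) -
          ln (cmod (1 - inverse (c s))) * Im ((- c' / (c s)\<^sup>2) / inverse (c s)))) (at s)"
    using s' z by (intro has_vector_derivative_minus bloch_wigner_deriv_slit e') auto
  have B: "eventually (\<lambda>x. - bloch_wigner (Some (inverse (c x))) = bloch_wigner (Some (c x))) (nhds s)"
  proof -
    have "eventually (\<lambda>x. c x \<in> - {0}) (nhds s)"
      using z by (intro isCont_eventually_nhds[OF has_vector_derivative_isCont[OF c]]) auto
    thus ?thesis by eventually_elim (simp add: bloch_wigner_inverse)
  qed
  have C: "- (ln (cmod (inverse (c s))) * Im ((- c' / (c s)\<^sup>2) / (inverse (c s) - 1)) -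
          ln (cmod (1 - inverse (c s))) * Im ((- c' / (c s)\<^sup>2) / inverse (c s))) =
     ln (cmod (c s)) * Im (c' / (c s - 1)) - ln (cmod (1 - c s)) * Im (c' / c s)"
  proof -
    have i1: "(- c' / (c s)\<^sup>2) / (inverse (c s) - 1) = c' / (c s - 1) - c' / c s"
    proof -
      have "inverse (c s) - 1 = - ((c s - 1) / c s)" using z by (simp add: field_simps)
      moreover have "c s - 1 \<noteq> 0" using z by simp
      ultimately show ?thesis using z
        by (simp add: divide_simps power2_eq_square) (simp add: algebra_simps)
    qed
    have i2: "(- c' / (c s)\<^sup>2) / inverse (c s) = - (c' / c s)"
      using z by (simp add: field_simps power2_eq_square)
    have i3: "ln (cmod (1 - inverse (c s))) = ln (cmod (1 - c s)) - ln (cmod (c s))"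
    proof -
      have "1 - inverse (c s) = - ((1 - c s) / c s)" using z by (simp add: field_simps)
      thus ?thesis using z by (simp add: norm_divide ln_div)
    qed
    have i4: "ln (cmod (inverse (c s))) = - ln (cmod (c s))"
      using z by (simp add: norm_inverse ln_inverse)
    show ?thesis unfolding i1 i2 i3 i4 by (simp add: algebra_simps)
  qed
  show ?thesis
    using has_vector_derivative_cong_nhds[OF A B] by (simp only: C)
qed

lemma isCont_bloch_wigner_0: "isCont (\<lambda>z. bloch_wigner (Some z)) 0"
proof -
  have Li: "isCont (\<lambda>z. Im (Li2 z)) 0"
    using Li2_has_field_derivative[of 0, THEN DERIV_isCont] by (intro isCont_Im) auto
  have d0: "((\<lambda>u. Ln (1 - u)) has_field_derivative -1) (at 0)"
    by (auto intro!: derivative_eq_intros)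
  have l1: "((\<lambda>u::complex. Ln (1 - u) / u) \<longlongrightarrow> -1) (at 0)"
    using d0 unfolding has_field_derivative_iff
    by (rule tendsto_cong[THEN iffD1, rotated]) (auto simp: eventually_at_filter)
  have "((\<lambda>x::real. x * ln x) \<longlongrightarrow> 0) (at_right 0)" by real_asymp
  moreover have "filterlim (\<lambda>z::complex. cmod z) (at_right 0) (at 0)"
    unfolding filterlim_at by (auto intro!: tendsto_eq_intros simp: eventually_at_filter)
  ultimately have l2: "((\<lambda>z. cmod z * ln (cmod z)) \<longlongrightarrow> 0) (at 0)"
    by (rule filterlim_compose)
  \<comment> \<open>The product to be estimated is split into |z| ln |z|, which tends to 0, and |Ln
    (1 - z) / z|, which converges.\<close>
  have "((\<lambda>z. (cmod z * ln (cmod z)) * cmod (Ln (1 - z) / z)) \<longlongrightarrow> 0 * cmod (-1)) (at 0)"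
    by (intro tendsto_mult l2 tendsto_norm l1)
  hence "((\<lambda>z. (cmod z * ln (cmod z)) * cmod (Ln (1 - z) / z)) \<longlongrightarrow> 0) (at 0)" by simp
  hence l3: "((\<lambda>z. ln (cmod z) * Im (Ln (1 - z))) \<longlongrightarrow> 0) (at 0)"
  proof (rule Lim_null_comparison[rotated, OF tendsto_rabs_zero])
    show "eventually (\<lambda>z. norm (ln (cmod z) * Im (Ln (1 - z))) \<le>
        \<bar>(cmod z * ln (cmod z)) * cmod (Ln (1 - z) / z)\<bar>) (at 0)"
      by (auto simp: eventually_at_filter abs_mult norm_divide intro!: always_eventually
           mult_left_mono abs_Im_le_cmod)
  qed
  have "((\<lambda>z. Im (Li2 z) + ln (cmod z) * Im (Ln (1 - z))) \<longlongrightarrow> Im (Li2 0) + 0) (at 0)"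
    using Li l3 by (intro tendsto_add) (auto simp: isCont_def)
  moreover have "eventually (\<lambda>z. Im (Li2 z) + ln (cmod z) * Im (Ln (1 - z)) = bloch_wigner (Some z)) (at (0::complex))"
    using eventually_nhds_in_open[OF open_slit, of 0]
    by (auto simp: eventually_at_filter bloch_wigner_slit elim!: eventually_mono)
  ultimately have "((\<lambda>z. bloch_wigner (Some z)) \<longlongrightarrow> Im (Li2 0) + 0) (at 0)"
    by (rule Lim_transform_eventually)
  thus ?thesis by (simp add: isCont_def bloch_wigner_slit)
qed

text \<open>Reflection carries the point 1 to 0 and inversion carries (1,\<infinity>) to (0,1);
  elsewhere the defining formula is continuous, with 0 treated separately because of the factor
  \<open>ln (cmod z)\<close>.\<close>

lemma isCont_bloch_wigner: "isCont (\<lambda>z. bloch_wigner (Some z)) z"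
proof -
  have slit: "isCont (\<lambda>z. bloch_wigner (Some z)) z" if z: "1 - z \<notin> \<real>\<^sub>\<le>\<^sub>0" "z \<noteq> 0" for z
  proof -
    have "isCont (\<lambda>z. Im (Li2 z) + ln (cmod z) * Im (Ln (1 - z))) z"
      using Li2_has_field_derivative[OF z(1), THEN DERIV_isCont] z
      by (intro continuous_intros isCont_Im) auto
    moreover have "eventually (\<lambda>z. Im (Li2 z) + ln (cmod z) * Im (Ln (1 - z)) = bloch_wigner (Some z)) (nhds z)"
      using eventually_nhds_in_open[OF open_slit, of z] z
      by (auto simp: bloch_wigner_slit elim!: eventually_mono)
    ultimately show ?thesis by (rule isCont_cong_nhds)
  qed
  consider "z = 0" | "z = 1" | "1 - z \<notin> \<real>\<^sub>\<le>\<^sub>0" "z \<noteq> 0" | "1 - z \<in> \<real>\<^sub>\<le>\<^sub>0" "z \<noteq> 1" by blast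
  thus ?thesis
  proof cases
    case 1
    thus ?thesis using isCont_bloch_wigner_0 by simp
  next
    case 2
    have "isCont (\<lambda>z. - bloch_wigner (Some (1 - z))) 1"
      by (rule continuous_minus, rule isCont_o2[where f = "\<lambda>z. 1 - z" and g = "\<lambda>z. bloch_wigner (Some z)"])
         (simp_all add: isCont_bloch_wigner_0)
    thus ?thesis using 2 by (simp add: bloch_wigner_reflect)
  next
    case 3
    thus ?thesis by (rule slit)
  next
    case 4
    have z: "Im z = 0" "Re z > 1"
      using 4 by (auto simp: complex_nonpos_Reals_iff complex_eq_iff)
    have z0: "z \<noteq> 0" using z by auto
    have zz: "z = of_real (Re z)" using z by (simp add: complex_eq_iff)
    have "1 - inverse z \<notin> \<real>\<^sub>\<le>\<^sub>0"
      using z by (subst zz) (simp add: complex_nonpos_Reals_iff field_simps flip: of_real_inverse)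
    hence "isCont (\<lambda>z. - bloch_wigner (Some (inverse z))) z"
      using z0 by (intro continuous_minus isCont_o2[where f = inverse and g = "\<lambda>z. bloch_wigner (Some z)"]
          slit DERIV_isCont[OF DERIV_inverse]) simp_all
    moreover have "eventually (\<lambda>z. - bloch_wigner (Some (inverse z)) = bloch_wigner (Some z)) (nhds z)"
      using t1_space_nhds[OF z0] by eventually_elim (simp add: bloch_wigner_inverse)
    ultimately show ?thesis by (rule isCont_cong_nhds)
  qed
qed

lemma bloch_wigner_at_infinity: "((\<lambda>z. bloch_wigner (Some z)) \<longlongrightarrow> 0) at_infinity"
proof -
  have "((\<lambda>z. - bloch_wigner (Some (inverse z))) \<longlongrightarrow> - bloch_wigner (Some 0)) at_infinity"
    by (intro tendsto_minus isCont_tendsto_compose[OF isCont_bloch_wigner_0] tendsto_inverse_0)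
  moreover have "eventually (\<lambda>z::complex. - bloch_wigner (Some (inverse z)) = bloch_wigner (Some z)) at_infinity"
    unfolding eventually_at_infinity
    by (intro exI[of _ 1] allI impI, subst bloch_wigner_inverse) auto
  ultimately have "((\<lambda>z. bloch_wigner (Some z)) \<longlongrightarrow> - bloch_wigner (Some 0)) at_infinity"
    by (rule Lim_transform_eventually)
  thus ?thesis using bloch_wigner_real[of 0] by simp
qed

section \<open>Jensen's formula\<close>

lemma cis_eq_iff: "cis x = cis y \<longleftrightarrow> (\<exists>k::int. x = y + 2 * pi * of_int k)"
  using sin_cos_eq_iff[of x y] by (auto simp: complex_eq_iff)

lemma finite_cis_eq: "finite {x\<in>{a..b}. cis x = z}"
proof (cases "\<exists>y. cis y = z")
  case False
  thus ?thesis by simp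
next
  case True
  then obtain y where y: "cis y = z" by blast
  have "{x\<in>{a..b}. cis x = z} \<subseteq> (\<lambda>k::int. y + 2 * pi * of_int k) ` {\<lfloor>(a - y) / (2 * pi)\<rfloor>..\<lceil>(b - y) / (2 * pi)\<rceil>}"
  proof safe
    fix x assume x: "x \<in> {a..b}" "z = cis x"
    then obtain k :: int where k: "x = y + 2 * pi * of_int k"
      using y cis_eq_iff by metis
    have "(a - y) / (2 * pi) \<le> of_int k" "of_int k \<le> (b - y) / (2 * pi)"
      using x k by (auto simp: field_simps)
    hence "k \<in> {\<lfloor>(a - y) / (2 * pi)\<rfloor>..\<lceil>(b - y) / (2 * pi)\<rceil>}"
      by (simp add: floor_le_iff le_ceiling_iff)
    thus "x \<in> (\<lambda>k::int. y + 2 * pi * of_int k) ` {\<lfloor>(a - y) / (2 * pi)\<rfloor>..\<lceil>(b - y) / (2 * pi)\<rceil>}"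
      using k by blast
  qed
  thus ?thesis by (rule finite_subset) auto
qed

lemma finite_cis_in:
  assumes "finite Z"
  shows "finite {x\<in>{a..b}. cis x \<in> Z}"
proof -
  have "{x\<in>{a..b}. cis x \<in> Z} = (\<Union>z\<in>Z. {x\<in>{a..b}. cis x = z})" by auto
  thus ?thesis using assms finite_cis_eq by auto
qed

lemma AE_finite_notin:
  assumes "finite (N :: real set)"
  shows "AE x in lborel. x \<notin> N"
proof -
  have "N \<in> null_sets lborel" using assms by (intro finite_imp_null_set_lborel)
  thus ?thesis by (rule AE_not_in)
qed

lemma AE_cis_notin:
  assumes "finite Z"
  shows "AE x in lborel. x \<in> {a..b} \<longrightarrow> cis x \<notin> Z"
  using AE_finite_notin[OF finite_cis_in[OF assms, of a b]] by eventually_elim auto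

lemma measurable_ln_cmod_cis [measurable]:
  "(\<lambda>x. ln (cmod (poly p (cis x)))) \<in> borel_measurable borel"
proof -
  have "(\<lambda>x. cmod (poly p (cis x))) \<in> borel_measurable borel"
    by (intro borel_measurable_continuous_onI continuous_intros)
  thus ?thesis by measurable
qed

text \<open>Mean value property of \<open>Ln (1 - b * z)\<close>, which is holomorphic up to the
  unit circle: Cauchy's formula at 0, where this function vanishes.\<close>

lemma jensen_inside:
  assumes b: "cmod b < 1"
  shows "set_integrable lborel {0..2*pi} (\<lambda>x. ln (cmod (1 - b * cis x)))"
    and "(LINT x:{0..2*pi}|lborel. ln (cmod (1 - b * cis x))) = 0"
proof -
  have nz: "1 - b * z \<notin> \<real>\<^sub>\<le>\<^sub>0" if "cmod z \<le> 1" for z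
  proof
    assume "1 - b * z \<in> \<real>\<^sub>\<le>\<^sub>0"
    hence "Re (b * z) \<ge> 1" by (simp add: complex_nonpos_Reals_iff)
    moreover have "Re (b * z) \<le> cmod (b * z)" by (rule complex_Re_le_cmod)
    moreover have "cmod (b * z) \<le> cmod b * 1"
      unfolding norm_mult using that by (intro mult_left_mono) auto
    ultimately show False using b by simp
  qed
  have nz': "1 - b * cis x \<noteq> 0" for x using nz[of "cis x"] by auto
  have "continuous_on {0..2*pi} (\<lambda>x. ln (cmod (1 - b * cis x)))"
    using nz' by (intro continuous_intros) auto
  thus int: "set_integrable lborel {0..2*pi} (\<lambda>x. ln (cmod (1 - b * cis x)))"
    by (rule borel_integrable_atLeastAtMost')
  have "(\<lambda>z. Ln (1 - b * z)) holomorphic_on cball 0 1"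
    using nz by (intro holomorphic_intros) auto
  hence "((\<lambda>u. Ln (1 - b * u) / (u - 0)) has_contour_integral (2 * of_real pi * \<i> * Ln (1 - b * 0)))
          (circlepath 0 1)"
    by (intro Cauchy_integral_circlepath_simple) auto
  hence "((\<lambda>u. Ln (1 - b * u) / u) has_contour_integral 0) (part_circlepath 0 1 0 (2*pi))"
    by (simp add: circlepath_def)
  hence "((\<lambda>t. Ln (1 - b * (0 + of_real 1 * cis t)) / (0 + of_real 1 * cis t) * of_real 1 * \<i> * cis t) has_integral 0) {0..2*pi}"
    by (subst (asm) has_contour_integral_part_circlepath_iff) auto
  hence "((\<lambda>t. Ln (1 - b * cis t) * \<i>) has_integral 0) {0..2*pi}"
    by (simp add: mult_ac)
  from has_integral_linear[OF this bounded_linear_Im]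
  have "((\<lambda>t. Re (Ln (1 - b * cis t))) has_integral 0) {0..2*pi}" by (simp add: o_def)
  hence "((\<lambda>t. ln (cmod (1 - b * cis t))) has_integral 0) {0..2*pi}"
    by (rule has_integral_eq[rotated]) (use nz' in \<open>simp only: Re_Ln not_False_eq_True\<close>)
  thus "(LINT x:{0..2*pi}|lborel. ln (cmod (1 - b * cis x))) = 0"
    using set_borel_integral_eq_integral(2)[OF int] by (simp add: integral_unique)
qed

text \<open>The integrand now has a logarithmic singularity on the circle. It is approached by the
  functions with \<open>of_real (r n) * b\<close> in place of \<open>b\<close>: Fatou's lemma yields
  integrability, dominated convergence then the value.\<close>

lemma jensen_circle:
  assumes b: "cmod b = 1"
  shows "set_integrable lborel {0..2*pi} (\<lambda>x. ln (cmod (1 - b * cis x)))"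
    and "(LINT x:{0..2*pi}|lborel. ln (cmod (1 - b * cis x))) = 0"
proof -
  define A where "A = {0..2*pi}"
  define r where "r = (\<lambda>n. 1 - inverse (of_nat (Suc n)) :: real)"
  have r: "0 \<le> r n" "r n < 1" for n by (auto simp: r_def divide_simps)
  have rlim: "r \<longlonglongrightarrow> 1"
    unfolding r_def using tendsto_diff[OF tendsto_const LIMSEQ_inverse_real_of_nat, of 1] by simp
  \<comment> \<open>The modulus of \<open>1 - c * cis x\<close> is at most 2 for
    \<open>cmod c \<le> 1\<close>, so subtracting its logarithm from \<open>ln 2\<close> gives
    nonnegative functions, as Fatou's lemma requires.\<close>
  define h where "h = (\<lambda>n x. indicator A x * (ln 2 - ln (cmod (1 - of_real (r n) * b * cis x))))"
  define g where "g = (\<lambda>x. indicator A x * (ln 2 - ln (cmod (1 - b * cis x))))"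
  have meas: "(\<lambda>x. ln (cmod (1 - c * cis x))) \<in> borel_measurable borel" for c
    using measurable_ln_cmod_cis[of "[:1, -c:]"] by (simp add: mult_ac)
  have hm: "h n \<in> borel_measurable borel" for n
    unfolding h_def A_def by (intro borel_measurable_times borel_measurable_diff meas) auto
  have gm: "g \<in> borel_measurable borel"
    unfolding g_def A_def by (intro borel_measurable_times borel_measurable_diff meas) auto
  have rb: "cmod (of_real (r n) * b) < 1" for n using r[of n] b by (simp add: norm_mult)
  have const: "set_integrable lborel A (\<lambda>_. c)" "(LINT x:A|lborel. c) = 2 * pi * c" for c :: real
    by (auto simp: A_def set_integrable_def set_lebesgue_integral_def)
  have hi: "integrable lborel (h n)" and hI: "integral\<^sup>L lborel (h n) = 2 * pi * ln 2" for n
    using set_integral_diff[OF const(1)[of "ln 2"] jensen_inside(1)[OF rb[of n], folded A_def]]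
          const(2)[of "ln 2"] jensen_inside(2)[OF rb[of n], folded A_def]
    by (simp_all add: set_integrable_def set_lebesgue_integral_def h_def)
  have up: "cmod (1 - c * cis x) \<le> 2" if "cmod c \<le> 1" for c x
    using norm_triangle_ineq4[of 1 "c * cis x"] that by (simp add: norm_mult)
  have h0: "h n x \<ge> 0" for n x
  proof -
    have "1 - of_real (r n) * b * cis x \<noteq> 0"
      using rb[of n] by (metis eq_iff_diff_eq_0 less_irrefl mult.right_neutral norm_cis norm_mult norm_one)
    hence "ln (cmod (1 - of_real (r n) * b * cis x)) \<le> ln 2"
      using up[of "of_real (r n) * b" x] rb[of n] by (subst ln_le_cancel_iff) auto
    thus ?thesis by (simp add: h_def)
  qed
  have ae: "AE x in lborel. x \<in> A \<longrightarrow> cis x \<noteq> inverse b"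
    using AE_cis_notin[of "{inverse b}"] by (simp add: A_def)
  have nzA: "1 - b * cis x \<noteq> 0" if "cis x \<noteq> inverse b" for x
    using that inverse_unique[of b "cis x"] by auto
  have lim: "(\<lambda>n. h n x) \<longlonglongrightarrow> g x" if "x \<in> A \<longrightarrow> cis x \<noteq> inverse b" for x
  proof (cases "x \<in> A")
    case False thus ?thesis by (simp add: h_def g_def)
  next
    case True
    have "(\<lambda>n. 1 - of_real (r n) * b * cis x) \<longlonglongrightarrow> 1 - of_real 1 * b * cis x"
      by (intro tendsto_intros rlim)
    hence "(\<lambda>n. ln (cmod (1 - of_real (r n) * b * cis x))) \<longlonglongrightarrow> ln (cmod (1 - b * cis x))"
      using nzA[of x] that True by (intro tendsto_ln tendsto_norm) auto
    thus ?thesis unfolding h_def g_def by (rule tendsto_mult[OF tendsto_const tendsto_diff[OF tendsto_const]])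
  qed
  have g0: "AE x in lborel. 0 \<le> g x"
    using ae
  proof eventually_elim
    case (elim x)
    from lim[OF this] show ?case by (rule LIMSEQ_le_const) (use h0 in auto)
  qed
  have "(\<integral>\<^sup>+x. ennreal (g x) \<partial>lborel) = (\<integral>\<^sup>+x. liminf (\<lambda>n. ennreal (h n x)) \<partial>lborel)"
  proof (rule nn_integral_cong_AE)
    show "AE x in lborel. ennreal (g x) = liminf (\<lambda>n. ennreal (h n x))"
      using ae
    proof eventually_elim
      case (elim x)
      hence "(\<lambda>n. ennreal (h n x)) \<longlonglongrightarrow> ennreal (g x)"
        using lim by (intro tendsto_ennrealI) auto
      thus ?case by (simp add: lim_imp_Liminf)
    qed
  qed
  also have "\<dots> \<le> liminf (\<lambda>n. \<integral>\<^sup>+x. ennreal (h n x) \<partial>lborel)"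
    by (intro nn_integral_liminf) (use hm in measurable)
  also have "(\<lambda>n. \<integral>\<^sup>+x. ennreal (h n x) \<partial>lborel) = (\<lambda>n. ennreal (2 * pi * ln 2))"
    using hi hI h0 by (subst nn_integral_eq_integral) auto
  also have "liminf \<dots> < \<infinity>" by (simp add: Liminf_const)
  finally have gi: "integrable lborel g"
    using gm g0 by (intro integrableI_nonneg) auto
  have "(\<lambda>n. integral\<^sup>L lborel (h n)) \<longlonglongrightarrow> integral\<^sup>L lborel g"
  \<comment> \<open>The majorant is built from the limit function itself: |1 - w| \<le> 2 |1 - r w|
    for |w| = 1 and 0 \<le> r < 1, so \<open>h n\<close> exceeds \<open>g\<close> by at most
    \<open>ln 2\<close>.\<close>
  proof (rule integral_dominated_convergence[where w = "\<lambda>x. g x + indicator A x * ln 2"])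
    show "integrable lborel (\<lambda>x. g x + indicator A x * ln 2)"
      using gi const(1)[of "ln 2"] by (intro Bochner_Integration.integrable_add) (auto simp: set_integrable_def)
    show "AE x in lborel. (\<lambda>n. h n x) \<longlonglongrightarrow> g x"
      using ae by eventually_elim (use lim in auto)
    show "AE x in lborel. norm (h n x) \<le> g x + indicator A x * ln 2" for n
      using ae
    proof eventually_elim
      case (elim x)
      show ?case
      proof (cases "x \<in> A")
        case False thus ?thesis by (simp add: h_def g_def)
      next
        case True
        define w where "w = b * cis x"
        have w: "cmod w = 1" "w \<noteq> 1" using b nzA[of x] elim True by (auto simp: w_def norm_mult)
        have "cmod (1 - w) \<le> cmod (1 - of_real (r n) * w) + cmod (of_real (r n) * w - w)"
          using norm_triangle_ineq[of "1 - of_real (r n) * w" "of_real (r n) * w - w"] by simp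
        also have "of_real (r n) * w - w = of_real (r n - 1) * w" by (simp add: algebra_simps)
        also have "cmod \<dots> = 1 - r n" using r[of n] w by (simp add: norm_mult del: of_real_diff)
        also have "1 - r n \<le> cmod (1 - of_real (r n) * w)"
          using norm_triangle_ineq2[of 1 "of_real (r n) * w"] r[of n] w by (simp add: norm_mult)
        finally have "cmod (1 - w) \<le> 2 * cmod (1 - of_real (r n) * w)" by simp
        moreover have "cmod (1 - w) > 0" using w by simp
        ultimately have "ln (cmod (1 - w)) \<le> ln (2 * cmod (1 - of_real (r n) * w))"
          by (subst ln_le_cancel_iff) auto
        also have "\<dots> = ln 2 + ln (cmod (1 - of_real (r n) * w))"
          using \<open>cmod (1 - w) > 0\<close> \<open>cmod (1 - w) \<le> 2 * cmod (1 - of_real (r n) * w)\<close>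
          by (subst ln_mult) auto
        finally show ?thesis using True h0[of n x]
          by (simp add: h_def g_def w_def mult.assoc)
      qed
    qed
  qed (use gm hm in auto)
  hence "(\<lambda>n::nat. 2 * pi * ln 2) \<longlonglongrightarrow> integral\<^sup>L lborel g" by (simp add: hI)
  hence gI: "integral\<^sup>L lborel g = 2 * pi * ln 2" by (simp add: LIMSEQ_const_iff)
  have g_set: "set_integrable lborel A (\<lambda>x. ln 2 - ln (cmod (1 - b * cis x)))"
     "(LINT x:A|lborel. ln 2 - ln (cmod (1 - b * cis x))) = 2 * pi * ln 2"
    using gi gI by (simp_all add: set_integrable_def set_lebesgue_integral_def g_def)
  from set_integral_diff[OF const(1)[of "ln 2"] g_set(1)] const(2)[of "ln 2"] g_set(2)
  show "set_integrable lborel {0..2*pi} (\<lambda>x. ln (cmod (1 - b * cis x)))"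
    and "(LINT x:{0..2*pi}|lborel. ln (cmod (1 - b * cis x))) = 0"
    by (simp_all add: A_def)
qed

text \<open>Since |cis x| = 1, the modulus of \<open>cis x - a\<close> equals that of
  \<open>1 - cnj a * cis x\<close>, which settles |a| \<le> 1; for |a| > 1 the factor
  \<open>a\<close> is taken out, and it alone contributes.\<close>

lemma jensen_linear:
  fixes a :: complex
  shows "set_integrable lborel {0..2*pi} (\<lambda>x. ln (cmod (cis x - a)))"
    and "(LINT x:{0..2*pi}|lborel. ln (cmod (cis x - a))) = 2 * pi * ln (max 1 (cmod a))"
proof -
  have const: "set_integrable lborel {0..2*pi} (\<lambda>_. c)" "(LINT x:{0..2*pi}|lborel. c) = 2 * pi * c" for c :: real
    by (auto simp: set_integrable_def set_lebesgue_integral_def)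
  have "set_integrable lborel {0..2*pi} (\<lambda>x. ln (cmod (cis x - a))) \<and>
     (LINT x:{0..2*pi}|lborel. ln (cmod (cis x - a))) = 2 * pi * ln (max 1 (cmod a))"
  proof (cases "cmod a \<le> 1")
    case True
    have eq: "cmod (cis x - a) = cmod (1 - cnj a * cis x)" for x
    proof -
      have "cmod (cis x - a) = cmod (cis x * (1 - a * cis (-x)))"
        by (simp add: algebra_simps cis_mult)
      also have "\<dots> = cmod (cnj (1 - a * cis (-x)))" by (simp add: norm_mult del: complex_cnj_diff)
      also have "cnj (1 - a * cis (-x)) = 1 - cnj a * cis x" by (simp add: cis_cnj)
      finally show ?thesis .
    qed
    from True have "cmod (cnj a) < 1 \<or> cmod (cnj a) = 1" by auto
    thus ?thesis unfolding eq using True jensen_inside[of "cnj a"] jensen_circle[of "cnj a"]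
      by (auto simp: max_def)
  next
    case False
    hence a: "a \<noteq> 0" "cmod (inverse a) < 1" by (auto simp: norm_inverse inverse_less_1_iff)
    have nz: "1 - inverse a * cis x \<noteq> 0" for x
      using a(2) by (metis eq_iff_diff_eq_0 less_irrefl mult.right_neutral norm_cis norm_mult norm_one)
    have eq: "ln (cmod (cis x - a)) = ln (cmod a) + ln (cmod (1 - inverse a * cis x))" for x
    proof -
      have "cis x - a = - (a * (1 - inverse a * cis x))" using a by (simp add: algebra_simps)
      hence "cmod (cis x - a) = cmod a * cmod (1 - inverse a * cis x)"
        by (simp add: norm_mult)
      thus ?thesis using a nz by (simp add: ln_mult)
    qed
    show ?thesis unfolding eq
      using False set_integral_add[OF const(1)[of "ln (cmod a)"] jensen_inside(1)[OF a(2)]]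
        const(2)[of "ln (cmod a)"] jensen_inside(2)[OF a(2)]
      by (simp add: max_def)
  qed
  thus "set_integrable lborel {0..2*pi} (\<lambda>x. ln (cmod (cis x - a)))"
    and "(LINT x:{0..2*pi}|lborel. ln (cmod (cis x - a))) = 2 * pi * ln (max 1 (cmod a))" by auto
qed

lemma jensen_poly:
  fixes p :: "complex poly"
  assumes "p \<noteq> 0"
  shows "set_integrable lborel {0..2*pi} (\<lambda>x. ln (cmod (poly p (cis x))))"
    and "(LINT x:{0..2*pi}|lborel. ln (cmod (poly p (cis x)))) =
      2 * pi * ln (cmod (lead_coeff p)) +
      2 * pi * (\<Sum>z | poly p z = 0. of_nat (order z p) * ln (max 1 (cmod z)))"
proof -
  define Z where "Z = {z. poly p z = 0}"
  have fin: "finite Z" unfolding Z_def by (rule poly_roots_finite[OF assms])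
  have const: "set_integrable lborel {0..2*pi} (\<lambda>_. c)" "(LINT x:{0..2*pi}|lborel. c) = 2 * pi * c" for c :: real
    by (auto simp: set_integrable_def set_lebesgue_integral_def)
  define F where "F = (\<lambda>x. ln (cmod (lead_coeff p)) + (\<Sum>z\<in>Z. of_nat (order z p) * ln (cmod (cis x - z))))"
  have i: "set_integrable lborel {0..2*pi} (\<lambda>x. of_nat (order z p) * ln (cmod (cis x - z)))" for z
    using jensen_linear(1) by simp
  have si: "set_integrable lborel {0..2*pi} (\<lambda>x. \<Sum>z\<in>Z. of_nat (order z p) * ln (cmod (cis x - z)))"
    using i unfolding set_integrable_def scaleR_sum_right by (rule Bochner_Integration.integrable_sum)
  have Fi: "set_integrable lborel {0..2*pi} F"
    unfolding F_def by (intro set_integral_add const si)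
  have "(LINT x:{0..2*pi}|lborel. F x) = 2 * pi * ln (cmod (lead_coeff p)) +
     (LINT x:{0..2*pi}|lborel. \<Sum>z\<in>Z. of_nat (order z p) * ln (cmod (cis x - z)))"
    unfolding F_def using set_integral_add(2)[OF const(1) si] by (simp add: const)
  also have "(LINT x:{0..2*pi}|lborel. \<Sum>z\<in>Z. of_nat (order z p) * ln (cmod (cis x - z))) =
     (\<Sum>z\<in>Z. LINT x:{0..2*pi}|lborel. of_nat (order z p) * ln (cmod (cis x - z)))"
    using i unfolding set_lebesgue_integral_def set_integrable_def scaleR_sum_right
    by (rule Bochner_Integration.integral_sum)
  also have "\<dots> = 2 * pi * (\<Sum>z\<in>Z. of_nat (order z p) * ln (max 1 (cmod z)))"
    unfolding sum_distrib_left
    by (intro sum.cong refl) (simp add: jensen_linear(2))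
  finally have FI: "(LINT x:{0..2*pi}|lborel. F x) = 2 * pi * ln (cmod (lead_coeff p)) + \<dots>" .
  \<comment> \<open>Roots on the unit circle are excluded here: at such a root the convention
    \<open>ln 0 = 0\<close> breaks the rule that the logarithm of a product is the sum of the
    logarithms.\<close>
  have ae: "AE x in lborel. x \<in> {0..2*pi} \<longrightarrow> F x = ln (cmod (poly p (cis x)))"
    using AE_cis_notin[OF fin, of 0 "2*pi"]
  proof eventually_elim
    case (elim x)
    show ?case
    proof
      assume "x \<in> {0..2*pi}"
      hence nz: "cis x - z \<noteq> 0" if "z \<in> Z" for z using elim that by auto
      have "p = smult (lead_coeff p) (\<Prod>z\<in>Z. [:-z, 1:] ^ order z p)"
        unfolding Z_def using complex_poly_decompose[of p] by simp
      hence "poly p (cis x) = lead_coeff p * (\<Prod>z\<in>Z. (cis x - z) ^ order z p)"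
        by (metis (no_types, lifting) poly_smult poly_prod poly_power poly_pCons poly_0
            add.commute mult.right_neutral mult_zero_right add_0 uminus_add_conv_diff prod.cong)
      hence "cmod (poly p (cis x)) = cmod (lead_coeff p) * (\<Prod>z\<in>Z. cmod (cis x - z) ^ order z p)"
        by (simp add: norm_mult norm_power flip: prod_norm)
      also have "ln \<dots> = ln (cmod (lead_coeff p)) + (\<Sum>z\<in>Z. ln (cmod (cis x - z) ^ order z p))"
        using nz assms fin by (subst ln_mult) (auto intro!: prod_pos ln_prod)
      also have "\<dots> = F x" using nz by (simp add: F_def ln_realpow)
      finally show "F x = ln (cmod (poly p (cis x)))" by simp
    qed
  qed
  have m: "set_borel_measurable lborel {0..2*pi} (\<lambda>x. ln (cmod (poly p (cis x))))"
    unfolding set_borel_measurable_def by measurable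
  show "set_integrable lborel {0..2*pi} (\<lambda>x. ln (cmod (poly p (cis x))))"
    unfolding set_integrable_def
  proof (rule integrable_cong_AE_imp)
    show "integrable lborel (\<lambda>x. indicat_real {0..2*pi} x *\<^sub>R F x)"
      using Fi by (simp add: set_integrable_def)
    show "AE x in lborel. indicat_real {0..2*pi} x *\<^sub>R F x =
        indicat_real {0..2*pi} x *\<^sub>R ln (cmod (poly p (cis x)))"
      using ae by eventually_elim (auto simp: indicator_def)
  qed (use m in \<open>simp add: set_borel_measurable_def\<close>)
  have "(LINT x:{0..2*pi}|lborel. ln (cmod (poly p (cis x)))) = (LINT x:{0..2*pi}|lborel. F x)"
  proof (rule set_lebesgue_integral_cong_AE)
    show "AE x\<in>{0..2*pi} in lborel. ln (cmod (poly p (cis x))) = F x"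
      using ae by eventually_elim auto
  qed (use measurable_ln_cmod_cis[of p] measurable_ln_cmod_cis[of "[:-z, 1:]" for z] in \<open>auto simp: F_def\<close>)
  thus "(LINT x:{0..2*pi}|lborel. ln (cmod (poly p (cis x)))) =
      2 * pi * ln (cmod (lead_coeff p)) +
      2 * pi * (\<Sum>z | poly p z = 0. of_nat (order z p) * ln (max 1 (cmod z)))"
    using FI by (simp add: Z_def)
qed

section \<open>Fibres of the parametrization\<close>

abbreviation specialize :: "complex poly poly \<Rightarrow> complex \<Rightarrow> complex poly" where
  "specialize P x \<equiv> map_poly (\<lambda>p. poly p x) P"

lemma eval2_altdef: "eval2 P x y = (\<Sum>j\<le>degree P. poly (coeff P j) x * y ^ j)"
proof -
  have "poly ([:y:] ^ j) x = y ^ j" for j by (simp add: poly_power)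
  thus ?thesis unfolding eval2_def by (subst poly_altdef) (simp add: poly_sum)
qed

lemma degree_specialize_le: "degree (specialize P x) \<le> degree P"
  by (rule degree_le) (simp add: coeff_map_poly coeff_eq_0)

lemma poly_specialize: "poly (specialize P x) y = eval2 P x y"
proof -
  have "poly (specialize P x) y = (\<Sum>j\<le>degree P. coeff (specialize P x) j * y ^ j)"
    unfolding poly_altdef[where p = "specialize P x"]
    by (intro sum.mono_neutral_left)
       (use degree_specialize_le[where P = P and x = x] in \<open>auto simp: coeff_eq_0\<close>)
  thus ?thesis by (simp add: eval2_altdef coeff_map_poly)
qed

lemma pderiv_specialize: "pderiv (specialize P x) = specialize (pderiv P) x"
  by (rule poly_eqI) (simp add: coeff_pderiv coeff_map_poly)

lemma lead_coeff_specialize: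
  assumes "poly (lead_coeff P) x \<noteq> 0"
  shows "degree (specialize P x) = degree P" "lead_coeff (specialize P x) = poly (lead_coeff P) x"
proof -
  have "coeff (specialize P x) (degree P) \<noteq> 0" using assms by (simp add: coeff_map_poly)
  hence "degree P \<le> degree (specialize P x)" by (rule le_degree)
  thus "degree (specialize P x) = degree P" by (intro antisym degree_specialize_le)
  thus "lead_coeff (specialize P x) = poly (lead_coeff P) x" by (simp add: coeff_map_poly)
qed

lemma simple_root_order:
  fixes p :: "complex poly"
  assumes "poly p y = 0" "poly (pderiv p) y \<noteq> 0"
  shows "order y p = 1"
proof -
  have "pderiv p \<noteq> 0" "p \<noteq> 0" using assms(2) by auto
  hence "order y p = Suc (order y (pderiv p))" using assms(1)
    by (intro order_pderiv) (auto simp: order_root)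
  moreover have "order y (pderiv p) = 0" using assms(2) by (simp add: order_0I)
  ultimately show ?thesis by simp
qed

section \<open>Affine points of the projective curve and their parameters\<close>

lemma proj_point_eq_iff:
  "proj_point X Y Z = proj_point X' Y' Z' \<longleftrightarrow> (\<exists>c. c \<noteq> 0 \<and> X = c * X' \<and> Y = c * Y' \<and> Z = c * Z')"
proof
  assume "proj_point X Y Z = proj_point X' Y' Z'"
  moreover have "(X, Y, Z) \<in> proj_point X Y Z"
    unfolding proj_point_def by (auto intro!: exI[of _ 1])
  ultimately show "\<exists>c. c \<noteq> 0 \<and> X = c * X' \<and> Y = c * Y' \<and> Z = c * Z'"
    unfolding proj_point_def by auto
next
  assume "\<exists>c. c \<noteq> 0 \<and> X = c * X' \<and> Y = c * Y' \<and> Z = c * Z'"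
  then obtain c where c: "c \<noteq> 0" "X = c * X'" "Y = c * Y'" "Z = c * Z'" by blast
  have "(a * X', a * Y', a * Z') \<in> proj_point X Y Z" if "a \<noteq> 0" for a
    unfolding proj_point_def using c that by (auto intro!: exI[of _ "a / c"])
  moreover have "(a * X, a * Y, a * Z) \<in> proj_point X' Y' Z'" if "a \<noteq> 0" for a
    unfolding proj_point_def using c that by (auto intro!: exI[of _ "a * c"])
  ultimately show "proj_point X Y Z = proj_point X' Y' Z'"
    unfolding proj_point_def[of X' Y' Z'] proj_point_def[of X Y Z]
    by (auto simp: proj_point_def)
qed

lemma le_total_degree:
  assumes "coeff (coeff P j) i \<noteq> 0"
  shows "i + j \<le> total_degree P"
proof -
  have "{i + j |i j. coeff (coeff P j) i \<noteq> 0} \<subseteq>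
      (\<lambda>(i,j). i + j) ` (SIGMA j:{..degree P}. {..degree (coeff P j)})"
  proof safe
    fix i j assume a: "coeff (coeff P j) i \<noteq> 0"
    hence "j \<le> degree P" "i \<le> degree (coeff P j)"
      by (auto intro!: le_degree)
    thus "i + j \<in> (\<lambda>(i,j). i + j) ` (SIGMA j:{..degree P}. {..degree (coeff P j)})"
      by (intro image_eqI[of _ _ "(j, i)"]) auto
  qed
  hence "finite {i + j |i j. coeff (coeff P j) i \<noteq> 0}"
    by (rule finite_subset) auto
  thus ?thesis unfolding total_degree_def using assms by (intro Max_ge) auto
qed

lemma homogenization_scale:
  "homogenization P (c * X) (c * Y) (c * Z) = c ^ total_degree P * homogenization P X Y Z"
proof -
  have "coeff (coeff P j) i * (c * X) ^ i * (c * Y) ^ j * (c * Z) ^ (total_degree P - (i + j)) =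
     c ^ total_degree P * (coeff (coeff P j) i * X ^ i * Y ^ j * Z ^ (total_degree P - (i + j)))" for i j
  \<comment> \<open>The exponent of \<open>Z\<close> is a truncated subtraction. For monomials that
    occur in \<open>P\<close> it is a true difference; the others have coefficient 0.\<close>
  proof (cases "coeff (coeff P j) i = 0")
    case False
    have "c ^ total_degree P = c ^ i * c ^ j * c ^ (total_degree P - (i + j))"
      using le_total_degree[OF False] by (simp flip: power_add)
    thus ?thesis by (simp add: power_mult_distrib mult_ac)
  qed simp
  thus ?thesis unfolding homogenization_def sum_distrib_left by (intro sum.cong refl)
qed

lemma homogenization_affine: "homogenization P x y 1 = eval2 P x y"
  unfolding homogenization_def eval2_altdef
  by (intro sum.cong refl) (simp add: poly_altdef sum_distrib_left mult_ac)

lemma homogenization_affine':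
  assumes "Z \<noteq> 0"
  shows "homogenization P X Y Z = Z ^ total_degree P * eval2 P (X / Z) (Y / Z)"
  using homogenization_scale[of P Z "X / Z" "Y / Z" 1] assms by (simp add: homogenization_affine)

lemma proj_point_affine_in_curve_iff: "proj_point x y 1 \<in> proj_curve P \<longleftrightarrow> eval2 P x y = 0"
proof
  assume "proj_point x y 1 \<in> proj_curve P"
  then obtain X Y Z where *: "proj_point X Y Z = proj_point x y 1" "homogenization P X Y Z = 0"
    unfolding proj_curve_def by auto
  then obtain c where "c \<noteq> 0" "X = c * x" "Y = c * y" "Z = c * 1"
    unfolding proj_point_eq_iff by auto
  thus "eval2 P x y = 0" using *(2) homogenization_scale[of P c x y 1]
    by (simp add: homogenization_affine)
next
  assume "eval2 P x y = 0"
  thus "proj_point x y 1 \<in> proj_curve P"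
    unfolding proj_curve_def
    by (simp, intro exI[of _ x] exI[of _ y] exI[of _ 1]) (simp add: homogenization_affine)
qed

text \<open>The partial derivative in \<open>Y\<close> detects nonsingularity here: at fixed
  \<open>X\<close> and \<open>Z = c\<close> it is a nonzero multiple of the derivative of
  \<open>specialize P x\<close>.\<close>

lemma affine_nonsingular:
  assumes "eval2 (pderiv P) x y \<noteq> 0"
  shows "proj_point x y 1 \<notin> singular_points P"
proof
  assume "proj_point x y 1 \<in> singular_points P"
  then obtain X Y Z where *: "proj_point X Y Z = proj_point x y 1"
     "deriv (\<lambda>W. homogenization P X W Z) Y = 0"
    unfolding singular_points_def by auto
  then obtain c where c: "c \<noteq> 0" "X = c * x" "Y = c * y" "Z = c"
    unfolding proj_point_eq_iff by auto
  have eq: "homogenization P X W Z = c ^ total_degree P * poly (specialize P x) (W / c)" for W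
    using c by (simp add: homogenization_affine' poly_specialize)
  have "((\<lambda>W. c ^ total_degree P * poly (specialize P x) (W / c)) has_field_derivative
     c ^ total_degree P * (poly (pderiv (specialize P x)) (Y / c) * (1 / c))) (at Y)"
    by (intro DERIV_cmult DERIV_chain2[OF poly_DERIV] DERIV_cdivide DERIV_ident)
  hence "c ^ total_degree P * (poly (pderiv (specialize P x)) (Y / c) * (1 / c)) = 0"
    using *(2) unfolding eq by (simp add: DERIV_imp_deriv)
  hence "eval2 (pderiv P) x y = 0"
    using c by (simp add: pderiv_specialize poly_specialize)
  thus False using assms by simp
qed

text \<open>Bridge between two evaluations: \<open>ratfun_at\<close> works in lowest terms,
  \<open>param_point\<close> with a common denominator \<open>C\<close>. At infinity,
  \<open>val C \<noteq> 0\<close> forces \<open>d = degree C\<close>, and the leading coefficient of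
  \<open>e\<close> cancels from the quotient.\<close>

lemma ratfun_at_eq_valI:
  assumes q: "quot_of_fract f = (p, q)" and C: "C = q * e" "A = p * e" "C \<noteq> 0"
    and d: "degree A \<le> d" "degree C \<le> d"
    and val: "val = (\<lambda>h. case t of Some z \<Rightarrow> poly h z | None \<Rightarrow> coeff h d)" "val C \<noteq> 0"
  shows "ratfun_at f t = Some (val A / val C)"
proof (cases t)
  case (Some z)
  thus ?thesis using val C q by (simp add: ratfun_at_def)
next
  case None
  have dC: "d = degree C" using val None d le_degree[of C d] by auto
  have nz: "q \<noteq> 0" "e \<noteq> 0" using C by auto
  have dq: "degree C = degree q + degree e" using C nz by (simp add: degree_mult_eq)
  have dp: "degree p \<le> degree q"
  proof (cases "p = 0")
    case False
    hence "degree A = degree p + degree e" using C nz by (simp add: degree_mult_eq)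
    thus ?thesis using d dC dq by simp
  qed simp
  have "coeff A d = coeff p (degree q) * lead_coeff e"
  proof (cases "degree p = degree q")
    case True
    thus ?thesis using C(2) dC dq coeff_mult_degree_sum[of p e] by simp
  next
    case False
    hence "coeff p (degree q) = 0" using dp by (simp add: coeff_eq_0)
    moreover have "degree A < d"
    proof (cases "p = 0")
      case True
      thus ?thesis using False dC dq C by simp
    next
      case False
      thus ?thesis using C(2) nz dC dq dp \<open>degree p \<noteq> degree q\<close> by (simp add: degree_mult_eq)
    qed
    ultimately show ?thesis by (simp add: coeff_eq_0)
  qed
  moreover have "coeff C d = lead_coeff q * lead_coeff e"
    using C(1) dC dq coeff_mult_degree_sum[of q e] by simp
  ultimately show ?thesis using dp q val None nz by (simp add: ratfun_at_def)
qed

lemma quot_of_fract_coprime: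
  assumes "quot_of_fract f = (p, q)"
  shows "coprime p q" "q \<noteq> 0" "f = Fract p q"
  using assms coprime_quot_of_fract[of f] snd_quot_of_fract_nonzero[of f] Fract_quot_of_fract[of f]
  by simp_all

text \<open>The point at issue is that \<open>C\<close> cannot vanish where both \<open>f\<close>
  and \<open>g\<close> are finite. At a finite parameter this holds because \<open>C\<close> divides
  the product of the two denominators; at infinity, because finiteness bounds the degrees of
  \<open>A\<close> and \<open>B\<close> by that of \<open>C\<close>.\<close>

lemma param_point_eq_affine_iff:
  "param_point f g t = proj_point x y 1 \<longleftrightarrow> ratfun_at f t = Some x \<and> ratfun_at g t = Some y"
proof -
  obtain p q where f: "quot_of_fract f = (p, q)" by (cases "quot_of_fract f")
  obtain p' q' where g: "quot_of_fract g = (p', q')" by (cases "quot_of_fract g")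
  note fq = quot_of_fract_coprime[OF f] and gq = quot_of_fract_coprime[OF g]
  define C where "C = lcm q q'"
  define A where "A = p * (C div q)"
  define B where "B = p' * (C div q')"
  define d where "d = Max {degree A, degree B, degree C}"
  define val where "val = (\<lambda>h. case t of Some z \<Rightarrow> poly h z | None \<Rightarrow> coeff (h :: complex poly) d)"
  have pp: "param_point f g t = proj_point (val A) (val B) (val C)"
    unfolding param_point_def f g by (simp only: Let_def C_def A_def B_def d_def val_def prod.case)
  have C0: "C \<noteq> 0" using fq gq by (simp add: C_def lcm_eq_0_iff)
  have Ce: "C = q * (C div q)" "C = q' * (C div q')" by (simp_all add: C_def)
  have d: "degree A \<le> d" "degree B \<le> d" "degree C \<le> d" by (simp_all add: d_def)
  have 1: "ratfun_at f t = Some (val A / val C)" "ratfun_at g t = Some (val B / val C)" if "val C \<noteq> 0"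
    using ratfun_at_eq_valI[OF f Ce(1) A_def C0 d(1,3) val_def that]
      ratfun_at_eq_valI[OF g Ce(2) B_def C0 d(2,3) val_def that] by simp_all
  have 2: "val C \<noteq> 0" if fs: "ratfun_at f t = Some x" and gs: "ratfun_at g t = Some y"
  proof (cases t)
    case (Some z)
    hence "poly q z \<noteq> 0" "poly q' z \<noteq> 0"
      using fs gs f g by (auto simp: ratfun_at_def split: if_splits)
    moreover obtain k where "q * q' = C * k"
      unfolding C_def using lcm_least[of q "q * q'" q'] by (meson dvd_def dvd_triv_left dvd_triv_right)
    hence "poly q z * poly q' z = poly C z * poly k z" by (metis poly_mult)
    ultimately show ?thesis using Some by (auto simp: val_def)
  next
    case None
    hence dp: "degree p \<le> degree q" "degree p' \<le> degree q'"
      using fs gs f g by (auto simp: ratfun_at_def split: if_splits)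
    have "degree A \<le> degree C"
    proof -
      have "degree A \<le> degree p + degree (C div q)" unfolding A_def by (rule degree_mult_le)
      also have "\<dots> \<le> degree q + degree (C div q)" using dp by simp
      also have "\<dots> = degree C" using Ce(1) C0 fq
        by (metis degree_mult_eq mult_eq_0_iff)
      finally show ?thesis .
    qed
    moreover have "degree B \<le> degree C"
    proof -
      have "degree B \<le> degree p' + degree (C div q')" unfolding B_def by (rule degree_mult_le)
      also have "\<dots> \<le> degree q' + degree (C div q')" using dp by simp
      also have "\<dots> = degree C" using Ce(2) C0 gq
        by (metis degree_mult_eq mult_eq_0_iff)
      finally show ?thesis .
    qed
    ultimately have "d = degree C" by (simp add: d_def)
    thus ?thesis using None C0 by (simp add: val_def)
  qed
  show ?thesis
  proof
    assume "param_point f g t = proj_point x y 1"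
    then obtain c where c: "c \<noteq> 0" "val A = c * x" "val B = c * y" "val C = c"
      unfolding pp proj_point_eq_iff by auto
    thus "ratfun_at f t = Some x \<and> ratfun_at g t = Some y" using 1 by simp
  next
    assume *: "ratfun_at f t = Some x \<and> ratfun_at g t = Some y"
    hence nz: "val C \<noteq> 0" using 2 by simp
    with 1 * have "x = val A / val C" "y = val B / val C" by simp_all
    thus "param_point f g t = proj_point x y 1"
      unfolding pp proj_point_eq_iff using nz by (intro exI[of _ "val C"]) simp
  qed
qed

section \<open>Values of x with irregular fibres\<close>

lemma finite_ratfun_at_None: "finite {t. ratfun_at g t = None}"
proof -
  obtain p q where g: "quot_of_fract g = (p, q)" by (cases "quot_of_fract g")
  note q = quot_of_fract_coprime[OF g]
  have "{t. ratfun_at g t = None} \<subseteq> insert None (Some ` {z. poly q z = 0})"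
  proof
    fix t assume "t \<in> {t. ratfun_at g t = None}"
    thus "t \<in> insert None (Some ` {z. poly q z = 0})"
      using g by (cases t) (auto simp: ratfun_at_def split: if_splits)
  qed
  thus ?thesis by (rule finite_subset) (simp add: poly_roots_finite q)
qed

text \<open>\<open>r\<close> stands in for the discriminant. By pseudo-division, an element
  \<open>h\<close> of least degree in y in the ideal of \<open>P\<close> and its y-derivative
  divides multiples of both by nonzero polynomials in x. As \<open>P\<close> is irreducible and its
  derivative has smaller degree, \<open>h\<close> is free of y; it vanishes wherever both generators
  do.\<close>

lemma irreducible_pderiv_resultant:
  fixes P :: "complex poly poly"
  assumes P: "irreducible P" and deg: "degree P > 0"
  obtains r where "r \<noteq> 0" "\<And>x y. eval2 P x y = 0 \<Longrightarrow> eval2 (pderiv P) x y = 0 \<Longrightarrow> poly r x = 0"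
proof -
  define Q where "Q = pderiv P"
  have Q0: "Q \<noteq> 0" and degQ: "degree Q < degree P"
    using deg by (auto simp: Q_def pderiv_eq_0_iff degree_pderiv)
  have prime: "prime_elem P" using P by (rule irreducible_imp_prime_elem)
  have P0: "P \<noteq> 0" using deg by auto
  define I where "I = {h. \<exists>a b. h = a * P + b * Q}"
  have PQ: "P \<in> I" "Q \<in> I"
  proof -
    have "P = 1 * P + 0 * Q" "Q = 0 * P + 1 * Q" by simp_all
    thus "P \<in> I" "Q \<in> I" unfolding I_def by blast+
  qed
  have ex: "\<exists>h. h \<in> I \<and> h \<noteq> 0"
    using P0 PQ by blast
  define h where "h = arg_min degree (\<lambda>h. h \<in> I \<and> h \<noteq> 0)"
  from ex obtain h0 where "h0 \<in> I \<and> h0 \<noteq> 0" by blast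
  from arg_min_nat_lemma[of "\<lambda>h. h \<in> I \<and> h \<noteq> 0", OF this, of degree]
  have h: "h \<in> I" "h \<noteq> 0" and min: "\<And>k. k \<in> I \<Longrightarrow> k \<noteq> 0 \<Longrightarrow> degree h \<le> degree k"
    by (auto simp: h_def)
  have I_diff: "smult c a - h * b \<in> I" if aI: "a \<in> I" for a b c
  proof -
    obtain a1 a2 h1 h2 where "a = a1 * P + a2 * Q" "h = h1 * P + h2 * Q"
      using aI h(1) unfolding I_def by blast
    hence "smult c a - h * b = (smult c a1 - h1 * b) * P + (smult c a2 - h2 * b) * Q"
      by (simp add: algebra_simps smult_add_right)
    thus ?thesis unfolding I_def by blast
  qed
  have div: "\<exists>c. c \<noteq> 0 \<and> h dvd smult c a" if "a \<in> I" for a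
  proof -
    obtain b r where br: "pseudo_divmod a h = (b, r)" by (cases "pseudo_divmod a h")
    define c where "c = lead_coeff h ^ (Suc (degree a) - degree h)"
    have *: "smult c a = h * b + r" "r = 0 \<or> degree r < degree h"
      using pseudo_divmod[OF h(2) br] by (simp_all add: c_def)
    have "r \<in> I" using I_diff[OF that, of c b] *(1) by simp
    hence "r = 0" using min[of r] *(2) not_less by blast
    thus ?thesis using *(1) h(2) by (intro exI[of _ c]) (auto simp: c_def)
  qed
  from div[OF PQ(1)] obtain c where c: "c \<noteq> 0" "h dvd smult c P" by blast
  from div[OF PQ(2)] obtain c' where c': "c' \<noteq> 0" "h dvd smult c' Q" by blast
  from c obtain k where k: "smult c P = h * k" by (elim dvdE)
  \<comment> \<open>Otherwise \<open>P\<close> would divide a nonzero multiple of its derivative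
    whose degree in y is too small. The prime element \<open>P\<close> therefore divides the
    cofactor \<open>k\<close>, which leaves \<open>h\<close> a divisor of a polynomial in x
    alone.\<close>
  have "\<not> P dvd h"
  proof
    assume "P dvd h"
    hence "P dvd smult c' Q" using c' dvd_trans by blast
    moreover have "smult c' Q \<noteq> 0" using c' Q0 by simp
    ultimately have "degree P \<le> degree (smult c' Q)" by (rule dvd_imp_degree_le)
    thus False using degQ c' by simp
  qed
  moreover have "P dvd h * k" unfolding k[symmetric] by (simp add: dvd_smult)
  ultimately have "P dvd k" using prime by (auto simp: prime_elem_dvd_mult_iff)
  then obtain k' where k': "k = P * k'" by (elim dvdE)
  have "P * (h * k') = P * [:c:]" using k unfolding k' by (simp add: mult_ac)
  hence hk: "h * k' = [:c:]" using P0 by (metis mult_left_cancel)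
  hence "degree h = 0"
    using c h by (metis degree_mult_eq degree_pCons_0 mult_eq_0_iff pCons_eq_0_iff add_is_0)
  then obtain r where r: "h = [:r:]" by (metis degree_eq_zeroE)
  show ?thesis
  proof (rule that)
    show "r \<noteq> 0" using r h by auto
    fix x y assume e: "eval2 P x y = 0" "eval2 (pderiv P) x y = 0"
    obtain a b where "h = a * P + b * Q" using h unfolding I_def by blast
    hence "eval2 h x y = eval2 a x y * eval2 P x y + eval2 b x y * eval2 Q x y"
      by (simp add: eval2_def)
    hence "eval2 h x y = 0" using e by (simp add: Q_def)
    thus "poly r x = 0" by (simp add: r eval2_def)
  qed
qed

text \<open>Off \<open>Z\<close> every y on the curve over \<open>x\<close> is a simple root of
  \<open>specialize P x\<close>, so the point is nonsingular and the parametrization is injective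
  above \<open>x\<close>; surjectivity onto the curve gives the rest.\<close>

lemma parametrized_fibre:
  assumes par: "parametrized_by P f g"
  obtains Z where "finite Z"
    "\<And>x. x \<notin> Z \<Longrightarrow> poly (lead_coeff P) x \<noteq> 0"
    "\<And>x. x \<notin> Z \<Longrightarrow> bij_betw (\<lambda>t. the (ratfun_at g t)) {t. ratfun_at f t = Some x} {y. eval2 P x y = 0}"
    "\<And>x t. x \<notin> Z \<Longrightarrow> ratfun_at f t = Some x \<Longrightarrow> ratfun_at g t \<noteq> None"
    "\<And>x y. x \<notin> Z \<Longrightarrow> eval2 P x y = 0 \<Longrightarrow> order y (specialize P x) = 1"
proof -
  have irr: "irreducible P" and range: "range (param_point f g) = proj_curve P"
    and inj: "inj_on (param_point f g) {t. param_point f g t \<notin> singular_points P}"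
    using par by (auto simp: parametrized_by_def)
  have P0: "P \<noteq> 0" using irr by auto
  obtain r where r: "r \<noteq> 0" "\<And>x y. eval2 P x y = 0 \<Longrightarrow> eval2 (pderiv P) x y = 0 \<Longrightarrow> poly r x = 0"
  proof (cases "degree P = 0")
    case True
    \<comment> \<open>\<open>P\<close> is then a polynomial in x alone and itself serves as
      \<open>r\<close>: off its zeros the fibre is empty.\<close>
    then obtain p where p: "P = [:p:]" by (metis degree_eq_zeroE)
    thus ?thesis using P0 that[of p] by (auto simp: eval2_def)
  next
    case False
    thus ?thesis using irreducible_pderiv_resultant[OF irr] that by blast
  qed
  \<comment> \<open>Removed are the x-values where a multiple root may occur, those where the degree
    in y drops, and those of the poles of \<open>g\<close>. Where \<open>f\<close> has a pole as
    well, \<open>the\<close> yields an unspecified value, which does no harm to finiteness.\<close>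
  define Z where "Z = {x. poly r x = 0} \<union> {x. poly (lead_coeff P) x = 0} \<union>
     (\<lambda>t. the (ratfun_at f t)) ` {t. ratfun_at g t = None}"
  have gN: "ratfun_at g t \<noteq> None" if "x \<notin> Z" "ratfun_at f t = Some x" for x t
  proof
    assume "ratfun_at g t = None"
    hence "the (ratfun_at f t) \<in> Z" unfolding Z_def by blast
    thus False using that by simp
  qed
  have ns: "eval2 (pderiv P) x y \<noteq> 0" if "x \<notin> Z" "eval2 P x y = 0" for x y
    using r(2)[of x y] that by (auto simp: Z_def)
  show ?thesis
  proof (rule that)
    show "finite Z" unfolding Z_def using r P0
      by (intro finite_UnI finite_imageI poly_roots_finite finite_ratfun_at_None) auto
    show "poly (lead_coeff P) x \<noteq> 0" if "x \<notin> Z" for x using that by (simp add: Z_def)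
    show "ratfun_at g t \<noteq> None" if "x \<notin> Z" "ratfun_at f t = Some x" for x t by (rule gN[OF that])
    show "order y (specialize P x) = 1" if "x \<notin> Z" "eval2 P x y = 0" for x y
      using ns[OF that] that(2) by (intro simple_root_order) (simp_all add: poly_specialize pderiv_specialize)
    show "bij_betw (\<lambda>t. the (ratfun_at g t)) {t. ratfun_at f t = Some x} {y. eval2 P x y = 0}"
      if x: "x \<notin> Z" for x
    proof -
      have pp: "param_point f g t = proj_point x (the (ratfun_at g t)) 1" if "ratfun_at f t = Some x" for t
        using gN[OF x that] that by (subst param_point_eq_affine_iff) auto
      have into: "eval2 P x (the (ratfun_at g t)) = 0" if "ratfun_at f t = Some x" for t
        using pp[OF that] range proj_point_affine_in_curve_iff by (metis rangeI)
      have "t = t'" if "ratfun_at f t = Some x" "ratfun_at f t' = Some x"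
         "the (ratfun_at g t) = the (ratfun_at g t')" for t t'
      proof (rule inj_onD[OF inj])
        show "param_point f g t = param_point f g t'" using pp that by simp
        have "param_point f g t \<notin> singular_points P" "param_point f g t' \<notin> singular_points P"
          using that(1,2) pp affine_nonsingular ns[OF x] into by auto
        thus "t \<in> {t. param_point f g t \<notin> singular_points P}"
          "t' \<in> {t. param_point f g t \<notin> singular_points P}" by auto
      qed
      moreover have "\<exists>t. ratfun_at f t = Some x \<and> the (ratfun_at g t) = y" if "eval2 P x y = 0" for y
      proof -
        have "proj_point x y 1 \<in> range (param_point f g)"
          using that range proj_point_affine_in_curve_iff by blast
        then obtain t where "param_point f g t = proj_point x y 1" by (metis rangeE)
        thus ?thesis unfolding param_point_eq_affine_iff by (intro exI[of _ t]) auto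
      qed
      ultimately show ?thesis unfolding bij_betw_def inj_on_def using into by (auto simp: image_iff) (metis)
    qed
  qed
qed

section \<open>Factored rational functions\<close>

definition factored_eval ::
    "complex \<Rightarrow> nat \<Rightarrow> (nat \<Rightarrow> complex) \<Rightarrow> (nat \<Rightarrow> int) \<Rightarrow> complex \<Rightarrow> complex" where
  "factored_eval c n a e z = c * (\<Prod>k<n. (z - a k) powi e k)"

lemma to_fract_power: "to_fract (x ^ k) = to_fract x ^ k"
  by (induction k) simp_all

lemma to_fract_prod: "to_fract (\<Prod>k\<in>A. x k) = (\<Prod>k\<in>A. to_fract (x k))"
  by (induction A rule: infinite_finite_induct) simp_all

lemma power_int_nat_quotient:
  assumes "x \<noteq> (0 :: 'a :: field)"
  shows "x powi e = x ^ nat e / x ^ nat (- e)"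
  using assms by (cases "e \<ge> 0") (auto simp: power_int_def field_simps)

definition factored_num :: "complex \<Rightarrow> nat \<Rightarrow> (nat \<Rightarrow> complex) \<Rightarrow> (nat \<Rightarrow> int) \<Rightarrow> complex poly" where
  "factored_num c n a e = [:c:] * (\<Prod>k<n. [:- a k, 1:] ^ nat (e k))"

definition factored_denom :: "nat \<Rightarrow> (nat \<Rightarrow> complex) \<Rightarrow> (nat \<Rightarrow> int) \<Rightarrow> complex poly" where
  "factored_denom n a e = (\<Prod>k<n. [:- a k, 1:] ^ nat (- e k))"

lemma factored_denom_nonzero: "factored_denom n a e \<noteq> 0"
  by (auto simp: factored_denom_def)

lemma factored_fract_eq: "factored_fract c n a e = Fract (factored_num c n a e) (factored_denom n a e)"
proof -
  have "to_fract [:- a k, 1:] powi e k = to_fract ([:- a k, 1:] ^ nat (e k)) / to_fract ([:- a k, 1:] ^ nat (- e k))" for k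
    by (subst power_int_nat_quotient) (simp_all add: to_fract_power)
  hence "factored_fract c n a e = to_fract (factored_num c n a e) / to_fract (factored_denom n a e)"
    unfolding factored_fract_def factored_num_def factored_denom_def
    by (simp only: to_fract_prod to_fract_mult prod_dividef times_divide_eq_right)
  thus ?thesis by (simp add: Fract_conv_to_fract)
qed

lemma coprime_no_common_root:
  fixes p q :: "complex poly"
  assumes "coprime p q" "poly p z = 0"
  shows "poly q z \<noteq> 0"
proof
  assume "poly q z = 0"
  hence "[:-z, 1:] dvd p" "[:-z, 1:] dvd q" using assms(2) by (simp_all add: poly_eq_0_iff_dvd)
  hence "is_unit [:-z, 1:]" using assms(1) not_coprimeI by blast
  thus False by (simp add: is_unit_iff_degree)
qed

text \<open>The reduced fraction is not computed: cross-multiplication with the factored form,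
  together with coprimality of \<open>p\<close> and \<open>q\<close>, decides whether
  \<open>q\<close> vanishes at \<open>z\<close>.\<close>

lemma ratfun_at_factored:
  assumes c: "c \<noteq> 0" and z: "\<And>k. k < n \<Longrightarrow> z \<noteq> a k"
  shows "ratfun_at (factored_fract c n a e) (Some z) = Some (factored_eval c n a e z)"
proof -
  obtain p q where pq: "quot_of_fract (factored_fract c n a e) = (p, q)"
    by (cases "quot_of_fract (factored_fract c n a e)")
  note q = quot_of_fract_coprime[OF pq]
  define N where "N = factored_num c n a e"
  define M where "M = factored_denom n a e"
  have "p * M = N * q"
    using q(3) q(2) factored_denom_nonzero factored_fract_eq[of c n a e] by (simp add: eq_fract M_def N_def)
  hence e: "poly p z * poly M z = poly N z * poly q z" by (metis poly_mult)
  have M0: "poly M z = (\<Prod>k<n. (z - a k) ^ nat (- e k))"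
    and N0: "poly N z = c * (\<Prod>k<n. (z - a k) ^ nat (e k))"
    by (simp_all add: M_def N_def factored_num_def factored_denom_def poly_prod poly_power)
  have M1: "poly M z \<noteq> 0" and N1: "poly N z \<noteq> 0"
    using z c by (auto simp: M0 N0)
  have q1: "poly q z \<noteq> 0"
  proof
    assume "poly q z = 0"
    hence "poly p z = 0" using e M1 by simp
    thus False using coprime_no_common_root[OF q(1)] \<open>poly q z = 0\<close> by blast
  qed
  have "poly p z / poly q z = poly N z / poly M z" using e M1 q1 by (simp add: field_simps)
  also have "\<dots> = factored_eval c n a e z"
    using z unfolding factored_eval_def M0 N0
    by (simp add: power_int_nat_quotient prod_dividef)
  finally show ?thesis using pq q1 by (simp add: ratfun_at_def)
qed

text \<open>As the points \<open>a k\<close> are distinct and the exponents nonzero, exactly one of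
  factored numerator and denominator vanishes at \<open>a j\<close>. Hence no \<open>a j\<close> can
  lie where the function has modulus 1.\<close>

lemma ratfun_at_factored_root:
  assumes c: "c \<noteq> 0" and inj: "inj_on a {..<n}" and e: "\<And>k. k < n \<Longrightarrow> e k \<noteq> 0" and j: "j < n"
  shows "ratfun_at (factored_fract c n a e) (Some (a j)) = (if e j > 0 then Some 0 else None)"
proof -
  obtain p q where pq: "quot_of_fract (factored_fract c n a e) = (p, q)"
    by (cases "quot_of_fract (factored_fract c n a e)")
  note q = quot_of_fract_coprime[OF pq]
  define N where "N = factored_num c n a e"
  define M where "M = factored_denom n a e"
  define z where "z = a j"
  have "p * M = N * q"
    using q(3) q(2) factored_denom_nonzero factored_fract_eq[of c n a e] by (simp add: eq_fract M_def N_def)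
  hence eq: "poly p z * poly M z = poly N z * poly q z" by (metis poly_mult)
  have M0: "poly M z = (\<Prod>k<n. (z - a k) ^ nat (- e k))"
    and N0: "poly N z = c * (\<Prod>k<n. (z - a k) ^ nat (e k))"
    by (simp_all add: M_def N_def factored_num_def factored_denom_def poly_prod poly_power)
  have za: "z = a k \<longleftrightarrow> k = j" if "k < n" for k
    using inj_onD[OF inj, of k j] that j by (auto simp: z_def)
  show ?thesis
  proof (cases "e j > 0")
    case True
    have "(\<Prod>k<n. (z - a k) ^ nat (e k)) = 0"
      using True j by (intro prod_zero) (auto simp: z_def intro!: bexI[of _ j])
    hence "poly N z = 0" by (simp add: N0)
    moreover have "poly M z \<noteq> 0" using True za by (auto simp: M0)
    ultimately have "poly p z = 0" using eq by simp
    thus ?thesis using coprime_no_common_root[OF q(1)] True pq by (simp add: ratfun_at_def z_def)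
  next
    case False
    hence ej: "e j < 0" using e[OF j] by simp
    have "(\<Prod>k<n. (z - a k) ^ nat (- e k)) = 0"
      using ej j by (intro prod_zero) (auto simp: z_def intro!: bexI[of _ j])
    hence "poly M z = 0" by (simp add: M0)
    moreover have "poly N z \<noteq> 0" using ej za c by (auto simp: N0)
    ultimately have "poly q z = 0" using eq by simp
    thus ?thesis using False pq by (simp add: ratfun_at_def z_def)
  qed
qed

section \<open>Derivative, logarithm and expansion at infinity of a factored function\<close>

lemma factored_eval_nonzero:
  assumes "c \<noteq> 0" "\<And>k. k < n \<Longrightarrow> z \<noteq> a k"
  shows "factored_eval c n a e z \<noteq> 0"
  using assms by (auto simp: factored_eval_def)

lemma has_field_derivative_factored_eval:
  assumes "\<And>k. k < n \<Longrightarrow> z \<noteq> a k"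
  shows "(factored_eval c n a e has_field_derivative
     factored_eval c n a e z * (\<Sum>k<n. of_int (e k) / (z - a k))) (at z)"
  using assms
proof (induction n)
  case 0
  have "factored_eval c 0 a e = (\<lambda>z. c)" by (auto simp: factored_eval_def)
  thus ?case by simp
next
  case (Suc n)
  have z: "z - a n \<noteq> 0" using Suc.prems[of n] by simp
  have IH: "(factored_eval c n a e has_field_derivative
     factored_eval c n a e z * (\<Sum>k<n. of_int (e k) / (z - a k))) (at z)"
    using Suc by auto
  have "((\<lambda>z. (z - a n) powi e n) has_field_derivative (of_int (e n) * (z - a n) powi (e n - 1) * 1)) (at z)"
    using z by (intro DERIV_power_int) (auto intro!: derivative_eq_intros)
  moreover have "(z - a n) powi (e n - 1) = (z - a n) powi e n / (z - a n)"
    using z by (simp add: power_int_diff)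
  ultimately have D: "((\<lambda>z. (z - a n) powi e n) has_field_derivative
      (z - a n) powi e n * (of_int (e n) / (z - a n))) (at z)" by (simp add: mult_ac)
  have "factored_eval c (Suc n) a e = (\<lambda>z. factored_eval c n a e z * (z - a n) powi e n)"
    by (auto simp: factored_eval_def)
  with DERIV_mult[OF IH D] show ?case
    by (simp add: algebra_simps)
qed

lemma ln_cmod_power_int:
  assumes "x \<noteq> 0"
  shows "ln (cmod (x powi k)) = of_int k * ln (cmod x)"
  using assms by (simp add: power_int_nat_quotient norm_divide norm_power ln_div ln_realpow)
    (cases "k \<ge> 0"; simp)

lemma ln_cmod_prod_power_int:
  assumes "c \<noteq> 0" "finite A" "\<And>k. k \<in> A \<Longrightarrow> x k \<noteq> 0"
  shows "ln (cmod (c * (\<Prod>k\<in>A. x k powi e k))) = ln (cmod c) + (\<Sum>k\<in>A. of_int (e k) * ln (cmod (x k)))"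
proof -
  have "cmod (c * (\<Prod>k\<in>A. x k powi e k)) = cmod c * (\<Prod>k\<in>A. cmod (x k powi e k))"
    by (simp add: norm_mult flip: prod_norm)
  also have "ln \<dots> = ln (cmod c) + ln (\<Prod>k\<in>A. cmod (x k powi e k))"
    using assms by (intro ln_mult_pos prod_pos) auto
  also have "ln (\<Prod>k\<in>A. cmod (x k powi e k)) = (\<Sum>k\<in>A. ln (cmod (x k powi e k)))"
    using assms by (intro ln_prod) auto
  finally show ?thesis using assms by (simp add: ln_cmod_power_int)
qed

text \<open>With \<open>r = p - smult c q\<close> the difference is \<open>r / q\<close>;
  \<open>r\<close> is nonzero because the function is not constant, and its coefficient in degree
  \<open>degree q\<close> cancels by the value of \<open>c\<close>. The exponent
  \<open>k = degree q - degree r\<close> is the order to which the value \<open>c\<close> is taken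
  at infinity.\<close>

lemma ratfun_expansion_at_infinity:
  assumes c0: "c0 \<noteq> 0" and at_inf: "ratfun_at (factored_fract c0 n a e) None = Some c" and c: "c \<noteq> 0"
    and nonconst: "\<exists>t. ratfun_at (factored_fract c0 n a e) t \<notin> {None, Some c}"
  obtains k A where "A \<noteq> 0" "k > 0"
    "((\<lambda>z. (factored_eval c0 n a e z - c) * z ^ k) \<longlongrightarrow> A) at_infinity"
proof -
  obtain p q where pq: "quot_of_fract (factored_fract c0 n a e) = (p, q)"
    by (cases "quot_of_fract (factored_fract c0 n a e)")
  note q = quot_of_fract_coprime[OF pq]
  have dp: "degree p \<le> degree q" and cc: "c = coeff p (degree q) / lead_coeff q"
    using at_inf pq by (auto simp: ratfun_at_def split: if_splits)
  define r where "r = p - smult c q"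
  have r0: "r \<noteq> 0"
  proof
    assume "r = 0"
    hence p: "p = smult c q" by (simp add: r_def)
    have "ratfun_at (factored_fract c0 n a e) t \<in> {None, Some c}" for t
      using pq q by (cases t) (auto simp: ratfun_at_def p)
    thus False using nonconst by blast
  qed
  have "coeff r (degree q) = 0" using cc q by (simp add: r_def)
  moreover have "degree r \<le> degree q" unfolding r_def using dp by (intro degree_diff_le) auto
  ultimately have dr: "degree r < degree q"
    using r0 by (metis le_neq_implies_less leading_coeff_0_iff)
  define k where "k = degree q - degree r"
  have ev: "eventually (\<lambda>z. z \<noteq> 0 \<and> poly q z \<noteq> 0 \<and> (\<forall>k<n. z \<noteq> a k)) at_infinity"
  proof -
    have "finite ({0} \<union> {z. poly q z = 0} \<union> a ` {..<n})" using q by (auto simp: poly_roots_finite)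
    hence "bounded ({0} \<union> {z. poly q z = 0} \<union> a ` {..<n})" by (rule finite_imp_bounded)
    then obtain B where B: "\<forall>x\<in>{0} \<union> {z. poly q z = 0} \<union> a ` {..<n}. cmod x \<le> B"
      unfolding bounded_iff by blast
    show ?thesis unfolding eventually_at_infinity
    proof (intro exI[of _ "B + 1"] allI impI)
      fix z assume "B + 1 \<le> cmod z"
      hence "\<not> cmod z \<le> B" by linarith
      hence "z \<notin> {0} \<union> {z. poly q z = 0} \<union> a ` {..<n}" using B by blast
      thus "z \<noteq> 0 \<and> poly q z \<noteq> 0 \<and> (\<forall>k<n. z \<noteq> a k)" by auto
    qed
  qed
  have "((\<lambda>z. (poly r z / z ^ degree r) / (poly q z / z ^ degree q)) \<longlongrightarrow> lead_coeff r / lead_coeff q) at_infinity"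
    using q by (intro tendsto_divide poly_divide_tendsto_aux) auto
  moreover have "eventually (\<lambda>z. (poly r z / z ^ degree r) / (poly q z / z ^ degree q) =
      (factored_eval c0 n a e z - c) * z ^ k) at_infinity"
    using ev
  proof eventually_elim
    case (elim z)
    have "ratfun_at (factored_fract c0 n a e) (Some z) = Some (poly p z / poly q z)"
      using pq elim by (simp add: ratfun_at_def)
    hence "factored_eval c0 n a e z = poly p z / poly q z"
      using ratfun_at_factored[OF c0, of n z a e] elim by simp
    hence E: "factored_eval c0 n a e z - c = poly r z / poly q z"
      using elim by (simp add: r_def diff_divide_distrib)
    have D: "z ^ degree q = z ^ k * z ^ degree r" using dr by (simp add: k_def flip: power_add)
    have "(u / w) / (v / (x * w)) = u / v * x" if "w \<noteq> 0" for u v w x :: complex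
      using that by simp
    thus ?case unfolding E D using elim by simp
  qed
  ultimately have "((\<lambda>z. (factored_eval c0 n a e z - c) * z ^ k) \<longlongrightarrow> lead_coeff r / lead_coeff q) at_infinity"
    by (rule Lim_transform_eventually)
  thus ?thesis using that[of "lead_coeff r / lead_coeff q" k] r0 q dr by (simp add: k_def)
qed

section \<open>Paths and winding angles\<close>

lemma Im_Ln_cis:
  assumes "\<bar>x\<bar> < pi"
  shows "Im (Ln (cis x)) = x"
  using Ln_exp[of "\<i> * of_real x"] assms by (simp add: cis_conv_exp abs_less_iff)

lemma ball_1_not_nonpos: "(z::complex) \<in> ball 1 1 \<Longrightarrow> z \<notin> \<real>\<^sub>\<le>\<^sub>0"
proof
  assume z: "z \<in> ball 1 1" "z \<in> \<real>\<^sub>\<le>\<^sub>0"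
  have "Re (1 - z) \<le> cmod (1 - z)" by (rule complex_Re_le_cmod)
  thus False using z by (auto simp: dist_norm complex_nonpos_Reals_iff)
qed

lemma eventually_within_finite:
  assumes "finite (K :: real set)"
  shows "eventually (\<lambda>s. s \<in> A \<and> s \<noteq> x \<and> s \<notin> K) (at x within A)"
proof -
  have "eventually (\<lambda>s. s \<in> - (K - {x})) (nhds x)"
    using assms by (intro eventually_nhds_in_open) (auto intro!: open_Compl finite_imp_closed simp del: Compl_Diff_eq)
  thus ?thesis unfolding eventually_at_filter by eventually_elim auto
qed

text \<open>Logarithmic derivative of H^k t / A, for use at a passage through infinity:
  \<open>H\<close> is h - b, \<open>P\<close> its power of exponent k - 1, \<open>w\<close> is k,
  and \<open>u\<close>, \<open>v\<close> are the derivatives of h and \<open>t\<close>.\<close>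

lemma log_deriv_quotient:
  fixes A P H t u v w :: complex
  assumes "A \<noteq> 0" "P \<noteq> 0" "H \<noteq> 0" "t \<noteq> 0"
  shows "(w * P * u * t + H * P * v) / A / (H * P * t / A) = w * (u / H) + v / t"
proof -
  have "(w * P * u * t + H * P * v) / A / (H * P * t / A) = (w * P * u * t + H * P * v) / (H * P * t)"
    using assms(1) by simp
  also have "\<dots> = (w * u) / H + v / t"
    unfolding add_divide_distrib using assms(2-4) by simp
  finally show ?thesis by simp
qed

section \<open>A single path on |f| = 1 with a continuous angle\<close>

locale unit_path =
  fixes c0 :: complex and n :: nat and a :: "nat \<Rightarrow> complex" and e :: "nat \<Rightarrow> int"
    and \<gamma> :: "real \<Rightarrow> complex option" and \<theta> :: "real \<Rightarrow> real"
  assumes c0: "c0 \<noteq> 0" and inj_a: "inj_on a {..<n}" and e_nz: "\<And>k. k < n \<Longrightarrow> e k \<noteq> 0"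
    and path: "sphere_path \<gamma>" and cont_\<theta>: "continuous_on {0..1} \<theta>"
    and mono_\<theta>: "strict_mono_on {0..1} \<theta>"
    and f_\<gamma>: "\<And>s. s \<in> {0..1} \<Longrightarrow> ratfun_at (factored_fract c0 n a e) (\<gamma> s) = Some (cis (\<theta> s))"
begin

abbreviation "fr \<equiv> factored_fract c0 n a e"
abbreviation "h s \<equiv> the (\<gamma> s)"
abbreviation "h' s \<equiv> vector_derivative (\<lambda>s. the (\<gamma> s)) (at s)"

lemma inj_\<theta>: "inj_on \<theta> {0..1}"
  using mono_\<theta> by (rule strict_mono_on_imp_inj_on)

lemma finite_cis_\<theta>: "finite {s\<in>{0..1}. cis (\<theta> s) = z}"
proof (rule finite_imageD)
  have "\<theta> s \<in> {\<theta> 0..\<theta> 1}" if "s \<in> {0..1}" for s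
    using mono_onD[OF strict_mono_on_imp_mono_on[OF mono_\<theta>], of 0 s]
      mono_onD[OF strict_mono_on_imp_mono_on[OF mono_\<theta>], of s 1] that by auto
  hence "\<theta> ` {s\<in>{0..1}. cis (\<theta> s) = z} \<subseteq> {x\<in>{\<theta> 0..\<theta> 1}. cis x = z}" by blast
  thus "finite (\<theta> ` {s\<in>{0..1}. cis (\<theta> s) = z})"
    using finite_cis_eq finite_subset by blast
  show "inj_on \<theta> {s\<in>{0..1}. cis (\<theta> s) = z}"
    using inj_\<theta> by (rule inj_on_subset) auto
qed

text \<open>Along the path \<open>f\<close> equals \<open>cis \<theta>\<close> with
  \<open>\<theta>\<close> strictly increasing and bounded, so each value of \<open>f\<close>, and
  with it each point of the sphere, is met only finitely often. Passages through infinity or a zero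
  or pole of g thereby become finitely many exceptional parameters.\<close>

lemma finite_preimage: "finite {s\<in>{0..1}. \<gamma> s = t}"
proof (cases "\<exists>s\<in>{0..1}. \<gamma> s = t")
  case True
  then obtain s0 where s0: "s0 \<in> {0..1}" "\<gamma> s0 = t" by blast
  have "{s\<in>{0..1}. \<gamma> s = t} \<subseteq> {s\<in>{0..1}. cis (\<theta> s) = cis (\<theta> s0)}"
    using f_\<gamma>[OF s0(1)] f_\<gamma> s0(2) by force
  thus ?thesis using finite_cis_\<theta> finite_subset by blast
next
  case False
  hence "{s\<in>{0..1}. \<gamma> s = t} = {}" by blast
  thus ?thesis by (simp only: finite.emptyI)
qed

text \<open>\<open>f\<close> has a zero or a pole at each \<open>a k\<close> but modulus 1 on the
  path. The winding integrands about these points therefore never meet their own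
  singularity.\<close>

lemma avoids_a: "s \<in> {0..1} \<Longrightarrow> k < n \<Longrightarrow> \<gamma> s \<noteq> Some (a k)"
  using f_\<gamma>[of s] ratfun_at_factored_root[OF c0 inj_a, where e = e and j = k] e_nz
  by (auto split: if_splits)

lemma f_eval: "s \<in> {0..1} \<Longrightarrow> \<gamma> s = Some z \<Longrightarrow> factored_eval c0 n a e z = cis (\<theta> s)"
  using f_\<gamma>[of s] avoids_a[of s] ratfun_at_factored[OF c0, of n z a e] by auto

lemma path_eventually:
  assumes U: "openin riemann_sphere U" and s: "s \<in> {0..1}" "\<gamma> s \<in> U"
  shows "eventually (\<lambda>x. \<gamma> x \<in> U) (at s within {0..1})"
proof -
  have "continuous_map (top_of_set {0..1}) riemann_sphere \<gamma>"
    using path by (simp add: sphere_path_def pathin_def)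
  hence "openin (top_of_set {0..1}) {x\<in>topspace (top_of_set {0..1}). \<gamma> x \<in> U}"
    using U by (rule openin_continuous_map_preimage)
  then obtain T where T: "open T" "{x\<in>{0..1}. \<gamma> x \<in> U} = {0..1} \<inter> T"
    unfolding openin_open by auto
  hence "s \<in> T" using s by blast
  thus ?thesis unfolding eventually_at_topological using T by blast
qed

lemma tendsto_finite:
  assumes s: "s \<in> {0..1}" "\<gamma> s = Some b"
  shows "(h \<longlongrightarrow> b) (at s within {0..1})"
proof (rule topological_tendstoI)
  fix U assume U: "open U" "b \<in> U"
  have "openin riemann_sphere (Some ` U)"
    using U by (simp add: riemann_sphere_def openin_Alexandroff_compactification_image_Some)
  hence "eventually (\<lambda>x. \<gamma> x \<in> Some ` U) (at s within {0..1})"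
    using s U by (intro path_eventually) auto
  thus "eventually (\<lambda>x. h x \<in> U) (at s within {0..1})" by eventually_elim auto
qed

lemma finite_infinity: "finite {s\<in>{0..1}. \<gamma> s = None}"
  by (rule finite_preimage)

lemma filterlim_infinity:
  assumes s: "s \<in> {0..1}" "\<gamma> s = None"
  shows "filterlim h at_infinity (at s within {0..1})"
  unfolding filterlim_at_infinity[OF order_refl]
proof (intro allI impI)
  fix r :: real assume "r > 0"
  have "openin riemann_sphere (insert None (Some ` (topspace euclidean - cball 0 r)))"
    unfolding riemann_sphere_def openin_Alexandroff_compactification
    by (intro disjI2 exI[of _ "cball 0 r"]) auto
  hence "eventually (\<lambda>x. \<gamma> x \<in> insert None (Some ` (topspace euclidean - cball 0 r))) (at s within {0..1})"
    using s by (intro path_eventually) auto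
  with eventually_within_finite[OF finite_infinity, of "{0..1}" s]
  show "eventually (\<lambda>x. r \<le> cmod (h x)) (at s within {0..1})"
    by eventually_elim auto
qed

text \<open>The endpoints are included so that the remaining parameters form an open set with
  two-sided derivatives, and passages through infinity so that \<open>the\<close> is meaningful. The
  choice operator fixes one such set for the whole locale.\<close>

definition exc :: "real set" where
  "exc = (SOME K. finite K \<and> {0,1} \<subseteq> K \<and> (\<forall>s\<in>{0..1} - K. \<gamma> s \<noteq> None \<and> (h has_vector_derivative h' s) (at s)))"

lemma exc: "finite exc" "0 \<in> exc" "1 \<in> exc"
  "\<And>s. s \<in> {0..1} - exc \<Longrightarrow> \<gamma> s = Some (h s)"
  "\<And>s. s \<in> {0..1} - exc \<Longrightarrow> (h has_vector_derivative h' s) (at s)"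
proof -
  obtain K c where K: "finite K" "c C1_differentiable_on ({0..1} - K)" "\<And>s. s\<in>{0..1} - K \<Longrightarrow> \<gamma> s = Some (c s)"
    using path unfolding sphere_path_def by blast
  have "\<gamma> s \<noteq> None \<and> (h has_vector_derivative h' s) (at s)" if s: "s \<in> {0..1} - (insert 0 (insert 1 K))" for s
  proof -
    have "c differentiable (at s)"
      using C1_differentiable_on_eq[of c] K(2) s by auto
    then obtain D where D: "(c has_vector_derivative D) (at s)"
      using vector_derivative_works by blast
    have "open ({0<..<1} - K)" using K(1) by (intro open_Diff finite_imp_closed) auto
    moreover have "s \<in> {0<..<1} - K" using s by auto
    ultimately have "(h has_vector_derivative D) (at s)"
      by (rule has_vector_derivative_transform_within_open[OF D]) (use K(3) in auto)
    thus ?thesis using K(3) s by (auto simp: vector_derivative_at)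
  qed
  hence "\<exists>K. finite K \<and> {0,1} \<subseteq> K \<and> (\<forall>s\<in>{0..1} - K. \<gamma> s \<noteq> None \<and> (h has_vector_derivative h' s) (at s))"
    using K(1) by (intro exI[of _ "insert 0 (insert 1 K)"]) auto
  from someI_ex[OF this, folded exc_def]
  show "finite exc" "0 \<in> exc" "1 \<in> exc"
    "\<And>s. s \<in> {0..1} - exc \<Longrightarrow> \<gamma> s = Some (h s)"
    "\<And>s. s \<in> {0..1} - exc \<Longrightarrow> (h has_vector_derivative h' s) (at s)"
    by auto
qed

lemma open_regular: "open ({0<..<1} - exc)"
  using exc(1) by (intro open_Diff finite_imp_closed) auto

lemma regular_eq: "{0..1} - exc = {0<..<1} - exc"
  using exc(2,3) by (force simp: less_le)

lemma eventually_regular: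
  assumes "s \<in> {0..1} - exc"
  shows "eventually (\<lambda>x. x \<in> {0..1} - exc) (nhds s)"
  unfolding regular_eq using assms open_regular regular_eq by (intro eventually_nhds_in_open) auto

text \<open>Imaginary part of the logarithmic derivative of \<open>f\<close> along the path, that
  is, the derivative of arg f written as a combination of winding integrands.\<close>

definition \<theta>' :: "real \<Rightarrow> real" where
  "\<theta>' s = (\<Sum>k<n. of_int (e k) * Im (h' s / (h s - a k)))"

text \<open>Near \<open>s\<close> the quotient
  \<open>F x / F s = cis (\<theta> x - \<theta> s)\<close> has an angle below \<pi> in modulus, so
  its principal argument recovers \<open>\<theta>\<close> up to the constant
  \<open>\<theta> s\<close>. Differentiability is inherited from the path, as
  \<open>\<theta>\<close> is only assumed continuous and increasing.\<close>

lemma \<theta>_deriv: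
  assumes s: "s \<in> {0..1} - exc"
  shows "(\<theta> has_vector_derivative \<theta>' s) (at s)"
proof -
  have ne: "h s \<noteq> a k" if "k < n" for k
    using avoids_a[of s k] exc(4)[OF s] s that by auto
  define F where "F = (\<lambda>x. factored_eval c0 n a e (h x))"
  have F0: "F s \<noteq> 0" unfolding F_def using ne by (intro factored_eval_nonzero c0)
  have dF: "(F has_vector_derivative (h' s * (F s * (\<Sum>k<n. of_int (e k) / (h s - a k))))) (at s)"
    using field_vector_diff_chain_at[OF exc(5)[OF s] has_field_derivative_factored_eval[of n "h s" a c0 e]] ne
    by (simp add: F_def o_def)
  hence "((\<lambda>x. F x / F s) has_vector_derivative (h' s * (F s * (\<Sum>k<n. of_int (e k) / (h s - a k)))) / F s) (at s)"
    by (rule has_vector_derivative_divide)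
  from has_vector_derivative_Im[OF has_vector_derivative_Ln[OF this]] F0
  have "((\<lambda>x. Im (Ln (F x / F s)) + \<theta> s) has_vector_derivative Im (h' s * (\<Sum>k<n. of_int (e k) / (h s - a k))) + 0) (at s)"
    by (intro has_vector_derivative_add has_vector_derivative_const) (simp add: mult_ac)
  also have "Im (h' s * (\<Sum>k<n. of_int (e k) / (h s - a k))) + 0 = \<theta>' s"
  proof -
    have "h' s * (\<Sum>k<n. of_int (e k) / (h s - a k)) = (\<Sum>k<n. real_of_int (e k) *\<^sub>R (h' s / (h s - a k)))"
      by (simp add: sum_distrib_left scaleR_conv_of_real mult_ac)
    thus ?thesis by (simp only: \<theta>'_def Im_sum scaleR_complex.sel add_0_right)
  qed
  finally have D: "((\<lambda>x. Im (Ln (F x / F s)) + \<theta> s) has_vector_derivative \<theta>' s) (at s)" .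
  have "isCont \<theta> s"
    using continuous_on_interior[OF cont_\<theta>, of s] s regular_eq by auto
  hence "eventually (\<lambda>x. \<theta> x \<in> ball (\<theta> s) pi) (nhds s)"
    by (rule isCont_eventually_nhds) auto
  with eventually_regular[OF s]
  have "eventually (\<lambda>x. Im (Ln (F x / F s)) + \<theta> s = \<theta> x) (nhds s)"
  proof eventually_elim
    case (elim x)
    have "F x / F s = cis (\<theta> x - \<theta> s)"
      using f_eval[OF _ exc(4)[OF s]] f_eval[OF _ exc(4)[OF elim(1)]] s elim(1)
      by (simp add: F_def cis_divide)
    moreover have "\<bar>\<theta> x - \<theta> s\<bar> < pi" using elim(2) by (simp add: dist_real_def abs_minus_commute)
    ultimately show ?case by (simp add: Im_Ln_cis)
  qed
  with D show ?thesis by (rule has_vector_derivative_cong_nhds)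
qed

text \<open>Difference quotients of an increasing function are nonnegative. This identifies
  \<open>\<theta>'\<close> with its absolute value, which is what a change of variables
  produces.\<close>

lemma \<theta>'_nonneg:
  assumes s: "s \<in> {0..1} - exc"
  shows "\<theta>' s \<ge> 0"
proof -
  have s': "s \<in> {0<..<1}" using s regular_eq by auto
  have "(\<theta> has_real_derivative \<theta>' s) (at s within {0..1})"
    using \<theta>_deriv[OF s] by (simp add: has_real_derivative_iff_has_vector_derivative has_vector_derivative_at_within)
  hence "((\<lambda>x. (\<theta> x - \<theta> s) / (x - s)) \<longlongrightarrow> \<theta>' s) (at s within {0..1})"
    by (simp add: has_field_derivative_iff)
  moreover have "eventually (\<lambda>x. (\<theta> x - \<theta> s) / (x - s) \<ge> 0) (at s within {0..1})"
    unfolding eventually_at_filter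
  proof (intro always_eventually allI impI)
    fix x assume x: "x \<noteq> s" "x \<in> {0..1}"
    show "(\<theta> x - \<theta> s) / (x - s) \<ge> 0"
    proof (cases "x < s")
      case True
      thus ?thesis using strict_mono_onD[OF mono_\<theta>, of x s] x s by (auto intro!: divide_nonpos_neg)
    next
      case False
      thus ?thesis using strict_mono_onD[OF mono_\<theta>, of s x] x s by (auto intro!: divide_nonneg_pos)
    qed
  qed
  moreover have "at s within {0..1} \<noteq> bot" using s' by (simp add: trivial_limit_within islimpt_Icc)
  ultimately show ?thesis by (rule tendsto_lowerbound)
qed

lemma nonconst: "\<exists>t. ratfun_at fr t \<notin> {None, Some z}"
proof (rule ccontr)
  assume "\<not> ?thesis"
  hence *: "ratfun_at fr (\<gamma> s) \<in> {None, Some z}" for s by blast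
  have "{0..1} \<subseteq> {s\<in>{0..1}. cis (\<theta> s) = z}"
  proof
    fix s :: real assume s: "s \<in> {0..1}"
    have "Some (cis (\<theta> s)) \<in> {None, Some z}" using *[of s] unfolding f_\<gamma>[OF s] .
    thus "s \<in> {s\<in>{0..1}. cis (\<theta> s) = z}" using s by simp
  qed
  hence "finite {0..1::real}" using finite_cis_\<theta>[of z] finite_subset by blast
  thus False using infinite_Icc[of "0::real" 1] by simp
qed

text \<open>
  Where the path runs through infinity, \<open>f (t) = f (\<infinity>) + A t\<^sup>-\<^sup>k (1 + o (1))\<close> forces the real number
  \<open>\<theta> x - \<theta> s\<close> to be asymptotic to a constant multiple of \<open>h x\<^sup>-\<^sup>k\<close>, so that the argument of \<open>h x\<close>
  has a limit on either side.
\<close>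

lemma argument_at_infinity:
  assumes s: "s \<in> {0..1}" "\<gamma> s = None"
  obtains A k where "A \<noteq> 0" "k > 0"
    "((\<lambda>x. (h x - b) ^ k * of_real (\<theta> x - \<theta> s)) \<longlongrightarrow> A) (at s within {0..1})"
proof -
  define c where "c = cis (\<theta> s)"
  obtain k B where B: "B \<noteq> 0" "k > 0"
    "((\<lambda>z. (factored_eval c0 n a e z - c) * z ^ k) \<longlongrightarrow> B) at_infinity"
  proof -
    have "ratfun_at fr None = Some c" "c \<noteq> 0" using f_\<gamma>[OF s(1)] s(2) by (simp_all add: c_def)
    from ratfun_expansion_at_infinity[OF c0 this nonconst] that show ?thesis by blast
  qed
  let ?F = "at s within {0..1}"
  note hinf = filterlim_infinity[OF s]
  have lim1: "((\<lambda>x. (factored_eval c0 n a e (h x) - c) * h x ^ k) \<longlongrightarrow> B) ?F"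
    by (rule filterlim_compose[OF B(3) hinf])
  have ev: "eventually (\<lambda>x. x \<in> {0..1} \<and> x \<noteq> s \<and> x \<notin> exc) ?F"
    by (rule eventually_within_finite[OF exc(1)])
  have \<theta>_ne: "\<theta> x \<noteq> \<theta> s" if "x \<in> {0..1}" "x \<noteq> s" for x
    using inj_onD[OF inj_\<theta>, of x s] that s by auto
  \<comment> \<open>The difference quotient of exp (i z) at \<open>\<theta> s\<close> converts f -
    c, which the expansion at infinity controls, into the real difference
    \<open>\<theta> x - \<theta> s\<close>.\<close>
  have "((\<lambda>z. exp (\<i> * z)) has_field_derivative (\<i> * c)) (at (of_real (\<theta> s)))"
    by (auto intro!: derivative_eq_intros simp: c_def cis_conv_exp)
  hence "((\<lambda>z. (exp (\<i> * z) - exp (\<i> * of_real (\<theta> s))) / (z - of_real (\<theta> s))) \<longlongrightarrow> \<i> * c) (at (of_real (\<theta> s)))"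
    by (simp add: has_field_derivative_iff)
  moreover have "filterlim (\<lambda>x. complex_of_real (\<theta> x)) (at (of_real (\<theta> s))) ?F"
    unfolding filterlim_at
  proof
    show "eventually (\<lambda>x. of_real (\<theta> x) \<in> UNIV \<and> complex_of_real (\<theta> x) \<noteq> of_real (\<theta> s)) ?F"
      using ev by eventually_elim (use \<theta>_ne in auto)
    show "((\<lambda>x. complex_of_real (\<theta> x)) \<longlongrightarrow> of_real (\<theta> s)) ?F"
      using cont_\<theta> s by (intro tendsto_of_real) (simp add: continuous_on_def)
  qed
  ultimately have lim2: "((\<lambda>x. (exp (\<i> * of_real (\<theta> x)) - exp (\<i> * of_real (\<theta> s))) /
      (of_real (\<theta> x) - of_real (\<theta> s))) \<longlongrightarrow> \<i> * c) ?F"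
    by (rule filterlim_compose)
  have lim2_ne: "eventually (\<lambda>x. (exp (\<i> * of_real (\<theta> x)) - exp (\<i> * of_real (\<theta> s))) /
      (of_real (\<theta> x) - of_real (\<theta> s)) \<noteq> 0) ?F"
    using lim2 by (rule tendsto_imp_eventually_ne) (simp add: c_def)
  \<comment> \<open>The expansion is in powers of \<open>h x\<close>; as \<open>b / h x\<close>
    tends to 0, the limit is the same with powers of \<open>h x - b\<close>, which the winding about
    \<open>b\<close> calls for.\<close>
  have "((\<lambda>x. 1 - b / h x) \<longlongrightarrow> 1 - 0) ?F"
    by (intro tendsto_diff tendsto_const tendsto_divide_0[OF tendsto_const hinf])
  hence lim3: "((\<lambda>x. (1 - b / h x) ^ k) \<longlongrightarrow> (1 - 0) ^ k) ?F"
    by (rule tendsto_power)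
  have "c \<noteq> 0" by (simp add: c_def)
  hence "((\<lambda>x. (factored_eval c0 n a e (h x) - c) * h x ^ k /
      ((exp (\<i> * of_real (\<theta> x)) - exp (\<i> * of_real (\<theta> s))) / (of_real (\<theta> x) - of_real (\<theta> s))) *
      (1 - b / h x) ^ k) \<longlongrightarrow> B / (\<i> * c) * (1 - 0) ^ k) ?F"
    by (intro tendsto_mult tendsto_divide lim1 lim2 lim3) simp
  moreover have "eventually (\<lambda>x. cmod (h x) \<ge> 1) ?F"
    using hinf unfolding filterlim_at_infinity[OF order_refl] by simp
  with ev have "eventually (\<lambda>x. (factored_eval c0 n a e (h x) - c) * h x ^ k /
      ((exp (\<i> * of_real (\<theta> x)) - exp (\<i> * of_real (\<theta> s))) / (of_real (\<theta> x) - of_real (\<theta> s))) *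
      (1 - b / h x) ^ k = (h x - b) ^ k * of_real (\<theta> x - \<theta> s)) ?F"
    using lim2_ne
  proof eventually_elim
    case (elim x)
    have hx: "h x \<noteq> 0" using elim by auto
    have F: "factored_eval c0 n a e (h x) = cis (\<theta> x)"
      using f_eval[of x "h x"] exc(4)[of x] elim by auto
    have ne: "\<theta> x \<noteq> \<theta> s" using \<theta>_ne elim by auto
    have "cis (\<theta> x) \<noteq> c" using elim by (auto simp: c_def cis_conv_exp)
    have "(1 - b / h x) ^ k * h x ^ k = (h x - b) ^ k"
      using hx by (simp add: left_diff_distrib flip: power_mult_distrib)
    moreover have "u * v / (u / y) * w = (w * v) * y" if "u \<noteq> 0" for u v w y :: complex
      using that by simp
    ultimately show ?case using \<open>cis (\<theta> x) \<noteq> c\<close> unfolding F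
      by (simp add: c_def cis_conv_exp mult.commute[of "h x ^ k"])
  qed
  ultimately have "((\<lambda>x. (h x - b) ^ k * of_real (\<theta> x - \<theta> s)) \<longlongrightarrow> B / (\<i> * c) * (1 - 0) ^ k) ?F"
    by (rule Lim_transform_eventually)
  thus ?thesis using that[of "B / (\<i> * c) * (1 - 0) ^ k" k] B \<open>c \<noteq> 0\<close> by simp
qed

text \<open>Fundamental theorem for the Henstock-Kurzweil integral: at the one exceptional point
  \<open>x\<close> continuity of the primitive is enough, however badly the integrand behaves
  nearby.\<close>

lemma has_integral_subinterval:
  assumes x: "x \<in> {u..v}" "{u..v} \<subseteq> {0..1}" "exc \<inter> {u..v} \<subseteq> {x}"
    and A: "\<And>s. s \<in> {u..v} \<Longrightarrow> s \<noteq> x \<Longrightarrow> (A has_vector_derivative (A' s :: real)) (at s)"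
    and Ax: "(A \<longlongrightarrow> A x) (at x within {0..1})"
  shows "(A' has_integral (A v - A u)) {u..v}"
proof (rule fundamental_theorem_of_calculus_interior_strong[of "{x}"])
  show "continuous_on {u..v} A"
    unfolding continuous_on_eq_continuous_within
  proof
    fix s assume s: "s \<in> {u..v}"
    show "continuous (at s within {u..v}) A"
    proof (cases "s = x")
      case True
      have "(A \<longlongrightarrow> A x) (at x within {u..v})" by (rule tendsto_within_subset[OF Ax x(2)])
      thus ?thesis using True by (simp add: continuous_within)
    next
      case False
      from A[OF s this] have "isCont A s" by (rule has_vector_derivative_isCont)
      thus ?thesis by (rule continuous_at_imp_continuous_at_within)
    qed
  qed
qed (use x A in auto)

text \<open>Integrability is local, so a continuous primitive near each parameter suffices. At a
  finite point it is the argument of \<open>h - b\<close>, normalized to be 0 there. At a passage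
  through infinity it is the argument of \<open>(h - b) ^ k\<close> times the real factor
  \<open>\<theta> - \<theta> x\<close>, divided by \<open>k\<close>: the sign change of that factor
  compensates the half turn which the power makes at \<open>x\<close>.\<close>

lemma wind_integrable:
  assumes b: "\<And>s. s \<in> {0..1} \<Longrightarrow> \<gamma> s \<noteq> Some b"
  shows "(\<lambda>s. Im (h' s / (h s - b))) integrable_on {0..1}"
proof -
  let ?w = "\<lambda>s. Im (h' s / (h s - b))"
  have "?w integrable_on cbox 0 1"
  proof (rule integrable_on_little_subintervals, intro ballI)
    fix x :: real assume x: "x \<in> cbox 0 1"
    hence x01: "x \<in> {0..1}" by simp
    have local: "\<exists>d>0. \<forall>u v. x \<in> cbox u v \<and> cbox u v \<subseteq> ball x d \<and> cbox u v \<subseteq> cbox 0 1 \<longrightarrow> ?w integrable_on cbox u v"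
      if ev: "eventually (\<lambda>s. s \<notin> exc \<longrightarrow> (A has_vector_derivative ?w s) (at s)) (at x within {0..1})"
        and Ax: "(A \<longlongrightarrow> A x) (at x within {0..1})" for A
    proof -
      from ev eventually_within_finite[OF exc(1), of "{0..1}" x]
      have "eventually (\<lambda>s. s \<notin> exc \<and> (A has_vector_derivative ?w s) (at s)) (at x within {0..1})"
        by eventually_elim auto
      then obtain d where d: "d > 0" "\<And>s. s \<in> {0..1} \<Longrightarrow> s \<noteq> x \<Longrightarrow> dist s x < d \<Longrightarrow>
          s \<notin> exc \<and> (A has_vector_derivative ?w s) (at s)"
        unfolding eventually_at by blast
      show ?thesis
      proof (intro exI[of _ d] conjI allI impI)
        fix u v assume uv: "x \<in> cbox u v \<and> cbox u v \<subseteq> ball x d \<and> cbox u v \<subseteq> cbox 0 1"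
        have in_d: "s \<in> {0..1} \<and> dist s x < d" if "s \<in> {u..v}" for s
          using uv that by (auto simp: dist_commute subset_iff)
        have "(?w has_integral (A v - A u)) {u..v}"
        proof (rule has_integral_subinterval[OF _ _ _ _ Ax])
          show "exc \<inter> {u..v} \<subseteq> {x}" using in_d d(2) by blast
          show "(A has_vector_derivative ?w s) (at s)" if "s \<in> {u..v}" "s \<noteq> x" for s
            using in_d[OF that(1)] d(2) that(2) by blast
        qed (use uv in auto)
        thus "?w integrable_on cbox u v" by (auto simp: integrable_on_def)
      qed (use d in auto)
    qed
    have hb: "h s - b \<noteq> 0" if "s \<in> {0..1}" "s \<notin> exc" for s
      using b[of s] exc(4)[of s] that by auto
    have dh: "((\<lambda>x. h x - b) has_vector_derivative h' s) (at s)" if "s \<in> {0..1}" "s \<notin> exc" for s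
      using exc(5)[of s] that by (auto intro!: derivative_eq_intros)
    show "\<exists>d>0. \<forall>u v. x \<in> cbox u v \<and> cbox u v \<subseteq> ball x d \<and> cbox u v \<subseteq> cbox 0 1 \<longrightarrow> ?w integrable_on cbox u v"
    proof (cases "\<gamma> x")
      case (Some z)
      hence zb: "z - b \<noteq> 0" using b[OF x01] by auto
      define q where "q = (\<lambda>s. (h s - b) / (z - b))"
      have qlim: "(q \<longlongrightarrow> 1) (at x within {0..1})"
      proof -
        have "(q \<longlongrightarrow> (z - b) / (z - b)) (at x within {0..1})"
          unfolding q_def using zb by (intro tendsto_intros tendsto_finite[OF x01 Some])
        thus ?thesis using zb by simp
      qed
      show ?thesis
      proof (rule local[of "\<lambda>s. Im (Ln (q s))"])
        have "q x = 1" using Some zb by (simp add: q_def)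
        thus "((\<lambda>s. Im (Ln (q s))) \<longlongrightarrow> Im (Ln (q x))) (at x within {0..1})"
          using qlim by (intro tendsto_Im tendsto_Ln) auto
        have "eventually (\<lambda>s. q s \<in> ball 1 1) (at x within {0..1})"
          by (rule topological_tendstoD[OF qlim]) auto
        with eventually_within_finite[OF exc(1), of "{0..1}" x]
        show "eventually (\<lambda>s. s \<notin> exc \<longrightarrow> ((\<lambda>s. Im (Ln (q s))) has_vector_derivative ?w s) (at s)) (at x within {0..1})"
        proof eventually_elim
          case (elim s)
          show ?case
          proof
            assume "s \<notin> exc"
            have "q s \<notin> \<real>\<^sub>\<le>\<^sub>0" using elim(2) by (rule ball_1_not_nonpos)
            moreover have "(q has_vector_derivative (h' s / (z - b))) (at s)"
              unfolding q_def using dh elim by (intro has_vector_derivative_divide) auto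
            ultimately have "((\<lambda>s. Im (Ln (q s))) has_vector_derivative Im ((h' s / (z - b)) / q s)) (at s)"
              by (intro has_vector_derivative_Im has_vector_derivative_Ln)
            thus "((\<lambda>s. Im (Ln (q s))) has_vector_derivative ?w s) (at s)"
              using zb by (simp add: q_def)
          qed
        qed
      qed
    next
      case None
      obtain A k where A: "A \<noteq> 0" "k > 0"
        "((\<lambda>y. (h y - b) ^ k * of_real (\<theta> y - \<theta> x)) \<longlongrightarrow> A) (at x within {0..1})"
        using argument_at_infinity[OF x01 None, of b] by blast
      define q0 where "q0 = (\<lambda>y. (h y - b) ^ k * of_real (\<theta> y - \<theta> x) / A)"
      \<comment> \<open>\<open>q0\<close> is 0 at \<open>x\<close> itself because of its real
        factor; the value 1 makes it continuous there.\<close>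
      define q where "q = (\<lambda>y. if y = x then 1 else q0 y)"
      have qlim: "(q \<longlongrightarrow> 1) (at x within {0..1})"
      proof -
        have "(q0 \<longlongrightarrow> A / A) (at x within {0..1})"
          unfolding q0_def using A by (intro tendsto_divide A(3) tendsto_const)
        hence "(q0 \<longlongrightarrow> 1) (at x within {0..1})" using A by simp
        thus ?thesis
          by (rule Lim_transform_eventually) (simp add: q_def eventually_at_filter)
      qed
      show ?thesis
      proof (rule local[of "\<lambda>s. Im (Ln (q s)) / of_nat k"])
        have "((\<lambda>s. Im (Ln (q s)) / of_nat k) \<longlongrightarrow> Im (Ln 1) / of_nat k) (at x within {0..1})"
          using qlim A(2) by (intro tendsto_divide tendsto_Im tendsto_Ln tendsto_const) auto
        moreover have "q x = 1" by (simp add: q_def)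
        ultimately show "((\<lambda>s. Im (Ln (q s)) / of_nat k) \<longlongrightarrow> Im (Ln (q x)) / of_nat k) (at x within {0..1})"
          by simp
        have "eventually (\<lambda>s. q s \<in> ball 1 1) (at x within {0..1})"
          by (rule topological_tendstoD[OF qlim]) auto
        with eventually_within_finite[OF exc(1), of "{0..1}" x]
        show "eventually (\<lambda>s. s \<notin> exc \<longrightarrow> ((\<lambda>s. Im (Ln (q s)) / of_nat k) has_vector_derivative ?w s) (at s)) (at x within {0..1})"
        proof eventually_elim
          case (elim s)
          show ?case
          proof
            assume "s \<notin> exc"
            have th: "\<theta> s \<noteq> \<theta> x" using inj_onD[OF inj_\<theta>, of s x] elim x01 by auto
            have hs: "h s - b \<noteq> 0" using hb elim by auto
            have "q s \<notin> \<real>\<^sub>\<le>\<^sub>0" using elim(2) by (rule ball_1_not_nonpos)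
            define d where "d = (of_nat k * (h s - b) ^ (k - 1) * h' s * of_real (\<theta> s - \<theta> x) +
                (h s - b) ^ k * of_real (\<theta>' s)) / A"
            have "((\<lambda>y. (h y - b) ^ k) has_vector_derivative (h' s * (of_nat k * (h s - b) ^ (k - 1)))) (at s)"
            proof -
              have "((\<lambda>z::complex. z ^ k) has_field_derivative (of_nat k * z ^ (k - 1))) (at z)" for z
                by (auto intro!: derivative_eq_intros)
              from field_vector_diff_chain_at[OF dh this] elim show ?thesis by (simp add: o_def)
            qed
            moreover have "((\<lambda>y. complex_of_real (\<theta> y - \<theta> x)) has_vector_derivative of_real (\<theta>' s)) (at s)"
              using \<theta>_deriv[of s] elim
              by (auto intro!: derivative_eq_intros has_vector_derivative_of_real
                  simp: has_real_derivative_iff_has_vector_derivative)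
            ultimately have "(q0 has_vector_derivative d) (at s)"
              unfolding q0_def d_def
              by (intro has_vector_derivative_divide has_vector_derivative_eq_rhs[OF has_vector_derivative_mult])
                 (auto simp: mult_ac)
            moreover have "eventually (\<lambda>y. q0 y = q y) (nhds s)"
            proof -
              have "eventually (\<lambda>y. y \<noteq> x) (nhds s)" using elim by (intro t1_space_nhds) auto
              thus ?thesis by eventually_elim (simp add: q_def)
            qed
            ultimately have "(q has_vector_derivative d) (at s)"
              by (rule has_vector_derivative_cong_nhds)
            hence "((\<lambda>s. Im (Ln (q s)) / of_nat k) has_vector_derivative Im (d / q s) / of_nat k) (at s)"
              using \<open>q s \<notin> \<real>\<^sub>\<le>\<^sub>0\<close>
              by (intro has_vector_derivative_divide has_vector_derivative_Im has_vector_derivative_Ln)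
            moreover have "Im (d / q s) / of_nat k = ?w s"
            proof -
              \<comment> \<open>The second summand is real, hence invisible in the imaginary part:
                the factor \<open>\<theta> s - \<theta> x\<close> does not disturb the winding
                integrand.\<close>
              have "d / q s = of_nat k * (h' s / (h s - b)) + of_real (\<theta>' s / (\<theta> s - \<theta> x))"
              proof -
                obtain j where k: "k = Suc j" using A(2) by (cases k) auto
                define P H t v where defs: "P = (h s - b) ^ j" "H = h s - b"
                  "t = complex_of_real (\<theta> s - \<theta> x)" "v = complex_of_real (\<theta>' s)"
                have nz: "P \<noteq> 0" "H \<noteq> 0" "t \<noteq> 0" using th hs by (auto simp: defs)
                have 1: "d = (of_nat k * P * h' s * t + H * P * v) / A"
                  unfolding d_def defs k by simp
                have 2: "q s = H * P * t / A"
                  using elim unfolding q_def q0_def defs k by simp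
                have 3: "of_real (\<theta>' s / (\<theta> s - \<theta> x)) = v / t"
                  unfolding defs by simp
                show ?thesis unfolding 1 2 3 log_deriv_quotient[OF A(1) nz] unfolding defs ..
              qed
              hence "d / q s = real k *\<^sub>R (h' s / (h s - b)) + of_real (\<theta>' s / (\<theta> s - \<theta> x))"
                by (simp only: scaleR_conv_of_real of_real_of_nat_eq)
              hence "Im (d / q s) = real k * ?w s"
                by (simp only: plus_complex.sel scaleR_complex.sel Im_complex_of_real add_0_right)
              thus ?thesis using A(2) by simp
            qed
            ultimately show "((\<lambda>s. Im (Ln (q s)) / of_nat k) has_vector_derivative ?w s) (at s)"
              by simp
          qed
        qed
      qed
    qed
  qed
  thus ?thesis by simp
qed

end

section \<open>The integral along a path\<close>

text \<open>To be read at one parameter: \<open>LA\<close>, \<open>LB\<close> are the logarithms of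
  |t - \<alpha>| and |t - \<beta>|, \<open>WA\<close>, \<open>WB\<close> the derivatives of the
  corresponding arguments, \<open>c r s\<close> is log |\<beta> - \<alpha>|, and \<open>g0\<close>,
  \<open>f0\<close> are the logarithms of the moduli of the constant factors. The right side is log
  |g| d arg f - log |f| d arg g. The \<open>c r s\<close> of the dilogarithm terms cancel against
  those of the tilde terms, and a pair with \<alpha> = \<beta> contributes 0 to the right side by
  antisymmetry.\<close>

lemma bracket_algebra:
  fixes LA WA LB WB :: "nat \<Rightarrow> real" and l m :: "nat \<Rightarrow> int" and c :: "nat \<Rightarrow> nat \<Rightarrow> real"
    and \<alpha> \<beta> :: "nat \<Rightarrow> complex"
  assumes cross: "\<And>r s. r < R \<Longrightarrow> s < S \<Longrightarrow> \<alpha> r = \<beta> s \<Longrightarrow> LA r = LB s \<and> WA r = WB s"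
  shows "(\<Sum>(r, s)\<in>{(r, s). r < R \<and> s < S \<and> \<alpha> r \<noteq> \<beta> s}.
       of_int (l r * m s) * ((LB s - c r s) * WA r - (LA r - c r s) * WB s))
     + (\<Sum>r<R. of_int (l r) * (g0 + (\<Sum>s\<in>{s. s < S \<and> \<beta> s \<noteq> \<alpha> r}. of_int (m s) * c r s)) * WA r)
     - (\<Sum>s<S. of_int (m s) * (f0 + (\<Sum>r\<in>{r. r < R \<and> \<alpha> r \<noteq> \<beta> s}. of_int (l r) * c r s)) * WB s)
   = (g0 + (\<Sum>s<S. of_int (m s) * LB s)) * (\<Sum>r<R. of_int (l r) * WA r)
     - (f0 + (\<Sum>r<R. of_int (l r) * LA r)) * (\<Sum>s<S. of_int (m s) * WB s)"
    (is "?A + ?B - ?C = ?D - ?E")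
proof -
  \<comment> \<open>An indicator factor extends every restricted sum to the full rectangle of index
    pairs, so that the identity can be checked term by term.\<close>
  define d where "d = (\<lambda>r s. if \<alpha> r \<noteq> \<beta> s then 1 else 0 :: real)"
  define x where "x = (\<lambda>r. real_of_int (l r))"
  define y where "y = (\<lambda>s. real_of_int (m s))"
  have "?A = (\<Sum>(r, s)\<in>{..<R} \<times> {..<S}. d r s * (x r * y s * ((LB s - c r s) * WA r - (LA r - c r s) * WB s)))"
    by (rule sum.mono_neutral_cong_left) (auto simp: d_def x_def y_def)
  hence A: "?A = (\<Sum>r<R. \<Sum>s<S. d r s * (x r * y s * ((LB s - c r s) * WA r - (LA r - c r s) * WB s)))"
    by (simp add: sum.cartesian_product)
  have B1: "(\<Sum>s\<in>{s. s < S \<and> \<beta> s \<noteq> \<alpha> r}. of_int (m s) * c r s) = (\<Sum>s<S. d r s * (y s * c r s))" for r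
    by (rule sum.mono_neutral_cong_left) (auto simp: d_def y_def)
  have B: "?B = (\<Sum>r<R. \<Sum>s<S. d r s * (x r * y s * c r s * WA r)) + g0 * (\<Sum>r<R. x r * WA r)"
    unfolding B1
    by (simp add: x_def sum_distrib_left sum_distrib_right sum.distrib algebra_simps)
  have C1: "(\<Sum>r\<in>{r. r < R \<and> \<alpha> r \<noteq> \<beta> s}. of_int (l r) * c r s) = (\<Sum>r<R. d r s * (x r * c r s))" for s
    by (rule sum.mono_neutral_cong_left) (auto simp: d_def x_def)
  have "?C = (\<Sum>s<S. \<Sum>r<R. d r s * (x r * y s * c r s * WB s)) + f0 * (\<Sum>s<S. y s * WB s)"
    unfolding C1
    by (simp add: y_def sum_distrib_left sum_distrib_right sum.distrib algebra_simps)
  hence C: "?C = (\<Sum>r<R. \<Sum>s<S. d r s * (x r * y s * c r s * WB s)) + f0 * (\<Sum>s<S. y s * WB s)"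
    by (subst sum.swap)
  have "(\<Sum>s<S. y s * LB s) * (\<Sum>r<R. x r * WA r) = (\<Sum>s<S. \<Sum>r<R. y s * LB s * (x r * WA r))"
    by (rule sum_product)
  also have "\<dots> = (\<Sum>r<R. \<Sum>s<S. y s * LB s * (x r * WA r))" by (rule sum.swap)
  also have "\<dots> = (\<Sum>r<R. \<Sum>s<S. x r * y s * LB s * WA r)" by (simp add: mult_ac)
  finally have D: "?D = (\<Sum>r<R. \<Sum>s<S. x r * y s * LB s * WA r) + g0 * (\<Sum>r<R. x r * WA r)"
    by (simp add: x_def y_def distrib_right)
  have "(\<Sum>r<R. x r * LA r) * (\<Sum>s<S. y s * WB s) = (\<Sum>r<R. \<Sum>s<S. x r * LA r * (y s * WB s))"
    by (rule sum_product)
  also have "\<dots> = (\<Sum>r<R. \<Sum>s<S. x r * y s * LA r * WB s)" by (simp add: mult_ac)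
  finally have E: "?E = (\<Sum>r<R. \<Sum>s<S. x r * y s * LA r * WB s) + f0 * (\<Sum>s<S. y s * WB s)"
    by (simp add: x_def y_def distrib_right)
  have pt: "d r s * (x r * y s * ((LB s - c r s) * WA r - (LA r - c r s) * WB s)) +
      d r s * (x r * y s * c r s * WA r) - d r s * (x r * y s * c r s * WB s) =
      x r * y s * LB s * WA r - x r * y s * LA r * WB s" if "r < R" "s < S" for r s
    using cross[OF that] by (cases "\<alpha> r = \<beta> s") (auto simp: d_def algebra_simps)
  have "(\<Sum>r<R. \<Sum>s<S. d r s * (x r * y s * ((LB s - c r s) * WA r - (LA r - c r s) * WB s)) +
      d r s * (x r * y s * c r s * WA r) - d r s * (x r * y s * c r s * WB s)) =
     (\<Sum>r<R. \<Sum>s<S. x r * y s * LB s * WA r - x r * y s * LA r * WB s)"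
    using pt by (intro sum.cong refl) auto
  thus ?thesis unfolding A B C D E by (simp add: sum.distrib sum_subtractf)
qed

section \<open>Integrating log |g| d arg f along one path\<close>

locale locus_path = unit_path lam1 R \<alpha> l \<gamma> \<theta>
  for lam1 :: complex and R :: nat and \<alpha> :: "nat \<Rightarrow> complex" and l :: "nat \<Rightarrow> int"
    and \<gamma> :: "real \<Rightarrow> complex option" and \<theta> :: "real \<Rightarrow> real" +
  fixes lam2 :: complex and S :: nat and \<beta> :: "nat \<Rightarrow> complex" and m :: "nat \<Rightarrow> int"
  assumes lam2: "lam2 \<noteq> 0"
    and locus: "\<gamma> ` {0..1} \<subseteq> unit_locus fr (factored_fract lam2 S \<beta> m)"
begin

abbreviation "gr \<equiv> factored_fract lam2 S \<beta> m"

text \<open>Passages through the points \<open>\<beta> j\<close> are added: there log |g| and the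
  winding integrand about \<open>\<beta> j\<close> are singular.\<close>

definition exc2 where "exc2 = exc \<union> (\<Union>j<S. {s\<in>{0..1}. \<gamma> s = Some (\<beta> j)})"

lemma finite_exc2: "finite exc2"
  unfolding exc2_def using exc(1) finite_preimage by auto

lemma exc2_exc: "s \<in> {0..1} - exc2 \<Longrightarrow> s \<in> {0..1} - exc"
  by (simp add: exc2_def)

lemma exc2_beta:
  assumes s: "s \<in> {0..1} - exc2" and j: "j < S"
  shows "h s \<noteq> \<beta> j"
proof
  assume "h s = \<beta> j"
  hence "\<gamma> s = Some (\<beta> j)" using exc(4)[OF exc2_exc[OF s]] by simp
  thus False using s j by (auto simp: exc2_def)
qed

lemma exc2_alpha:
  assumes s: "s \<in> {0..1} - exc2" and k: "k < R"
  shows "h s \<noteq> \<alpha> k"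
  using avoids_a[of s k] exc(4)[OF exc2_exc[OF s]] s k by auto

lemma g_eval:
  assumes s: "s \<in> {0..1} - exc2"
  shows "ratfun_at gr (\<gamma> s) = Some (factored_eval lam2 S \<beta> m (h s))"
    and "1 \<le> cmod (factored_eval lam2 S \<beta> m (h s))"
proof -
  have \<gamma>: "\<gamma> s = Some (h s)" using exc(4)[OF exc2_exc[OF s]] .
  show *: "ratfun_at gr (\<gamma> s) = Some (factored_eval lam2 S \<beta> m (h s))"
    using ratfun_at_factored[OF lam2, of S "h s" \<beta> m] exc2_beta[OF s] \<gamma> by metis
  have "\<gamma> s \<in> unit_locus fr gr" using locus s by blast
  thus "1 \<le> cmod (factored_eval lam2 S \<beta> m (h s))"
    using * by (simp add: unit_locus_def)
qed

text \<open>A passage through \<open>b\<close> or through infinity puts the argument of the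
  dilogarithm at 1 or at infinity, where it is still continuous. This is what admits such passages
  in the fundamental theorem.\<close>

lemma continuous_dilog:
  assumes ab: "b \<noteq> a"
  shows "continuous_on {0..1} (\<lambda>s. bloch_wigner (map_option (\<lambda>t. (t - a) / (b - a)) (\<gamma> s)))"
  unfolding continuous_on_def
proof
  fix s :: real assume s: "s \<in> {0..1}"
  let ?F = "at s within {0..1}"
  have ev: "eventually (\<lambda>x. bloch_wigner (Some ((h x - a) / (b - a))) =
      bloch_wigner (map_option (\<lambda>t. (t - a) / (b - a)) (\<gamma> x))) ?F"
    using eventually_within_finite[OF exc(1), of "{0..1}" s]
  proof eventually_elim
    case (elim x)
    hence "\<gamma> x = Some (h x)" using exc(4)[of x] by simp
    thus ?case by (metis option.simps(9))
  qed
  show "((\<lambda>s. bloch_wigner (map_option (\<lambda>t. (t - a) / (b - a)) (\<gamma> s))) \<longlongrightarrow>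
      bloch_wigner (map_option (\<lambda>t. (t - a) / (b - a)) (\<gamma> s))) ?F"
  proof (cases "\<gamma> s")
    case (Some z)
    have "((\<lambda>x. (h x - a) / (b - a)) \<longlongrightarrow> (z - a) / (b - a)) ?F"
      using ab by (intro tendsto_intros tendsto_finite[OF s Some]) auto
    hence "((\<lambda>x. bloch_wigner (Some ((h x - a) / (b - a)))) \<longlongrightarrow> bloch_wigner (Some ((z - a) / (b - a)))) ?F"
      by (rule isCont_tendsto_compose[OF isCont_bloch_wigner])
    thus ?thesis using Some Lim_transform_eventually[OF _ ev] by simp
  next
    case None
    have "filterlim (\<lambda>x. inverse (b - a) * (- a + h x)) at_infinity ?F"
      using ab by (intro tendsto_mult_filterlim_at_infinity[OF tendsto_const]
          tendsto_add_filterlim_at_infinity[OF tendsto_const] filterlim_infinity[OF s None]) auto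
    hence "filterlim (\<lambda>x. (h x - a) / (b - a)) at_infinity ?F"
      by (simp add: divide_inverse mult_ac)
    hence "((\<lambda>x. bloch_wigner (Some ((h x - a) / (b - a)))) \<longlongrightarrow> 0) ?F"
      by (rule filterlim_compose[OF bloch_wigner_at_infinity])
    thus ?thesis using None Lim_transform_eventually[OF _ ev] by (simp add: bloch_wigner_def)
  qed
qed

text \<open>For \<open>c = (h - a) / (b - a)\<close> one has
  \<open>c - 1 = (h - b) / (b - a)\<close>. The denominator \<open>b - a\<close> drops out of the
  logarithmic derivatives but stays in the moduli, whence the constants
  \<open>ln (cmod (b - a))\<close>.\<close>

lemma deriv_dilog:
  assumes ab: "b \<noteq> a" and s: "s \<in> {0..1} - exc2" and ha: "h s \<noteq> a" "h s \<noteq> b"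
  shows "((\<lambda>s. bloch_wigner (map_option (\<lambda>t. (t - a) / (b - a)) (\<gamma> s))) has_vector_derivative
     ((ln (cmod (h s - a)) - ln (cmod (b - a))) * Im (h' s / (h s - b)) -
      (ln (cmod (h s - b)) - ln (cmod (b - a))) * Im (h' s / (h s - a)))) (at s)"
proof -
  define c where "c = (\<lambda>x. (h x - a) / (b - a))"
  have ba: "b - a \<noteq> 0" using ab by simp
  have dc: "(c has_vector_derivative (h' s / (b - a))) (at s)"
    unfolding c_def using exc(5)[OF exc2_exc[OF s]]
    by (intro has_vector_derivative_divide) (auto intro!: derivative_eq_intros)
  have c1: "c s - 1 = (h s - b) / (b - a)"
  proof -
    have "c s - 1 = (h s - a) / (b - a) - (b - a) / (b - a)" using ba by (simp add: c_def)
    also have "\<dots> = ((h s - a) - (b - a)) / (b - a)" by (rule diff_divide_distrib[symmetric])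
    finally show ?thesis by simp
  qed
  have c2: "cmod (1 - c s) = cmod (h s - b) / cmod (b - a)"
    using c1 by (metis norm_divide norm_minus_commute)
  have "c s \<noteq> 0" "c s \<noteq> 1" using ha ba c1 by (auto simp: c_def)
  from bloch_wigner_deriv[OF dc this]
  have "((\<lambda>x. bloch_wigner (Some (c x))) has_vector_derivative
     (ln (cmod (c s)) * Im ((h' s / (b - a)) / (c s - 1)) - ln (cmod (1 - c s)) * Im ((h' s / (b - a)) / c s))) (at s)" .
  moreover have "(h' s / (b - a)) / (c s - 1) = h' s / (h s - b)" unfolding c1 using ba by simp
  moreover have "(h' s / (b - a)) / c s = h' s / (h s - a)" unfolding c_def using ba by simp
  moreover have "ln (cmod (c s)) = ln (cmod (h s - a)) - ln (cmod (b - a))"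
    unfolding c_def using ba ha by (simp add: norm_divide ln_div)
  moreover have "ln (cmod (1 - c s)) = ln (cmod (h s - b)) - ln (cmod (b - a))"
    unfolding c2 using ba ha by (simp add: ln_div)
  ultimately have D: "((\<lambda>x. bloch_wigner (Some (c x))) has_vector_derivative
     ((ln (cmod (h s - a)) - ln (cmod (b - a))) * Im (h' s / (h s - b)) -
      (ln (cmod (h s - b)) - ln (cmod (b - a))) * Im (h' s / (h s - a)))) (at s)" by (simp only:)
  have "eventually (\<lambda>x. bloch_wigner (Some (c x)) = bloch_wigner (map_option (\<lambda>t. (t - a) / (b - a)) (\<gamma> x))) (nhds s)"
    using eventually_regular[OF exc2_exc[OF s]]
  proof eventually_elim
    case (elim x)
    show ?case unfolding c_def using exc(4)[OF elim] by (metis option.simps(9))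
  qed
  with D show ?thesis by (rule has_vector_derivative_cong_nhds)
qed

definition bracket :: real where
  "bracket = (\<Sum>(r, s)\<in>{(r, s). r < R \<and> s < S \<and> \<alpha> r \<noteq> \<beta> s}.
          of_int (l r * m s) *
          (bloch_wigner (map_option (\<lambda>t. (t - \<alpha> r) / (\<beta> s - \<alpha> r)) (\<gamma> 0)) -
           bloch_wigner (map_option (\<lambda>t. (t - \<alpha> r) / (\<beta> s - \<alpha> r)) (\<gamma> 1))))
       + (\<Sum>r<R. of_int (l r) * ln (cmod (tilde_at lam2 S \<beta> m (\<alpha> r))) * wind \<gamma> (\<alpha> r))
       - (\<Sum>s<S. of_int (m s) * ln (cmod (tilde_at lam1 R \<alpha> l (\<beta> s))) * wind \<gamma> (\<beta> s))"

lemma wind_has_integral: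
  assumes "\<And>s. s \<in> {0..1} \<Longrightarrow> \<gamma> s \<noteq> Some b"
  shows "((\<lambda>s. Im (h' s / (h s - b))) has_integral wind \<gamma> b) {0..1}"
  using wind_integrable[OF assms] unfolding wind_def by (rule integrable_integral)

text \<open>The dilogarithm sum is a continuous primitive of its share, and the winding terms are
  integrals by definition. Off \<open>exc2\<close> the integrands add up, by
  \<open>bracket_algebra\<close>, to log |g| d arg f - log |f| d arg g, whose second term vanishes
  because |f| = 1 on the path.\<close>

lemma bracket_has_integral:
  "((\<lambda>s. ln (cmod (factored_eval lam2 S \<beta> m (h s))) * \<theta>' s) has_integral bracket) {0..1}"
proof -
  let ?P = "{(r, s). r < R \<and> s < S \<and> \<alpha> r \<noteq> \<beta> s}"
  define bw where "bw = (\<lambda>r s x. bloch_wigner (map_option (\<lambda>t. (t - \<alpha> r) / (\<beta> s - \<alpha> r)) (\<gamma> x)))"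
  \<comment> \<open>Negated, since the formula takes the value at the initial point minus the one at
    the terminal point.\<close>
  define W where "W = (\<lambda>x. - (\<Sum>(r, s)\<in>?P. of_int (l r * m s) * bw r s x))"
  define wA where "wA = (\<lambda>r x. Im (h' x / (h x - \<alpha> r)))"
  define wB where "wB = (\<lambda>s x. Im (h' x / (h x - \<beta> s)))"
  define LA where "LA = (\<lambda>r x. ln (cmod (h x - \<alpha> r)))"
  define LB where "LB = (\<lambda>s x. ln (cmod (h x - \<beta> s)))"
  define c where "c = (\<lambda>r s. ln (cmod (\<beta> s - \<alpha> r)))"
  define gt where "gt = (\<lambda>r. ln (cmod (tilde_at lam2 S \<beta> m (\<alpha> r))))"
  define ft where "ft = (\<lambda>s. ln (cmod (tilde_at lam1 R \<alpha> l (\<beta> s))))"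
  define W' where "W' = (\<lambda>x. \<Sum>(r, s)\<in>?P. of_int (l r * m s) * ((LB s x - c r s) * wA r x - (LA r x - c r s) * wB s x))"
  have finP: "finite ?P" by (rule finite_subset[of _ "{..<R} \<times> {..<S}"]) auto
  have "(W' has_integral W 1 - W 0) {0..1}"
  proof (rule fundamental_theorem_of_calculus_interior_strong[OF finite_exc2])
    show "continuous_on {0..1} W"
      unfolding W_def bw_def
      by (intro continuous_on_minus continuous_on_sum) (auto intro!: continuous_intros continuous_dilog)
    fix x assume "x \<in> {0<..<1} - exc2"
    hence x: "x \<in> {0..1} - exc2" by auto
    have "((\<lambda>x. \<Sum>p\<in>?P. (case p of (r, s) \<Rightarrow> of_int (l r * m s) * bw r s x)) has_vector_derivative
       (\<Sum>p\<in>?P. (case p of (r, s) \<Rightarrow> of_int (l r * m s) * ((LA r x - c r s) * wB s x - (LB s x - c r s) * wA r x)))) (at x)"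
    proof (rule has_vector_derivative_sum)
      fix p assume p: "p \<in> ?P"
      obtain r s where rs: "p = (r, s)" "r < R" "s < S" "\<alpha> r \<noteq> \<beta> s" using p by auto
      have "(bw r s has_vector_derivative ((LA r x - c r s) * wB s x - (LB s x - c r s) * wA r x)) (at x)"
        unfolding bw_def LA_def LB_def c_def wA_def wB_def
        using rs exc2_alpha[OF x] exc2_beta[OF x] by (intro deriv_dilog x) auto
      thus "((\<lambda>x. (case p of (r, s) \<Rightarrow> of_int (l r * m s) * bw r s x)) has_vector_derivative
        (case p of (r, s) \<Rightarrow> of_int (l r * m s) * ((LA r x - c r s) * wB s x - (LB s x - c r s) * wA r x))) (at x)"
        unfolding rs prod.case by (intro has_vector_derivative_mult_right)
    qed
    hence "(W has_vector_derivative - (\<Sum>p\<in>?P. (case p of (r, s) \<Rightarrow> of_int (l r * m s) * ((LA r x - c r s) * wB s x - (LB s x - c r s) * wA r x)))) (at x)"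
      unfolding W_def by (rule has_vector_derivative_minus)
    moreover have "- (\<Sum>p\<in>?P. (case p of (r, s) \<Rightarrow> of_int (l r * m s) * ((LA r x - c r s) * wB s x - (LB s x - c r s) * wA r x))) = W' x"
      unfolding W'_def sum_negf[symmetric] by (intro sum.cong refl) (auto simp: algebra_simps)
    ultimately show "(W has_vector_derivative W' x) (at x)" by simp
  qed auto
  moreover have "((\<lambda>x. of_int (l r) * gt r * wA r x) has_integral of_int (l r) * gt r * wind \<gamma> (\<alpha> r)) {0..1}"
    if "r < R" for r
    unfolding wA_def using avoids_a that by (intro has_integral_mult_right wind_has_integral) auto
  hence "((\<lambda>x. \<Sum>r<R. of_int (l r) * gt r * wA r x) has_integral (\<Sum>r<R. of_int (l r) * gt r * wind \<gamma> (\<alpha> r))) {0..1}"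
    by (intro has_integral_sum) auto
  moreover have "((\<lambda>x. of_int (m s) * ft s * wB s x) has_integral of_int (m s) * ft s * wind \<gamma> (\<beta> s)) {0..1}"
    if s: "s < S" for s
  proof (cases "\<exists>x\<in>{0..1}. \<gamma> x = Some (\<beta> s)")
    case False
    thus ?thesis unfolding wB_def by (intro has_integral_mult_right wind_has_integral) auto
  next
    case True
    then obtain x where x: "x \<in> {0..1}" "\<gamma> x = Some (\<beta> s)" by blast
    \<comment> \<open>Here \<open>\<beta> s\<close> lies on the path, so it is none of the
      \<open>\<alpha> k\<close> and its tilde value is the value of \<open>f\<close>, of modulus 1.
      The coefficient is 0, and the winding integrand about \<open>\<beta> s\<close>, singular on
      the path, drops out.\<close>
    have "\<alpha> k \<noteq> \<beta> s" if "k < R" for k using avoids_a[OF x(1) that] x(2) by auto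
    hence "{k. k < R \<and> \<alpha> k \<noteq> \<beta> s} = {..<R}" by auto
    hence "tilde_at lam1 R \<alpha> l (\<beta> s) = factored_eval lam1 R \<alpha> l (\<beta> s)"
      by (simp add: tilde_at_def factored_eval_def)
    also have "\<dots> = cis (\<theta> x)" by (rule f_eval[OF x])
    finally have "ft s = 0" by (simp add: ft_def)
    thus ?thesis by simp
  qed
  hence "((\<lambda>x. \<Sum>s<S. of_int (m s) * ft s * wB s x) has_integral (\<Sum>s<S. of_int (m s) * ft s * wind \<gamma> (\<beta> s))) {0..1}"
    by (intro has_integral_sum) auto
  ultimately have "((\<lambda>x. W' x + (\<Sum>r<R. of_int (l r) * gt r * wA r x) - (\<Sum>s<S. of_int (m s) * ft s * wB s x)) has_integral
     (W 1 - W 0 + (\<Sum>r<R. of_int (l r) * gt r * wind \<gamma> (\<alpha> r)) - (\<Sum>s<S. of_int (m s) * ft s * wind \<gamma> (\<beta> s)))) {0..1}"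
    by (intro has_integral_add has_integral_diff)
  moreover have "W 1 - W 0 = (\<Sum>(r, s)\<in>?P. of_int (l r * m s) * (bw r s 0 - bw r s 1))"
    unfolding W_def by (simp add: sum_subtractf[symmetric] case_prod_unfold algebra_simps del: of_int_mult)
  ultimately have I: "((\<lambda>x. W' x + (\<Sum>r<R. of_int (l r) * gt r * wA r x) - (\<Sum>s<S. of_int (m s) * ft s * wB s x)) has_integral bracket) {0..1}"
    unfolding bracket_def bw_def gt_def ft_def by simp
  show ?thesis
  proof (rule has_integral_spike_finite[OF finite_exc2 _ I])
    fix x assume x: "x \<in> {0..1} - exc2"
    have gt: "gt r = ln (cmod lam2) + (\<Sum>s\<in>{s. s < S \<and> \<beta> s \<noteq> \<alpha> r}. of_int (m s) * c r s)" for r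
      unfolding gt_def tilde_at_def c_def using lam2
      by (subst ln_cmod_prod_power_int) (auto simp: norm_minus_commute)
    have ft: "ft s = ln (cmod lam1) + (\<Sum>r\<in>{r. r < R \<and> \<alpha> r \<noteq> \<beta> s}. of_int (l r) * c r s)" for s
      unfolding ft_def tilde_at_def c_def using c0
      by (subst ln_cmod_prod_power_int) auto
    have g: "ln (cmod (factored_eval lam2 S \<beta> m (h x))) = ln (cmod lam2) + (\<Sum>s<S. of_int (m s) * LB s x)"
      unfolding factored_eval_def LB_def using lam2 exc2_beta[OF x]
      by (subst ln_cmod_prod_power_int) auto
    have "ln (cmod lam1) + (\<Sum>r<R. of_int (l r) * LA r x) = ln (cmod (factored_eval lam1 R \<alpha> l (h x)))"
      unfolding factored_eval_def LA_def using c0 exc2_alpha[OF x]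
      by (subst ln_cmod_prod_power_int) auto
    also have "factored_eval lam1 R \<alpha> l (h x) = cis (\<theta> x)"
      using f_eval[of x "h x"] exc(4)[OF exc2_exc[OF x]] x by auto
    finally have f: "ln (cmod lam1) + (\<Sum>r<R. of_int (l r) * LA r x) = 0" by simp
    have "W' x + (\<Sum>r<R. of_int (l r) * gt r * wA r x) - (\<Sum>s<S. of_int (m s) * ft s * wB s x) =
       (ln (cmod lam2) + (\<Sum>s<S. of_int (m s) * LB s x)) * (\<Sum>r<R. of_int (l r) * wA r x)
     - (ln (cmod lam1) + (\<Sum>r<R. of_int (l r) * LA r x)) * (\<Sum>s<S. of_int (m s) * wB s x)"
      unfolding W'_def gt ft
      by (rule bracket_algebra) (simp add: LA_def LB_def wA_def wB_def)
    thus "ln (cmod (factored_eval lam2 S \<beta> m (h x))) * \<theta>' x =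
      W' x + (\<Sum>r<R. of_int (l r) * gt r * wA r x) - (\<Sum>s<S. of_int (m s) * ft s * wB s x)"
      unfolding f by (simp add: g \<theta>'_def wA_def)
  qed
qed

end

section \<open>From the path parameter to the angle of x\<close>

lemma has_integral_shift_real:
  fixes f :: "real \<Rightarrow> real"
  assumes "(f has_integral i) {a + c..b + c}"
  shows "((\<lambda>x. f (x + c)) has_integral i) {a..b}"
proof -
  have "((\<lambda>x. f (1 *\<^sub>R x + c)) has_integral (1 / \<bar>1\<bar> ^ DIM(real)) *\<^sub>R i)
     ((\<lambda>x. (1 / 1) *\<^sub>R x + - ((1 / 1) *\<^sub>R c)) ` cbox (a + c) (b + c))"
    using assms by (intro has_integral_affinity) auto
  moreover have "(\<lambda>x. x - c) ` {a + c..b + c} = {a..b}"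
    using image_add_atLeastAtMost[of "- c" "a + c" "b + c"] by simp
  ultimately show ?thesis by simp
qed

text \<open>The angle along a path may run through several turns, while x on the circle is described
  by one period; summing over translates brings the integral back to a single period.\<close>

lemma has_integral_fold_periods:
  fixes G :: "real \<Rightarrow> real" and a b :: int
  assumes "a \<le> b" "p > 0" "(G has_integral I) {p * of_int a..p * of_int b}"
  shows "((\<lambda>x. \<Sum>k\<in>{a..<b}. G (x + p * of_int k)) has_integral I) {0..p}"
  using assms(1,3)
proof (induction b arbitrary: I rule: int_ge_induct)
  case base
  hence "I = 0" by (metis box_real(2) has_integral_unique has_integral_refl(1))
  thus ?case by simp
next
  case (step b)
  have le: "p * of_int a \<le> p * of_int b" "p * of_int b \<le> p * of_int (b + 1)"
    using assms(2) step.hyps by (auto intro!: mult_left_mono)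
  have "G integrable_on {p * of_int a..p * of_int (b + 1)}" using step.prems by auto
  hence i1: "G integrable_on {p * of_int a..p * of_int b}" and i2: "G integrable_on {p * of_int b..p * of_int (b + 1)}"
    using le by (auto intro: integrable_on_subinterval)
  define I1 I2 where "I1 = integral {p * of_int a..p * of_int b} G"
    and "I2 = integral {p * of_int b..p * of_int (b + 1)} G"
  have h1: "(G has_integral I1) {p * of_int a..p * of_int b}"
    and h2: "(G has_integral I2) {p * of_int b..p * of_int (b + 1)}"
    using i1 i2 by (auto simp: I1_def I2_def intro: integrable_integral)
  have "I = I1 + I2"
    using has_integral_combine[OF le h1 h2] step.prems has_integral_unique by blast
  moreover have "((\<lambda>x. G (x + p * of_int b)) has_integral I2) {0..p}"
    using h2 by (intro has_integral_shift_real) (simp add: algebra_simps)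
  from has_integral_add[OF step.IH[OF h1] this]
  have "((\<lambda>x. (\<Sum>k\<in>{a..<b}. G (x + p * of_int k)) + G (x + p * of_int b)) has_integral (I1 + I2)) {0..p}" .
  moreover have "{a..<b + 1} = insert b {a..<b}" using step.hyps by auto
  ultimately show ?case by (simp add: add.commute)
qed

context locus_path
begin

definition L where "L s = ln (cmod (factored_eval lam2 S \<beta> m (h s)))"

lemma L_nonneg: "s \<in> {0..1} - exc2 \<Longrightarrow> L s \<ge> 0"
  using g_eval(2)[of s] by (simp add: L_def)

text \<open>Substitution of the angle for the path parameter, followed by folding modulo 2\<pi>: the
  sum collects all parameters of the path above the same point \<open>cis x\<close>.\<close>

lemma folded_integral:
  "((\<lambda>x. \<Sum>s\<in>{s\<in>{0..1} - exc2. cis (\<theta> s) = cis x}. L s) has_integral bracket) {0..2 * pi}"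
proof -
  define A where "A = {0..1} - exc2"
  define G0 where "G0 = (\<lambda>x. L (inv_into A \<theta> x))"
  define G where "G = (\<lambda>x. if x \<in> \<theta> ` A then G0 x else 0)"
  have injA: "inj_on \<theta> A" using inj_\<theta> by (rule inj_on_subset) (auto simp: A_def)
  have inv: "inv_into A \<theta> (\<theta> s) = s" if "s \<in> A" for s using injA that by simp
  have bI: "((\<lambda>s. L s * \<theta>' s) has_integral bracket) A"
  proof (rule has_integral_spike_set_eq[THEN iffD1, OF _ _ bracket_has_integral[folded L_def]])
    show "negligible {x \<in> {0..1} - A. L x * \<theta>' x \<noteq> 0}"
      by (rule negligible_subset[OF negligible_finite[OF finite_exc2]]) (auto simp: A_def)
    show "negligible {x \<in> A - {0..1}. L x * \<theta>' x \<noteq> 0}"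
      by (rule negligible_subset[OF negligible_empty]) (auto simp: A_def)
  qed
  have bI': "((\<lambda>s. \<bar>\<theta>' s\<bar> * G0 (\<theta> s)) has_integral bracket) A"
    by (rule has_integral_eq[OF _ bI])
       (use inv \<theta>'_nonneg exc2_exc in \<open>auto simp: G0_def A_def\<close>)
  \<comment> \<open>As log |g| is nonnegative on the locus, so is the integrand; this upgrades the
    Henstock-Kurzweil integral to an absolute one, as the change of variables requires.\<close>
  have "(\<lambda>s. \<bar>\<theta>' s\<bar> * G0 (\<theta> s)) absolutely_integrable_on A"
  proof (rule nonnegative_absolutely_integrable_1)
    show "(\<lambda>s. \<bar>\<theta>' s\<bar> * G0 (\<theta> s)) integrable_on A" using bI' by blast
    show "0 \<le> \<bar>\<theta>' s\<bar> * G0 (\<theta> s)" if "s \<in> A" for s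
      using that inv L_nonneg by (auto simp: G0_def A_def)
  qed
  hence "(\<lambda>s. \<bar>\<theta>' s\<bar> * G0 (\<theta> s)) absolutely_integrable_on A \<and> integral A (\<lambda>s. \<bar>\<theta>' s\<bar> * G0 (\<theta> s)) = bracket"
    using bI' by (simp add: integral_unique)
  moreover have "A \<in> sets lebesgue" unfolding A_def using finite_exc2
    by (intro sets.Diff) (auto intro!: negligible_imp_sets negligible_finite)
  moreover have "(\<theta> has_field_derivative \<theta>' s) (at s within A)" if "s \<in> A" for s
    using \<theta>_deriv[OF exc2_exc, of s] that
    by (simp add: A_def has_real_derivative_iff_has_vector_derivative has_vector_derivative_at_within)
  ultimately have "G0 absolutely_integrable_on (\<theta> ` A) \<and> integral (\<theta> ` A) G0 = bracket"
    using has_absolute_integral_change_of_variables_1'[of A \<theta> \<theta>' G0 bracket] injA by blast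
  hence "G0 integrable_on (\<theta> ` A)" "integral (\<theta> ` A) G0 = bracket"
    using set_lebesgue_integral_eq_integral(1) by auto
  hence G0I: "(G0 has_integral bracket) (\<theta> ` A)"
    using integrable_integral[of G0 "\<theta> ` A"] by simp
  \<comment> \<open>All values of \<open>\<theta>\<close> lie strictly within \<open>M\<close>
    periods on either side of 0; the added 1 makes the bound strict.\<close>
  define M :: int where "M = \<lceil>(\<bar>\<theta> 0\<bar> + \<bar>\<theta> 1\<bar>) / (2 * pi)\<rceil> + 1"
  have "(\<bar>\<theta> 0\<bar> + \<bar>\<theta> 1\<bar>) / (2 * pi) < of_int M" unfolding M_def by linarith
  hence M: "\<bar>\<theta> 0\<bar> + \<bar>\<theta> 1\<bar> < 2 * pi * of_int M" by (simp add: field_simps)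
  have "0 < 2 * pi * of_int M" using M by linarith
  hence M0: "M \<ge> 0" by (simp add: zero_less_mult_iff)
  have bnd: "\<bar>\<theta> s\<bar> < 2 * pi * of_int M" if "s \<in> {0..1}" for s
    using mono_onD[OF strict_mono_on_imp_mono_on[OF mono_\<theta>], of 0 s]
      mono_onD[OF strict_mono_on_imp_mono_on[OF mono_\<theta>], of s 1] that M by auto
  have "(G has_integral bracket) {2 * pi * of_int (- M)..2 * pi * of_int M}"
    unfolding G_def
  proof (subst has_integral_restrict)
    show "\<theta> ` A \<subseteq> {2 * pi * real_of_int (- M)..2 * pi * real_of_int M}"
    proof
      fix y assume "y \<in> \<theta> ` A"
      then obtain s where "s \<in> {0..1}" "y = \<theta> s" by (auto simp: A_def)
      thus "y \<in> {2 * pi * real_of_int (- M)..2 * pi * real_of_int M}" using bnd[of s] by auto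
    qed
  qed (rule G0I)
  hence I: "((\<lambda>x. \<Sum>k\<in>{- M..<M}. G (x + 2 * pi * of_int k)) has_integral bracket) {0..2 * pi}"
    using M0 by (intro has_integral_fold_periods) auto
  show ?thesis
  \<comment> \<open>The angle 2\<pi> gives the same point as 0 and is dropped: for 0 \<le> x <
    2\<pi> the floor of \<open>\<theta> s / (2 * pi)\<close> identifies the translate, which makes
    the reindexing below a bijection.\<close>
  proof (rule has_integral_spike_finite[of "{2 * pi}", OF _ _ I])
    fix x :: real assume x: "x \<in> {0..2 * pi} - {2 * pi}"
    define K where "K = {k\<in>{- M..<M}. x + 2 * pi * of_int k \<in> \<theta> ` A}"
    have fl: "\<lfloor>(x + 2 * pi * of_int k) / (2 * pi)\<rfloor> = k" for k
    proof -
      have "(x + 2 * pi * of_int k) / (2 * pi) = x / (2 * pi) + of_int k" by (simp add: field_simps)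
      moreover have "0 \<le> x / (2 * pi)" "x / (2 * pi) < 1" using x by (auto simp: field_simps)
      ultimately show ?thesis by (simp add: floor_eq_iff)
    qed
    have "(\<Sum>k\<in>{- M..<M}. G (x + 2 * pi * of_int k)) = (\<Sum>k\<in>K. G0 (x + 2 * pi * of_int k))"
      by (rule sum.mono_neutral_cong_right) (auto simp: K_def G_def)
    also have "\<dots> = (\<Sum>s\<in>{s\<in>A. cis (\<theta> s) = cis x}. L s)"
    proof (rule sum.reindex_bij_witness[where j = "\<lambda>k. inv_into A \<theta> (x + 2 * pi * of_int k)"
          and i = "\<lambda>s. \<lfloor>\<theta> s / (2 * pi)\<rfloor>"])
      fix k assume k: "k \<in> K"
      then obtain s where s: "s \<in> A" "x + 2 * pi * of_int k = \<theta> s" by (auto simp: K_def)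
      show "inv_into A \<theta> (x + 2 * pi * of_int k) \<in> {s\<in>A. cis (\<theta> s) = cis x}"
        using s inv[OF s(1)] by (auto simp: s(2)[symmetric] cis_eq_iff)
      show "\<lfloor>\<theta> (inv_into A \<theta> (x + 2 * pi * of_int k)) / (2 * pi)\<rfloor> = k"
        using fl[of k] inv[OF s(1)] s(2) by simp
      show "L (inv_into A \<theta> (x + 2 * pi * of_int k)) = G0 (x + 2 * pi * of_int k)"
        by (simp add: G0_def)
    next
      fix s assume s: "s \<in> {s\<in>A. cis (\<theta> s) = cis x}"
      then obtain k :: int where k: "\<theta> s = x + 2 * pi * of_int k" by (auto simp: cis_eq_iff)
      have fk: "\<lfloor>\<theta> s / (2 * pi)\<rfloor> = k" using fl[of k] k by simp
      have b: "\<bar>x + 2 * pi * of_int k\<bar> < 2 * pi * of_int M"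
        using bnd[of s] s k by (auto simp: A_def)
      have b': "x + 2 * pi * of_int k < 2 * pi * of_int M" "- (x + 2 * pi * of_int k) < 2 * pi * of_int M"
        using b by linarith+
      have x': "0 \<le> x" "x < 2 * pi" using x by auto
      have "2 * pi * of_int k < 2 * pi * of_int M" using b'(1) x'(1) by linarith
      hence k1: "k < M" by simp
      have "2 * pi * (of_int k + 1) > 2 * pi * of_int (- M)"
        using b'(2) x'(2) by (simp add: algebra_simps)
      hence "of_int k + 1 > real_of_int (- M)"
        by (subst (asm) mult_less_cancel_left_pos) auto
      hence k2: "- M \<le> k" by linarith
      have "x + 2 * pi * of_int k \<in> \<theta> ` A" unfolding k[symmetric] using s by blast
      thus "\<lfloor>\<theta> s / (2 * pi)\<rfloor> \<in> K" unfolding fk K_def using k1 k2 by simp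
      show "inv_into A \<theta> (x + 2 * pi * of_int \<lfloor>\<theta> s / (2 * pi)\<rfloor>) = s"
        unfolding fk k[symmetric] using s inv by auto
    qed
    finally show "(\<Sum>s\<in>{s\<in>{0..1} - exc2. cis (\<theta> s) = cis x}. L s) =
      (\<Sum>k\<in>{- M..<M}. G (x + 2 * pi * of_int k))" by (simp add: A_def)
  qed simp
qed

end

section \<open>The Mahler measure as a fibre integral\<close>

context locus_path
begin

text \<open>The exceptional set is hidden behind a quantifier so that the result can be used for all
  paths at once, outside the locale.\<close>

lemma folded_bracket:
  "\<exists>X. finite X \<and> (\<forall>s\<in>{0..1} - X. \<exists>y. ratfun_at gr (\<gamma> s) = Some y \<and> 1 \<le> cmod y) \<and>
     ((\<lambda>x. \<Sum>s\<in>{s\<in>{0..1} - X. cis (\<theta> s) = cis x}. ln (cmod (the (ratfun_at gr (\<gamma> s))))) has_integral bracket) {0..2 * pi}"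
proof (intro exI[of _ exc2] conjI finite_exc2)
  show "\<forall>s\<in>{0..1} - exc2. \<exists>y. ratfun_at gr (\<gamma> s) = Some y \<and> 1 \<le> cmod y"
    using g_eval by blast
  have "(\<lambda>x. \<Sum>s\<in>{s\<in>{0..1} - exc2. cis (\<theta> s) = cis x}. ln (cmod (the (ratfun_at gr (\<gamma> s))))) =
     (\<lambda>x. \<Sum>s\<in>{s\<in>{0..1} - exc2. cis (\<theta> s) = cis x}. L s)"
    by (intro ext sum.cong refl) (simp add: g_eval(1) L_def)
  thus "((\<lambda>x. \<Sum>s\<in>{s\<in>{0..1} - exc2. cis (\<theta> s) = cis x}. ln (cmod (the (ratfun_at gr (\<gamma> s))))) has_integral bracket) {0..2 * pi}"
    using folded_integral by simp
qed

end

section \<open>Fubini on the torus\<close>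

lemma continuous_on_eval2_torus:
  "continuous_on UNIV (\<lambda>p. eval2 P (cis (fst p)) (cis (snd p)))"
  unfolding eval2_altdef by (intro continuous_intros)

text \<open>\<open>N\<close> is given only through its Henstock-Kurzweil integral, so the
  integrability of log |P| on the torus is derived without integrating it: an upper bound
  \<open>M\<close> for log |P| and the sign of \<open>N\<close> bound the inner integral of the
  absolute value by a constant plus a multiple of \<open>\<bar>lam x\<bar>\<close>.\<close>

lemma mahler2_fibre_integral:
  fixes N :: "real \<Rightarrow> real"
  assumes P0: "P \<noteq> 0" and Z: "finite Z"
    and fibre: "\<And>x. cis x \<notin> Z \<Longrightarrow> specialize P (cis x) \<noteq> 0 \<and>
       (LINT y:{0..2*pi}|lborel. ln (cmod (eval2 P (cis x) (cis y)))) =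
         2 * pi * ln (cmod (poly (lead_coeff P) (cis x))) + 2 * pi * N x \<and> N x \<ge> 0"
    and N: "(N has_integral B) {0..2*pi}"
  shows "2 * pi * mahler2 P = 2 * pi * mahler1 (lead_coeff P) + B"
proof -
  define A where "A = {0..2*pi}"
  define u where "u = (\<lambda>x y. ln (cmod (eval2 P (cis x) (cis y))))"
  define F where "F = (\<lambda>p. indicator (A \<times> A) p * u (fst p) (snd p))"
  define lam where "lam = (\<lambda>x. ln (cmod (poly (lead_coeff P) (cis x))))"
  define \<Lambda> where "\<Lambda> = (LINT x:A|lborel. lam x)"
  have lam0: "lead_coeff P \<noteq> 0" using P0 by simp
  have lam_int: "set_integrable lborel A lam"
    unfolding A_def lam_def by (rule jensen_poly(1)[OF lam0])
  have u_int: "set_integrable lborel A (u x)" and u_val: "(LINT y:A|lborel. u x y) = 2 * pi * lam x + 2 * pi * N x"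
    and N0: "N x \<ge> 0" if "cis x \<notin> Z" for x
    using fibre[OF that] jensen_poly(1)[of "specialize P (cis x)"]
    by (auto simp: A_def u_def lam_def poly_specialize)
  have "bounded ((\<lambda>p. eval2 P (cis (fst p)) (cis (snd p))) ` (A \<times> A))"
    unfolding A_def
    by (intro compact_imp_bounded compact_continuous_image compact_Times
        continuous_on_subset[OF continuous_on_eval2_torus]) auto
  then obtain C where C: "\<And>x y. x \<in> A \<Longrightarrow> y \<in> A \<Longrightarrow> cmod (eval2 P (cis x) (cis y)) \<le> C"
    unfolding bounded_iff by auto
  \<comment> \<open>The maximum with 1 makes \<open>M\<close> nonnegative, so that
    \<open>u x y \<le> M\<close> holds also at zeros of \<open>P\<close>, where the logarithm is 0
    by convention.\<close>
  define M where "M = ln (max 1 C)"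
  have M0: "M \<ge> 0" by (simp add: M_def)
  have uM: "u x y \<le> M" if "x \<in> A" "y \<in> A" for x y
  proof (cases "eval2 P (cis x) (cis y) = 0")
    case True thus ?thesis using M0 by (simp add: u_def)
  next
    case False
    thus ?thesis using C[OF that] unfolding u_def M_def by (subst ln_le_cancel_iff) auto
  qed
  \<comment> \<open>Turns the upper bound and the known integral of \<open>u x\<close> into a bound
    for the integral of its absolute value.\<close>
  have abs_u: "\<bar>u x y\<bar> \<le> 2 * M - u x y" if "x \<in> A" "y \<in> A" for x y
    using uM[OF that] M0 by auto
  have meas_F: "F \<in> borel_measurable (lborel \<Otimes>\<^sub>M lborel)"
  proof -
    have "(\<lambda>p. cmod (eval2 P (cis (fst p)) (cis (snd p)))) \<in> borel_measurable borel"
      by (intro borel_measurable_continuous_onI continuous_intros continuous_on_eval2_torus)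
    hence "(\<lambda>p. u (fst p) (snd p)) \<in> borel_measurable borel" unfolding u_def by measurable
    moreover have "A \<times> A \<in> sets borel" unfolding A_def by (intro borel_closed closed_Times) auto
    ultimately have "F \<in> borel_measurable borel" unfolding F_def by (intro borel_measurable_times) auto
    thus ?thesis by (simp add: lborel_prod)
  qed
  have const: "set_integrable lborel A (\<lambda>_. c)" "(LINT x:A|lborel. c) = 2 * pi * c" for c :: real
    by (auto simp: A_def set_integrable_def set_lebesgue_integral_def)
  have F_eq: "F (x, y) = indicator A x * (indicator A y * u x y)" for x y
    by (simp add: F_def indicator_times)
  have ae: "AE x in lborel. x \<in> A \<longrightarrow> cis x \<notin> Z"
    unfolding A_def by (rule AE_cis_notin[OF Z])
  have F_int: "integrable (lborel \<Otimes>\<^sub>M lborel) F"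
  proof (rule lborel_pair.Fubini_integrable[OF meas_F])
    show "AE x in lborel. integrable lborel (\<lambda>y. F (x, y))"
      using ae
    proof eventually_elim
      case (elim x)
      thus ?case using u_int[of x] by (cases "x \<in> A") (auto simp: F_eq set_integrable_def)
    qed
    show "integrable lborel (\<lambda>x. \<integral>y. norm (F (x, y)) \<partial>lborel)"
    proof (rule Bochner_Integration.integrable_bound)
      show "integrable lborel (\<lambda>x. indicator A x * (4 * pi * M + 2 * pi * \<bar>lam x\<bar>))"
        using set_integral_add(1)[OF const(1)[of "4 * pi * M"] set_integrable_mult_right[OF set_integrable_abs[OF lam_int], of "2 * pi"]]
        by (simp add: set_integrable_def)
      show "(\<lambda>x. \<integral>y. norm (F (x, y)) \<partial>lborel) \<in> borel_measurable lborel"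
        using meas_F by measurable
      show "AE x in lborel. norm (\<integral>y. norm (F (x, y)) \<partial>lborel) \<le>
          norm (indicator A x * (4 * pi * M + 2 * pi * \<bar>lam x\<bar>))"
        using ae
      proof eventually_elim
        case (elim x)
        show ?case
        proof (cases "x \<in> A")
          case False thus ?thesis by (simp add: F_eq)
        next
          case True
          hence x: "cis x \<notin> Z" using elim by simp
          have i2: "set_integrable lborel A (\<lambda>y. 2 * M - u x y)"
            by (intro set_integral_diff const u_int x)
          have "(\<integral>y. norm (F (x, y)) \<partial>lborel) = (LINT y:A|lborel. \<bar>u x y\<bar>)"
            using True by (simp add: F_eq set_lebesgue_integral_def abs_mult)
          also have "\<dots> \<le> (LINT y:A|lborel. 2 * M - u x y)"
            using abs_u True by (intro set_integral_mono set_integrable_abs u_int x i2) auto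
          also have "\<dots> = 4 * pi * M - (2 * pi * lam x + 2 * pi * N x)"
            using set_integral_diff(2)[OF const(1)[of "2 * M"] u_int[OF x]] const(2)[of "2 * M"] u_val[OF x] by simp
          also have "\<dots> \<le> 4 * pi * M + 2 * pi * \<bar>lam x\<bar>"
          proof -
            have "2 * pi * N x \<ge> 0" using N0[OF x] by simp
            moreover have "2 * pi * - lam x \<le> 2 * pi * \<bar>lam x\<bar>" by (intro mult_left_mono) auto
            ultimately show ?thesis by simp
          qed
          finally have le: "(\<integral>y. norm (F (x, y)) \<partial>lborel) \<le> 4 * pi * M + 2 * pi * \<bar>lam x\<bar>" .
          moreover have "(\<integral>y. norm (F (x, y)) \<partial>lborel) \<ge> 0" by simp
          ultimately show ?thesis using True by simp
        qed
      qed
    qed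
  qed
  \<comment> \<open>The iterated integral and the fibre formula are now compared as
    Henstock-Kurzweil integrals of the same inner function, a setting in which \<open>N\<close> is
    admissible.\<close>
  define I where "I = integral\<^sup>L (lborel \<Otimes>\<^sub>M lborel) F"
  have "((\<lambda>x. \<integral>y. F (x, y) \<partial>lborel) has_integral (\<integral>x. \<integral>y. F (x, y) \<partial>lborel \<partial>lborel)) UNIV"
    by (rule has_integral_integral_lborel[OF lborel_pair.integrable_fst'[OF F_int]])
  hence hI: "((\<lambda>x. \<integral>y. F (x, y) \<partial>lborel) has_integral I) UNIV"
    unfolding I_def lborel_pair.integral_fst'[OF F_int] .
  have "(lam has_integral \<Lambda>) A"
    using set_borel_integral_eq_integral[OF lam_int] by (simp add: \<Lambda>_def integrable_integral)
  hence "((\<lambda>x. 2 * pi * lam x + 2 * pi * N x) has_integral (2 * pi * \<Lambda> + 2 * pi * B)) A"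
    using N unfolding A_def by (intro has_integral_add has_integral_mult_right)
  hence "((\<lambda>x. if x \<in> A then 2 * pi * lam x + 2 * pi * N x else 0) has_integral (2 * pi * \<Lambda> + 2 * pi * B)) UNIV"
    by (simp add: has_integral_restrict_UNIV)
  hence "((\<lambda>x. \<integral>y. F (x, y) \<partial>lborel) has_integral (2 * pi * \<Lambda> + 2 * pi * B)) UNIV"
  proof (rule has_integral_spike_finite[OF finite_cis_in[OF Z, of 0 "2*pi"], rotated])
    fix x assume x: "x \<in> UNIV - {x \<in> {0..2*pi}. cis x \<in> Z}"
    show "(\<integral>y. F (x, y) \<partial>lborel) = (if x \<in> A then 2 * pi * lam x + 2 * pi * N x else 0)"
    proof (cases "x \<in> A")
      case False thus ?thesis by (simp add: F_eq)
    next
      case True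
      hence "cis x \<notin> Z" using x by (auto simp: A_def)
      from u_val[OF this] True show ?thesis by (simp add: F_eq set_lebesgue_integral_def)
    qed
  qed
  with hI have I: "I = 2 * pi * \<Lambda> + 2 * pi * B" by (rule has_integral_unique)
  have "mahler2 P = 1 / (2 * pi) ^ 2 * I"
    unfolding mahler2_def I_def set_lebesgue_integral_def F_def u_def A_def by (simp add: lborel_prod)
  moreover have "I = 2 * pi * (\<Lambda> + B)" by (simp add: I distrib_left)
  moreover have "k * (1 / k ^ 2 * (k * x)) = x" if "k \<noteq> 0" for k x :: real
    using that by (simp add: power2_eq_square)
  ultimately have "2 * pi * mahler2 P = \<Lambda> + B" by simp
  moreover have "2 * pi * mahler1 (lead_coeff P) = \<Lambda>"
    by (simp add: mahler1_def \<Lambda>_def A_def lam_def)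
  ultimately show ?thesis by simp
qed

theorem theorem2:
  fixes P :: "complex poly poly"
    and f g :: "complex poly fract"
    and lam1 lam2 :: complex
    and R S n :: nat
    and \<alpha> \<beta> :: "nat \<Rightarrow> complex"
    and l m :: "nat \<Rightarrow> int"
    and \<gamma> :: "nat \<Rightarrow> real \<Rightarrow> complex option"
    and u v :: "nat \<Rightarrow> complex option"
  assumes "lam1 \<noteq> 0" and "lam2 \<noteq> 0"
    and "inj_on \<alpha> {..<R}" and "inj_on \<beta> {..<S}"
    and "\<And>r. r < R \<Longrightarrow> l r \<noteq> 0" and "\<And>s. s < S \<Longrightarrow> m s \<noteq> 0"
    and "f = factored_fract lam1 R \<alpha> l"
    and "g = factored_fract lam2 S \<beta> m"
    and "parametrized_by P f g"
    and "paths_comprising f g n \<gamma>"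
    and "\<And>j. j < n \<Longrightarrow> u j = \<gamma> j 0"
    and "\<And>j. j < n \<Longrightarrow> v j = \<gamma> j 1"
  shows "2 * pi * mahler2 P =
    2 * pi * mahler1 (lead_coeff P) +
    (\<Sum>j<n.
       (\<Sum>(r, s)\<in>{(r, s). r < R \<and> s < S \<and> \<alpha> r \<noteq> \<beta> s}.
          of_int (l r * m s) *
          (bloch_wigner (map_option (\<lambda>t. (t - \<alpha> r) / (\<beta> s - \<alpha> r)) (u j)) -
           bloch_wigner (map_option (\<lambda>t. (t - \<alpha> r) / (\<beta> s - \<alpha> r)) (v j))))
       + (\<Sum>r<R. of_int (l r) * ln (cmod (tilde_at lam2 S \<beta> m (\<alpha> r))) * wind (\<gamma> j) (\<alpha> r))
       - (\<Sum>s<S. of_int (m s) * ln (cmod (tilde_at lam1 R \<alpha> l (\<beta> s))) * wind (\<gamma> j) (\<beta> s)))"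
proof -
  define U where "U = unit_locus f g"
  define E where "E = {t \<in> U. \<not> (\<exists>!(j, s). j < n \<and> s \<in> {0..1} \<and> \<gamma> j s = t)}"
  have finE: "finite E" and paths: "\<And>j. j < n \<Longrightarrow> sphere_path (\<gamma> j) \<and> oriented_via f (\<gamma> j) \<and> \<gamma> j ` {0..1} \<subseteq> U"
    using assms(10) by (auto simp: paths_comprising_def E_def U_def)
  have "\<forall>j. \<exists>\<theta>::real \<Rightarrow> real. j < n \<longrightarrow> continuous_on {0..1} \<theta> \<and> strict_mono_on {0..1} \<theta> \<and>
        (\<forall>s\<in>{0..1}. ratfun_at f (\<gamma> j s) = Some (cis (\<theta> s)))"
    using paths unfolding oriented_via_def by blast
  from choice[OF this] obtain \<theta> where \<theta>0: "\<forall>j. j < n \<longrightarrow> continuous_on {0..1} (\<theta> j) \<and> strict_mono_on {0..1} (\<theta> j) \<and>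
        (\<forall>s\<in>{0..1}. ratfun_at f (\<gamma> j s) = Some (cis (\<theta> j s)))" ..
  have \<theta>: "\<And>j. j < n \<Longrightarrow> continuous_on {0..1} (\<theta> j)"
     "\<And>j. j < n \<Longrightarrow> strict_mono_on {0..1} (\<theta> j)"
     "\<And>j s. j < n \<Longrightarrow> s \<in> {0..1} \<Longrightarrow> ratfun_at f (\<gamma> j s) = Some (cis (\<theta> j s))"
    using \<theta>0 by blast+
  have lp: "locus_path lam1 R \<alpha> l (\<gamma> j) (\<theta> j) lam2 S \<beta> m" if j: "j < n" for j
    using assms(1-8) paths[OF j] \<theta>[OF j] by unfold_locales (auto simp: U_def)
  define br where "br = (\<lambda>j. (\<Sum>(r, s)\<in>{(r, s). r < R \<and> s < S \<and> \<alpha> r \<noteq> \<beta> s}.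
          of_int (l r * m s) *
          (bloch_wigner (map_option (\<lambda>t. (t - \<alpha> r) / (\<beta> s - \<alpha> r)) (\<gamma> j 0)) -
           bloch_wigner (map_option (\<lambda>t. (t - \<alpha> r) / (\<beta> s - \<alpha> r)) (\<gamma> j 1))))
       + (\<Sum>r<R. of_int (l r) * ln (cmod (tilde_at lam2 S \<beta> m (\<alpha> r))) * wind (\<gamma> j) (\<alpha> r))
       - (\<Sum>s<S. of_int (m s) * ln (cmod (tilde_at lam1 R \<alpha> l (\<beta> s))) * wind (\<gamma> j) (\<beta> s)))"
  have "\<forall>j. \<exists>X. j < n \<longrightarrow> finite X \<and> (\<forall>s\<in>{0..1} - X. \<exists>y. ratfun_at g (\<gamma> j s) = Some y \<and> 1 \<le> cmod y) \<and>
     ((\<lambda>x. \<Sum>s\<in>{s\<in>{0..1} - X. cis (\<theta> j s) = cis x}. ln (cmod (the (ratfun_at g (\<gamma> j s))))) has_integral br j) {0..2 * pi}"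
  proof
    fix j
    show "\<exists>X. j < n \<longrightarrow> finite X \<and> (\<forall>s\<in>{0..1} - X. \<exists>y. ratfun_at g (\<gamma> j s) = Some y \<and> 1 \<le> cmod y) \<and>
     ((\<lambda>x. \<Sum>s\<in>{s\<in>{0..1} - X. cis (\<theta> j s) = cis x}. ln (cmod (the (ratfun_at g (\<gamma> j s))))) has_integral br j) {0..2 * pi}"
    proof (cases "j < n")
      case True
      show ?thesis
        using locus_path.folded_bracket[OF lp[OF True], unfolded locus_path.bracket_def[OF lp[OF True]]]
        unfolding assms(8) br_def by blast
    qed auto
  qed
  from choice[OF this] obtain X where X0: "\<forall>j. j < n \<longrightarrow> finite (X j) \<and> (\<forall>s\<in>{0..1} - X j. \<exists>y. ratfun_at g (\<gamma> j s) = Some y \<and> 1 \<le> cmod y) \<and>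
     ((\<lambda>x. \<Sum>s\<in>{s\<in>{0..1} - X j. cis (\<theta> j s) = cis x}. ln (cmod (the (ratfun_at g (\<gamma> j s))))) has_integral br j) {0..2 * pi}" ..
  have X: "\<And>j. j < n \<Longrightarrow> finite (X j)"
      "\<And>j s. j < n \<Longrightarrow> s \<in> {0..1} - X j \<Longrightarrow> \<exists>y. ratfun_at g (\<gamma> j s) = Some y \<and> 1 \<le> cmod y"
      "\<And>j. j < n \<Longrightarrow> ((\<lambda>x. \<Sum>s\<in>{s\<in>{0..1} - X j. cis (\<theta> j s) = cis x}. ln (cmod (the (ratfun_at g (\<gamma> j s))))) has_integral br j) {0..2 * pi}"
    using X0 by blast+
  define N where "N = (\<lambda>x. \<Sum>j<n. \<Sum>s\<in>{s\<in>{0..1} - X j. cis (\<theta> j s) = cis x}. ln (cmod (the (ratfun_at g (\<gamma> j s)))))"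
  have N_int: "(N has_integral (\<Sum>j<n. br j)) {0..2*pi}"
    unfolding N_def using X(3) by (intro has_integral_sum) auto
  obtain Z where Z: "finite Z"
    "\<And>x. x \<notin> Z \<Longrightarrow> poly (lead_coeff P) x \<noteq> 0"
    "\<And>x. x \<notin> Z \<Longrightarrow> bij_betw (\<lambda>t. the (ratfun_at g t)) {t. ratfun_at f t = Some x} {y. eval2 P x y = 0}"
    "\<And>x t. x \<notin> Z \<Longrightarrow> ratfun_at f t = Some x \<Longrightarrow> ratfun_at g t \<noteq> None"
    "\<And>x y. x \<notin> Z \<Longrightarrow> eval2 P x y = 0 \<Longrightarrow> order y (specialize P x) = 1"
    using parametrized_fibre[OF assms(9)] by metis
  \<comment> \<open>Besides the irregular fibres, the x-values of the finitely many excluded path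
    parameters and of the locus points not passed exactly once are removed. Over any other x on the
    circle the paths list the locus without omission or repetition.\<close>
  define Z' where "Z' = Z \<union> (\<Union>j<n. (\<lambda>s. cis (\<theta> j s)) ` X j) \<union> (\<lambda>t. the (ratfun_at f t)) ` E"
  have finZ': "finite Z'" unfolding Z'_def using Z(1) X(1) finE by auto
  have P0: "P \<noteq> 0" using assms(9) by (auto simp: parametrized_by_def)
  have fibre: "specialize P (cis x) \<noteq> 0 \<and>
       (LINT y:{0..2*pi}|lborel. ln (cmod (eval2 P (cis x) (cis y)))) =
         2 * pi * ln (cmod (poly (lead_coeff P) (cis x))) + 2 * pi * N x \<and> N x \<ge> 0"
    if x: "cis x \<notin> Z'" for x
  proof -
    have xZ: "cis x \<notin> Z" using x by (simp add: Z'_def)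
    define p where "p = specialize P (cis x)"
    have lead: "lead_coeff p = poly (lead_coeff P) (cis x)"
      unfolding p_def by (rule lead_coeff_specialize(2)[OF Z(2)[OF xZ]])
    have p0: "p \<noteq> 0" using lead Z(2)[OF xZ] by auto
    define T where "T = {t. ratfun_at f t = Some (cis x)}"
    define J where "J = (SIGMA j:{..<n}. {s\<in>{0..1} - X j. cis (\<theta> j s) = cis x})"
    have roots: "{y. eval2 P (cis x) y = 0} = {y. poly p y = 0}" by (simp add: p_def poly_specialize)
    have finT: "finite T"
      using bij_betw_finite[OF Z(3)[OF xZ]] poly_roots_finite[OF p0] unfolding roots T_def by blast
    have TE: "t \<notin> E" if "t \<in> T" for t
    proof
      assume "t \<in> E"
      hence "the (ratfun_at f t) \<in> Z'" unfolding Z'_def by blast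
      thus False using that x by (simp add: T_def)
    qed
    have bij: "bij_betw (\<lambda>(j, s). \<gamma> j s) J (T \<inter> U)"
      unfolding bij_betw_def
    proof
      have into: "\<gamma> j s \<in> T \<inter> U" if "(j, s) \<in> J" for j s
        using that \<theta>(3)[of j s] paths[of j] by (auto simp: J_def T_def)
      have uniq: "\<exists>!q. case q of (j, s) \<Rightarrow> j < n \<and> s \<in> {0..1} \<and> \<gamma> j s = t" if "t \<in> T \<inter> U" for t
        using TE[of t] that by (auto simp: E_def)
      show "inj_on (\<lambda>(j, s). \<gamma> j s) J"
      proof (rule inj_onI)
        fix q q' assume q: "q \<in> J" "q' \<in> J" "(case q of (j, s) \<Rightarrow> \<gamma> j s) = (case q' of (j, s) \<Rightarrow> \<gamma> j s)"
        obtain j s j' s' where jj: "q = (j, s)" "q' = (j', s')" by (cases q, cases q') auto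
        have "\<gamma> j s \<in> T \<inter> U" using into q jj by auto
        from uniq[OF this] obtain p where
          p: "\<And>q. (case q of (i, r) \<Rightarrow> i < n \<and> r \<in> {0..1} \<and> \<gamma> i r = \<gamma> j s) \<Longrightarrow> q = p"
          by (elim ex1E) blast
        have "(j, s) = p" "(j', s') = p"
          by (rule p; use q in \<open>simp add: jj J_def\<close>)+
        thus "q = q'" by (simp add: jj)
      qed
      show "(\<lambda>(j, s). \<gamma> j s) ` J = T \<inter> U"
      proof
        show "(\<lambda>(j, s). \<gamma> j s) ` J \<subseteq> T \<inter> U" using into by auto
        show "T \<inter> U \<subseteq> (\<lambda>(j, s). \<gamma> j s) ` J"
        proof
          fix t assume t: "t \<in> T \<inter> U"
          from ex1_implies_ex[OF uniq[OF t]] obtain j s where js: "j < n" "s \<in> {0..1}" "\<gamma> j s = t" by auto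
          have c: "cis (\<theta> j s) = cis x" using \<theta>(3)[OF js(1,2)] js(3) t by (simp add: T_def)
          have "s \<notin> X j"
          proof
            assume "s \<in> X j"
            hence "cis (\<theta> j s) \<in> Z'" using js(1) unfolding Z'_def by blast
            thus False using c x by simp
          qed
          hence "(j, s) \<in> J" using js c by (simp add: J_def)
          thus "t \<in> (\<lambda>(j, s). \<gamma> j s) ` J" using js(3) by force
        qed
      qed
    qed
    have "N x = (\<Sum>(j, s)\<in>J. ln (cmod (the (ratfun_at g (\<gamma> j s)))))"
      unfolding N_def J_def
    proof (rule sum.Sigma)
      show "\<forall>j\<in>{..<n}. finite {s \<in> {0..1} - X j. cis (\<theta> j s) = cis x}"
      proof
        fix j assume "j \<in> {..<n}"
        hence j: "j < n" by simp
        interpret locus_path lam1 R \<alpha> l "\<gamma> j" "\<theta> j" lam2 S \<beta> m by (rule lp[OF j])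
        show "finite {s \<in> {0..1} - X j. cis (\<theta> j s) = cis x}"
          by (rule finite_subset[OF _ finite_cis_\<theta>[of "cis x"]]) auto
      qed
    qed simp
    also have "\<dots> = (\<Sum>t\<in>T \<inter> U. ln (cmod (the (ratfun_at g t))))"
      using sum.reindex_bij_betw[OF bij, of "\<lambda>t. ln (cmod (the (ratfun_at g t)))"]
      by (simp add: case_prod_unfold)
    \<comment> \<open>Points of the fibre outside the locus have |g| < 1 and add ln 1 = 0; this
      turns the sum over the paths into the sum of Jensen's formula.\<close>
    also have "\<dots> = (\<Sum>t\<in>T. ln (max 1 (cmod (the (ratfun_at g t)))))"
    proof (rule sum.mono_neutral_cong_left[OF finT])
      have Tval: "\<exists>y. ratfun_at g t = Some y \<and> (t \<in> U \<longleftrightarrow> 1 \<le> cmod y)" if "t \<in> T" for t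
        using Z(4)[OF xZ, of t] that by (auto simp: T_def U_def unit_locus_def)
      show "\<forall>t\<in>T - T \<inter> U. ln (max 1 (cmod (the (ratfun_at g t)))) = 0"
        using Tval by (fastforce simp: max_def)
      show "ln (cmod (the (ratfun_at g t))) = ln (max 1 (cmod (the (ratfun_at g t))))" if "t \<in> T \<inter> U" for t
        using Tval[of t] that by (auto simp: max_def)
    qed simp
    also have "\<dots> = (\<Sum>y\<in>{y. poly p y = 0}. ln (max 1 (cmod y)))"
      using sum.reindex_bij_betw[OF Z(3)[OF xZ], of "\<lambda>y. ln (max 1 (cmod y))"] unfolding T_def roots by simp
    \<comment> \<open>All roots over x are simple off \<open>Z\<close>, so the multiplicities in
      Jensen's formula are 1.\<close>
    also have "\<dots> = (\<Sum>y | poly p y = 0. of_nat (order y p) * ln (max 1 (cmod y)))"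
      using Z(5)[OF xZ] by (intro sum.cong refl) (simp add: p_def poly_specialize)
    finally have Nx: "N x = (\<Sum>y | poly p y = 0. of_nat (order y p) * ln (max 1 (cmod y)))" .
    hence "N x \<ge> 0" by (auto intro!: sum_nonneg)
    moreover have "(LINT y:{0..2*pi}|lborel. ln (cmod (eval2 P (cis x) (cis y)))) =
         2 * pi * ln (cmod (poly (lead_coeff P) (cis x))) + 2 * pi * N x"
      using jensen_poly(2)[OF p0] unfolding Nx[symmetric] lead by (simp add: p_def poly_specialize)
    ultimately show ?thesis using p0 by (simp add: p_def)
  qed
  have "2 * pi * mahler2 P = 2 * pi * mahler1 (lead_coeff P) + (\<Sum>j<n. br j)"
    by (rule mahler2_fibre_integral[OF P0 finZ' fibre N_int])
  moreover have "(\<Sum>j<n. br j) = (\<Sum>j<n.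
       (\<Sum>(r, s)\<in>{(r, s). r < R \<and> s < S \<and> \<alpha> r \<noteq> \<beta> s}.
          of_int (l r * m s) *
          (bloch_wigner (map_option (\<lambda>t. (t - \<alpha> r) / (\<beta> s - \<alpha> r)) (u j)) -
           bloch_wigner (map_option (\<lambda>t. (t - \<alpha> r) / (\<beta> s - \<alpha> r)) (v j))))
       + (\<Sum>r<R. of_int (l r) * ln (cmod (tilde_at lam2 S \<beta> m (\<alpha> r))) * wind (\<gamma> j) (\<alpha> r))
       - (\<Sum>s<S. of_int (m s) * ln (cmod (tilde_at lam1 R \<alpha> l (\<beta> s))) * wind (\<gamma> j) (\<beta> s)))"
    unfolding br_def using assms(11,12) by (intro sum.cong refl) (simp only: lessThan_iff)
  ultimately show ?thesis by (simp only:)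
qed

end
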